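(* Let $M^6$ be a complete, connected, orientable Riemannian manifold of dimension $6$ with constant (normalized) scalar curvature $R$, and let $f:M^6\to\mathbb{R}^7$ be an isometric immersion with positive constant mean curvature $H$ (with respect to a global unit normal vector field), non-negative $4$-th mean curvature ($H_4\geq 0$ everywhere) and non-positive $5$-th mean curvature ($H_5\leq 0$ everywhere). If $R=\frac{3}{5}H^2$ and the Gauss-Kronecker curvature satisfies $H_6\geq 0$ everywhere on $M^6$, then $f(M^6)=\mathbb{R}^4\times\mathbb{S}^2\left(\frac{1}{3|H|}\right)$.
   Context: For an isometric immersion $f:M^n\to\mathbb{R}^{n+1}$ of an orientable Riemannian manifold, let $A$ be the shape operator with respect to a global unit normal vector field $\xi$, and let $\lambda_1,\dots,\lambda_n$ be its eigenvalues (principal curvatures). The $r$-th mean curvature $H_r$ ($1\le r\le n$) is defined by $\binom{n}{r}H_r=\sum_{i_1<\cdots<i_r}\lambda_{i_1}\cdots\lambda_{i_r}$. Thus $H=H_1=\frac{1}{n}(\lambda_1+\cdots+\lambda_n)$ is the mean curvature and $H_n=\lambda_1\cdots\lambda_n$ is the Gauss-Kronecker curvature. The scalar curvature $R$ is the normalized (average) one: $R=\frac{2}{n(n-1)}\sum_{i<j}K(e_i,e_j)=\frac{2}{n(n-1)}\sum_{i<j}\lambda_i\lambda_j$, where $K(e_i,e_j)$ are sectional curvatures for an orthonormal frame of principal directions. $\mathbb{S}^k(r)$ denotes the round $k$-sphere of radius $r$ in $\mathbb{R}^{k+1}$, and $\mathbb{R}^{n-k}\times\mathbb{S}^k(r)\subset\mathbb{R}^{n-k}\times\mathbb{R}^{k+1}=\mathbb{R}^{n+1}$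 is the standard generalized cylinder; equalities such as $f(M^n)=\mathbb{R}^{n-k}\times\mathbb{S}^k(r)$ are understood up to a rigid motion of $\mathbb{R}^{n+1}$. *)

theory Defs
  imports "HOL-Analysis.Analysis"
begin

section \<open>Smooth maps between open subsets of Euclidean spaces\<close>

text \<open>Only used for open \<open>S\<close>, so that \<open>at x\<close> is the right filter.\<close>

primrec Ck_on :: "nat \<Rightarrow> 'a::euclidean_space set \<Rightarrow> ('a \<Rightarrow> 'b::real_normed_vector) \<Rightarrow> bool" where
  "Ck_on 0 S h \<longleftrightarrow> continuous_on S h"
| "Ck_on (Suc k) S h \<longleftrightarrow> (\<forall>x\<in>S. h differentiable (at x)) \<and>
     (\<forall>v. Ck_on k S (\<lambda>x. frechet_derivative h (at x) v))"

definition smooth_on :: "'a::euclidean_space set \<Rightarrow> ('a \<Rightarrow> 'b::real_normed_vector) \<Rightarrow> bool" where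
  "smooth_on S h \<longleftrightarrow> (\<forall>k. Ck_on k S h)"


section \<open>Smooth manifolds\<close>

text \<open>
  The underlying topological space is a type of class \<open>t2_space\<close> and \<open>second_countable_topology\<close>.
  A chart is a pair of a domain \<open>U\<close> and a coordinate map, whose values outside \<open>U\<close> are irrelevant.
\<close>

type_synonym ('m, 'n) chart = "'m set \<times> ('m \<Rightarrow> real^'n)"

definition chart_image :: "('m, 'n::finite) chart \<Rightarrow> (real^'n) set" where
  "chart_image c = snd c ` fst c"

definition chart_inv :: "('m, 'n::finite) chart \<Rightarrow> real^'n \<Rightarrow> 'm" where
  "chart_inv c = inv_into (fst c) (snd c)"

definition transition :: "('m, 'n::finite) chart \<Rightarrow> ('m, 'n) chart \<Rightarrow> real^'n \<Rightarrow> real^'n" where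
  "transition c d = snd d \<circ> chart_inv c"

definition smooth_atlas :: "('m::topological_space, 'n::finite) chart set \<Rightarrow> bool" where
  "smooth_atlas \<A> \<longleftrightarrow>
     (\<Union>c\<in>\<A>. fst c) = UNIV \<and>
     (\<forall>c\<in>\<A>. open (fst c) \<and> open (chart_image c) \<and>
        homeomorphism (fst c) (chart_image c) (snd c) (chart_inv c)) \<and>
     (\<forall>c\<in>\<A>. \<forall>d\<in>\<A>. smooth_on (snd c ` (fst c \<inter> fst d)) (transition c d))"

definition chart_at :: "('m, 'n) chart set \<Rightarrow> 'm \<Rightarrow> ('m, 'n) chart" where
  "chart_at \<A> p = (SOME c. c \<in> \<A> \<and> p \<in> fst c)"

definition jacobian :: "(real^'n \<Rightarrow> real^'m) \<Rightarrow> real^'n \<Rightarrow> real^'n^'m" where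
  "jacobian h x = matrix (frechet_derivative h (at x))"

text \<open>The given atlas need not be maximal, so an oriented atlas is only required to be compatible with it.\<close>

definition orientable :: "('m::topological_space, 'n::finite) chart set \<Rightarrow> bool" where
  "orientable \<A> \<longleftrightarrow> (\<exists>\<B>. smooth_atlas \<B> \<and> smooth_atlas (\<A> \<union> \<B>) \<and>
     (\<forall>c\<in>\<B>. \<forall>d\<in>\<B>. \<forall>x\<in>snd c ` (fst c \<inter> fst d). det (jacobian (transition c d) x) > 0))"

definition smooth_map ::
  "('m::topological_space, 'n::finite) chart set \<Rightarrow> ('m \<Rightarrow> 'e::euclidean_space) \<Rightarrow> bool" where
  "smooth_map \<A> h \<longleftrightarrow> (\<forall>c\<in>\<A>. smooth_on (chart_image c) (h \<circ> chart_inv c))"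

text \<open>
  A tangent vector at \<open>p\<close> is represented by its component vector \<open>u\<close> with respect to a chart \<open>c\<close>
  around \<open>p\<close>; this is the differential at \<open>p\<close> of a vector-valued function on the manifold.
\<close>

definition differential ::
  "('m, 'n::finite) chart \<Rightarrow> ('m \<Rightarrow> 'e::euclidean_space) \<Rightarrow> 'm \<Rightarrow> real^'n \<Rightarrow> 'e" where
  "differential c h p u = frechet_derivative (h \<circ> chart_inv c) (at (snd c p)) u"


section \<open>Riemannian metrics\<close>

text \<open>A metric is given by its Gram matrices \<open>g c x\<close> in each chart \<open>c\<close> at coordinates \<open>x\<close>.\<close>

type_synonym ('m, 'n) metric_tensor = "('m, 'n) chart \<Rightarrow> real^'n \<Rightarrow> real^'n^'n"

definition riemannian_metric ::
  "('m::topological_space, 'n::finite) chart set \<Rightarrow> ('m, 'n) metric_tensor \<Rightarrow> bool" where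
  "riemannian_metric \<A> g \<longleftrightarrow>
     (\<forall>c\<in>\<A>. smooth_on (chart_image c) (g c) \<and>
        (\<forall>x\<in>chart_image c. transpose (g c x) = g c x \<and> (\<forall>u. u \<noteq> 0 \<longrightarrow> u \<bullet> (g c x *v u) > 0))) \<and>
     (\<forall>c\<in>\<A>. \<forall>d\<in>\<A>. \<forall>x\<in>snd c ` (fst c \<inter> fst d).
        g c x = transpose (jacobian (transition c d) x) ** g d (transition c d x)
                  ** jacobian (transition c d) x)"

definition orthonormal_frame :: "real^'n^'n \<Rightarrow> ('n::finite \<Rightarrow> real^'n) \<Rightarrow> bool" where
  "orthonormal_frame G e \<longleftrightarrow> (\<forall>i j. e i \<bullet> (G *v e j) = (if i = j then 1 else 0))"


subsection \<open>Completeness\<close>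

definition C1_curve_on ::
  "('m::topological_space, 'n::finite) chart set \<Rightarrow> real \<Rightarrow> real \<Rightarrow> (real \<Rightarrow> 'm) \<Rightarrow> bool" where
  "C1_curve_on \<A> a b \<gamma> \<longleftrightarrow> continuous_on {a..b} \<gamma> \<and>
     (\<forall>c\<in>\<A>.
        (\<forall>t\<in>{a..b}. \<gamma> t \<in> fst c \<longrightarrow> (snd c \<circ> \<gamma>) differentiable (at t within {a..b})) \<and>
        continuous_on {t\<in>{a..b}. \<gamma> t \<in> fst c}
          (\<lambda>t. vector_derivative (snd c \<circ> \<gamma>) (at t within {a..b})))"

definition piecewise_C1_curve ::
  "('m::topological_space, 'n::finite) chart set \<Rightarrow> (real \<Rightarrow> 'm) \<Rightarrow> bool" where
  "piecewise_C1_curve \<A> \<gamma> \<longleftrightarrow> (\<exists>(k::nat) \<tau>. \<tau> 0 = 0 \<and> \<tau> k = 1 \<and>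
     (\<forall>i<k. \<tau> i < \<tau> (Suc i) \<and> C1_curve_on \<A> (\<tau> i) (\<tau> (Suc i)) \<gamma>))"

definition curve_speed ::
  "('m, 'n::finite) chart set \<Rightarrow> ('m, 'n) metric_tensor \<Rightarrow> (real \<Rightarrow> 'm) \<Rightarrow> real \<Rightarrow> real" where
  "curve_speed \<A> g \<gamma> t =
     (let c = chart_at \<A> (\<gamma> t); v = vector_derivative (snd c \<circ> \<gamma>) (at t)
      in sqrt (v \<bullet> (g c (snd c (\<gamma> t)) *v v)))"

text \<open>The speed may be meaningless at the finitely many break points; this does not affect the integral.\<close>

definition curve_length ::
  "('m, 'n::finite) chart set \<Rightarrow> ('m, 'n) metric_tensor \<Rightarrow> (real \<Rightarrow> 'm) \<Rightarrow> real" where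
  "curve_length \<A> g \<gamma> = integral {0..1} (curve_speed \<A> g \<gamma>)"

definition riemannian_dist ::
  "('m::topological_space, 'n::finite) chart set \<Rightarrow> ('m, 'n) metric_tensor \<Rightarrow> 'm \<Rightarrow> 'm \<Rightarrow> real" where
  "riemannian_dist \<A> g p q =
     Inf {curve_length \<A> g \<gamma> |\<gamma>. piecewise_C1_curve \<A> \<gamma> \<and> \<gamma> 0 = p \<and> \<gamma> 1 = q}"

definition complete_riemannian ::
  "('m::topological_space, 'n::finite) chart set \<Rightarrow> ('m, 'n) metric_tensor \<Rightarrow> bool" where
  "complete_riemannian \<A> g \<longleftrightarrow> Metric_space.mcomplete UNIV (riemannian_dist \<A> g)"


subsection \<open>Sectional and scalar curvature\<close>

text \<open>In this subsection \<open>G\<close> is the matrix of the metric as a function of the coordinates.\<close>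

definition partial :: "'n::finite \<Rightarrow> (real^'n \<Rightarrow> real) \<Rightarrow> real^'n \<Rightarrow> real" where
  "partial i h x = frechet_derivative h (at x) (axis i 1)"

text \<open>\<open>christoffel G k i j\<close> is $\Gamma^k_{ij}$.\<close>

definition christoffel :: "(real^'n \<Rightarrow> real^'n^'n) \<Rightarrow> 'n::finite \<Rightarrow> 'n \<Rightarrow> 'n \<Rightarrow> real^'n \<Rightarrow> real" where
  "christoffel G k i j x = (1/2) * (\<Sum>l\<in>UNIV. matrix_inv (G x) $ k $ l *
     (partial i (\<lambda>y. G y $ j $ l) x + partial j (\<lambda>y. G y $ i $ l) x
        - partial l (\<lambda>y. G y $ i $ j) x))"

text \<open>
  \<open>riemann_coeff G l k i j\<close> is the \<open>l\<close>-th component of $R(\partial_i,\partial_j)\partial_k$ with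
  $R(X,Y)Z = \nabla_X\nabla_Y Z - \nabla_Y\nabla_X Z - \nabla_{[X,Y]}Z$.
\<close>

definition riemann_coeff ::
  "(real^'n \<Rightarrow> real^'n^'n) \<Rightarrow> 'n::finite \<Rightarrow> 'n \<Rightarrow> 'n \<Rightarrow> 'n \<Rightarrow> real^'n \<Rightarrow> real" where
  "riemann_coeff G l k i j x =
     partial i (christoffel G l j k) x - partial j (christoffel G l i k) x
     + (\<Sum>m\<in>UNIV. christoffel G l i m x * christoffel G m j k x
                 - christoffel G l j m x * christoffel G m i k x)"

definition riemann_tensor ::
  "(real^'n \<Rightarrow> real^'n^'n) \<Rightarrow> real^'n \<Rightarrow> real^'n \<Rightarrow> real^'n \<Rightarrow> real^'n \<Rightarrow> real^'n::finite" where
  "riemann_tensor G x u v w =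
     (\<chi> l. \<Sum>i\<in>UNIV. \<Sum>j\<in>UNIV. \<Sum>k\<in>UNIV. u $ i * v $ j * w $ k * riemann_coeff G l k i j x)"

definition sectional_curvature ::
  "(real^'n \<Rightarrow> real^'n^'n) \<Rightarrow> real^'n \<Rightarrow> real^'n \<Rightarrow> real^'n::finite \<Rightarrow> real" where
  "sectional_curvature G x u v =
     (riemann_tensor G x u v v \<bullet> (G x *v u))
     / ((u \<bullet> (G x *v u)) * (v \<bullet> (G x *v v)) - (u \<bullet> (G x *v v))\<^sup>2)"

text \<open>The normalized scalar curvature; it depends neither on the chart nor on the frame.\<close>

definition scalar_curvature ::
  "('m, 'n::{finite,linorder}) chart set \<Rightarrow> ('m, 'n) metric_tensor \<Rightarrow> 'm \<Rightarrow> real" where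
  "scalar_curvature \<A> g p =
     (let c = chart_at \<A> p; x = snd c p; e = (SOME e. orthonormal_frame (g c x) e)
      in 2 / (real CARD('n) * (real CARD('n) - 1)) *
         (\<Sum>(i,j)\<in>{(i,j). i < j}. sectional_curvature (g c) x (e i) (e j)))"


section \<open>Isometrically immersed hypersurfaces\<close>

definition isometric_immersion ::
  "('m::topological_space, 'n::finite) chart set \<Rightarrow> ('m, 'n) metric_tensor \<Rightarrow>
     ('m \<Rightarrow> 'e::euclidean_space) \<Rightarrow> bool" where
  "isometric_immersion \<A> g f \<longleftrightarrow> smooth_map \<A> f \<and>
     (\<forall>c\<in>\<A>. \<forall>p\<in>fst c. inj (differential c f p) \<and>
        (\<forall>u v. differential c f p u \<bullet> differential c f p v = u \<bullet> (g c (snd c p) *v v)))"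

definition unit_normal_field ::
  "('m::topological_space, 'n::finite) chart set \<Rightarrow> ('m \<Rightarrow> 'e::euclidean_space) \<Rightarrow> ('m \<Rightarrow> 'e) \<Rightarrow> bool" where
  "unit_normal_field \<A> f \<xi> \<longleftrightarrow> smooth_map \<A> \<xi> \<and> (\<forall>p. norm (\<xi> p) = 1) \<and>
     (\<forall>c\<in>\<A>. \<forall>p\<in>fst c. \<forall>u. \<xi> p \<bullet> differential c f p u = 0)"

text \<open>Weingarten formula: $d\xi = - df \circ A$.\<close>

definition shape_operator ::
  "('m, 'n::finite) chart \<Rightarrow> ('m \<Rightarrow> 'e::euclidean_space) \<Rightarrow> ('m \<Rightarrow> 'e) \<Rightarrow> 'm \<Rightarrow> real^'n \<Rightarrow> real^'n" where
  "shape_operator c f \<xi> p u = (THE w. differential c f p w = - differential c \<xi> p u)"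

text \<open>\<open>\<kappa>\<close> lists the eigenvalues of the shape operator at \<open>p\<close> with multiplicity; it is unique up to a permutation.\<close>

definition principal_curvatures ::
  "('m, 'n::finite) chart set \<Rightarrow> ('m, 'n) metric_tensor \<Rightarrow> ('m \<Rightarrow> 'e::euclidean_space) \<Rightarrow> ('m \<Rightarrow> 'e) \<Rightarrow>
     'm \<Rightarrow> ('n \<Rightarrow> real) \<Rightarrow> bool" where
  "principal_curvatures \<A> g f \<xi> p \<kappa> \<longleftrightarrow>
     (let c = chart_at \<A> p
      in \<exists>e. orthonormal_frame (g c (snd c p)) e \<and>
             (\<forall>i. shape_operator c f \<xi> p (e i) = \<kappa> i *\<^sub>R e i))"

text \<open>The sum over $i_1 < \dots < i_r$ is written as a sum over the \<open>r\<close>-element index sets.\<close>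

definition mean_curvature ::
  "('m, 'n::finite) chart set \<Rightarrow> ('m, 'n) metric_tensor \<Rightarrow> ('m \<Rightarrow> 'e::euclidean_space) \<Rightarrow> ('m \<Rightarrow> 'e) \<Rightarrow>
     nat \<Rightarrow> 'm \<Rightarrow> real" where
  "mean_curvature \<A> g f \<xi> r p =
     (let \<kappa> = (SOME \<kappa>. principal_curvatures \<A> g f \<xi> p \<kappa>)
      in (\<Sum>I | card I = r. \<Prod>i\<in>I. \<kappa> i) / real (CARD('n) choose r))"


section \<open>Equality up to a rigid motion\<close>

text \<open>
  The two ambient Euclidean spaces may be different types, such as \<open>real^7\<close> and
  \<open>real^4 \<times> real^3\<close> with its product inner product.
\<close>

definition equal_up_to_rigid_motion :: "'a::euclidean_space set \<Rightarrow> 'b::euclidean_space set \<Rightarrow> bool" where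
  "equal_up_to_rigid_motion S T \<longleftrightarrow>
     (\<exists>\<Phi>::'a \<Rightarrow> 'b. surj \<Phi> \<and> (\<forall>x y. dist (\<Phi> x) (\<Phi> y) = dist x y) \<and> \<Phi> ` S = T)"

end

theory Submission
  imports Defs
begin

text \<open>
  Put \<open>a = 3 H\<close>, and let \<open>e\<^sub>r\<close> be the \<open>r\<close>-th elementary symmetric function of the principal curvatures
  \<open>\<kappa>\<^sub>1, \<dots>, \<kappa>\<^sub>6\<close>.  The mean curvature gives \<open>e\<^sub>1 = 2 a\<close>, and the Gauss equation (\<open>gauss_equation\<close>,
  \<open>scalar_curvature_esym\<close>) turns the hypothesis on the scalar curvature into \<open>e\<^sub>2 = a\<^sup>2\<close>.  So the squared norm
  \<open>e\<^sub>1\<^sup>2 - 2 e\<^sub>2\<close> of the shape operator \<open>A\<close> is constant along with its trace, and Simons' formula becomes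
  the pointwise identity \<open>\<bar>\<nabla>A\<bar>\<^sup>2 = (tr A\<^sup>2)\<^sup>2 - tr A tr A\<^sup>3 = - 6 a e\<^sub>3\<close>, whence \<open>e\<^sub>3 \<le> 0\<close>.  The
  formula is derived in \<open>simons_formula_gradient\<close> by writing the hypersurface as a graph over a tangent hyperplane.

  The characteristic polynomial of \<open>A\<close> is therefore
  \<open>t\<^sup>4 (t - a)\<^sup>2 - e\<^sub>3 t\<^sup>3 + e\<^sub>4 t\<^sup>2 - e\<^sub>5 t + e\<^sub>6\<close> with all terms nonnegative for \<open>t > 0\<close>.  It has a
  positive root, so all the terms vanish there: the principal curvatures are \<open>a, a, 0, 0, 0, 0\<close> at every point
  (\<open>six_curvatures_two_valued\<close>), \<open>e\<^sub>3 = 0\<close>, and \<open>A\<close> is parallel.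

  It follows that the orthogonal projection \<open>\<Pi>\<close> of the ambient space onto the span of the normal and the two
  curved directions is the same at all points (\<open>normal_projection_stationary\<close>, \<open>curved_proj_const\<close>), and that
  \<open>\<Pi> f + \<xi> / a\<close> is constant (\<open>centre_const\<close>).  These two facts put the image of \<open>f\<close> on a cylinder over a round
  sphere of radius \<open>1 / a\<close> in the three-dimensional range of \<open>\<Pi>\<close>.

  The image is the whole cylinder by completeness.  Two points of the cylinder are joined by a helix, and small
  pieces of it lift to curves of the same length, because near each point the hypersurface and the cylinder are
  graphs over the same tangent hyperplane (\<open>local_lift\<close>).  Lifting continues up to the end point
  (\<open>complete_continuation\<close>), once the infimum of lengths of curves is known to be a metric for which \<open>f\<close> does not
  increase distances (\<open>riemannian_dist_metric\<close>, \<open>riemannian_dist_ge\<close>).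
\<close>

section \<open>Calculus of smooth functions\<close>

text \<open>
  The derivative in a fixed direction \<open>v\<close>, as a function of the point: iterating it gives the higher
  derivatives that occur in \<open>Ck_on\<close> and in the definition of the curvature tensor.
\<close>

definition dir_deriv :: "'a::euclidean_space \<Rightarrow> ('a \<Rightarrow> 'b::real_normed_vector) \<Rightarrow> 'a \<Rightarrow> 'b" where
  "dir_deriv v F x = frechet_derivative F (at x) v"

lemma Ck_on_Suc_iff:
  "Ck_on (Suc k) S h \<longleftrightarrow> (\<forall>x\<in>S. h differentiable (at x)) \<and> (\<forall>v. Ck_on k S (dir_deriv v h))"
  by (simp add: dir_deriv_def[abs_def])

declare Ck_on.simps(2) [simp del]

lemma dir_deriv_eqI: "(F has_derivative D) (at x) \<Longrightarrow> dir_deriv v F x = D v"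
  unfolding dir_deriv_def using frechet_derivative_at by metis

lemma has_derivative_dir_deriv:
  "F differentiable (at x) \<Longrightarrow> (F has_derivative (\<lambda>v. dir_deriv v F x)) (at x)"
  unfolding dir_deriv_def using frechet_derivative_works by fastforce

lemma dir_deriv_linear_comb:
  assumes "F differentiable (at x)"
  shows "dir_deriv (\<Sum>i\<in>I. c i *\<^sub>R v i) F x = (\<Sum>i\<in>I. c i *\<^sub>R dir_deriv (v i) F x)"
proof -
  have "linear (\<lambda>v. dir_deriv v F x)"
    using has_derivative_dir_deriv[OF assms] has_derivative_linear by blast
  from linear_sum[OF this, of "\<lambda>i. c i *\<^sub>R v i" I] linear_cmul[OF this] show ?thesis by simp
qed

lemma dir_deriv_axis:
  fixes v :: "real^'n::finite"
  assumes "F differentiable (at x)"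
  shows "dir_deriv v F x = (\<Sum>i\<in>UNIV. (v $ i) *\<^sub>R dir_deriv (axis i 1) F x)"
proof -
  have "v = (\<Sum>i\<in>UNIV. (v $ i) *\<^sub>R axis i 1)"
    using basis_expansion[of v] by (simp add: scalar_mult_eq_scaleR)
  then show ?thesis using dir_deriv_linear_comb[OF assms, of "\<lambda>i. v $ i" "\<lambda>i. axis i 1" UNIV] by simp
qed

lemma dir_deriv_Basis:
  assumes "F differentiable (at x)"
  shows "dir_deriv v F x = (\<Sum>b\<in>Basis. (v \<bullet> b) *\<^sub>R dir_deriv b F x)"
proof -
  have "v = (\<Sum>b\<in>Basis. (v \<bullet> b) *\<^sub>R b)" by (simp add: euclidean_representation)
  then show ?thesis using dir_deriv_linear_comb[OF assms, of "\<lambda>b. v \<bullet> b" "\<lambda>b. b" Basis] by simp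
qed

lemma dir_deriv_cong:
  assumes "open S" "x \<in> S" "\<And>y. y \<in> S \<Longrightarrow> F y = G y"
  shows "dir_deriv v F x = dir_deriv v G x"
proof -
  have "(F has_derivative D) (at x) \<longleftrightarrow> (G has_derivative D) (at x)" for D
    using has_derivative_transform_within_open[OF _ assms(1,2)] assms(3) by metis
  then show ?thesis unfolding dir_deriv_def frechet_derivative_def by simp
qed

lemma dir_deriv_const [simp]: "dir_deriv v (\<lambda>x. c) x = 0"
  by (rule dir_deriv_eqI[of _ "\<lambda>_. 0"]) simp

lemma dir_deriv_add:
  "F differentiable (at x) \<Longrightarrow> G differentiable (at x) \<Longrightarrow>
    dir_deriv v (\<lambda>x. F x + G x) x = dir_deriv v F x + dir_deriv v G x"
  by (rule dir_deriv_eqI) (intro derivative_intros has_derivative_dir_deriv)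

lemma dir_deriv_diff:
  "F differentiable (at x) \<Longrightarrow> G differentiable (at x) \<Longrightarrow>
    dir_deriv v (\<lambda>x. F x - G x) x = dir_deriv v F x - dir_deriv v G x"
  by (rule dir_deriv_eqI) (intro derivative_intros has_derivative_dir_deriv)

lemma dir_deriv_sum:
  "(\<And>i. i \<in> I \<Longrightarrow> F i differentiable (at x)) \<Longrightarrow>
    dir_deriv v (\<lambda>x. \<Sum>i\<in>I. F i x) x = (\<Sum>i\<in>I. dir_deriv v (F i) x)"
  by (rule dir_deriv_eqI) (intro has_derivative_sum has_derivative_dir_deriv)

lemma dir_deriv_bounded_linear:
  assumes "bounded_linear L" "F differentiable (at x)"
  shows "dir_deriv v (\<lambda>x. L (F x)) x = L (dir_deriv v F x)"
  by (rule dir_deriv_eqI) (rule bounded_linear.has_derivative[OF assms(1) has_derivative_dir_deriv[OF assms(2)]])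

lemma dir_deriv_bilinear:
  assumes "bounded_bilinear pr" "F differentiable (at x)" "G differentiable (at x)"
  shows "dir_deriv v (\<lambda>x. pr (F x) (G x)) x = pr (F x) (dir_deriv v G x) + pr (dir_deriv v F x) (G x)"
  by (rule dir_deriv_eqI)
    (rule bounded_bilinear.FDERIV[OF assms(1) has_derivative_dir_deriv[OF assms(2)] has_derivative_dir_deriv[OF assms(3)]])

lemmas dir_deriv_mult = dir_deriv_bilinear[OF bounded_bilinear_mult]
  and dir_deriv_inner = dir_deriv_bilinear[OF bounded_bilinear_inner]
  and dir_deriv_scaleR = dir_deriv_bilinear[OF bounded_bilinear_scaleR]

lemma dir_deriv_compose:
  fixes F :: "'a::euclidean_space \<Rightarrow> 'b::euclidean_space"
  assumes "F differentiable (at x)" "G differentiable (at (F x))"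
  shows "dir_deriv v (\<lambda>x. G (F x)) x = dir_deriv (dir_deriv v F x) G (F x)"
  using diff_chain_at[OF has_derivative_dir_deriv[OF assms(1)] has_derivative_dir_deriv[OF assms(2)]]
  by (intro dir_deriv_eqI) (simp add: o_def)

lemma Ck_on_differentiable: "Ck_on (Suc k) S h \<Longrightarrow> x \<in> S \<Longrightarrow> h differentiable (at x)"
  by (simp add: Ck_on_Suc_iff)

lemma Ck_on_SucD: "Ck_on (Suc k) S h \<Longrightarrow> Ck_on k S h"
proof (induction k arbitrary: h)
  case 0
  then show ?case unfolding Ck_on_Suc_iff Ck_on.simps(1)
    by (meson continuous_at_imp_continuous_on differentiable_imp_continuous_within)
next
  case (Suc k)
  from Suc.prems have "\<forall>x\<in>S. h differentiable (at x)" "\<And>v. Ck_on (Suc k) S (dir_deriv v h)"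
    unfolding Ck_on_Suc_iff[of "Suc k"] by blast+
  with Suc.IH show ?case unfolding Ck_on_Suc_iff[of k S h] by blast
qed

lemma Ck_on_cong:
  assumes "open S" "\<And>x. x \<in> S \<Longrightarrow> f x = g x" "Ck_on k S f"
  shows "Ck_on k S g"
  using assms(2,3)
proof (induction k arbitrary: f g)
  case 0
  then show ?case by (auto intro: continuous_on_eq)
next
  case (Suc k)
  have "g differentiable (at x)" if "x \<in> S" for x
    using Suc.prems assms(1) that
    by (metis Ck_on_differentiable differentiable_def has_derivative_transform_within_open)
  moreover have "Ck_on k S (dir_deriv v g)" for v
    using Suc.IH[of "dir_deriv v f" "dir_deriv v g"] Suc.prems(2)
      dir_deriv_cong[OF assms(1), of _ f g v] Suc.prems(1) unfolding Ck_on_Suc_iff by blast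
  ultimately show ?case by (simp add: Ck_on_Suc_iff)
qed

lemma Ck_on_const: "Ck_on k S (\<lambda>x. c)"
proof (induction k arbitrary: c)
  case (Suc k)
  have "dir_deriv v (\<lambda>x::'a. c) = (\<lambda>x. 0)" for v by (rule ext) simp
  then show ?case using Suc by (simp add: Ck_on_Suc_iff)
qed simp

lemma Ck_on_add:
  assumes "open S"
  shows "Ck_on k S f \<Longrightarrow> Ck_on k S g \<Longrightarrow> Ck_on k S (\<lambda>x. f x + g x)"
proof (induction k arbitrary: f g)
  case 0
  then show ?case by (simp add: continuous_on_add)
next
  case (Suc k)
  then have "Ck_on k S (\<lambda>x. dir_deriv v f x + dir_deriv v g x)" for v
    using Suc.IH by (auto simp: Ck_on_Suc_iff)
  then have "Ck_on k S (dir_deriv v (\<lambda>x. f x + g x))" for v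
    by (rule Ck_on_cong[OF assms, rotated]) (use Suc.prems in \<open>auto simp: Ck_on_Suc_iff dir_deriv_add\<close>)
  then show ?case using Suc.prems by (auto simp: Ck_on_Suc_iff)
qed

lemma Ck_on_bounded_linear:
  assumes "open S" "bounded_linear L"
  shows "Ck_on k S f \<Longrightarrow> Ck_on k S (\<lambda>x. L (f x))"
proof (induction k arbitrary: f)
  case 0
  then show ?case using assms(2) by (simp add: bounded_linear.continuous_on)
next
  case (Suc k)
  then have "Ck_on k S (\<lambda>x. L (dir_deriv v f x))" for v
    using Suc.IH by (auto simp: Ck_on_Suc_iff)
  then have "Ck_on k S (dir_deriv v (\<lambda>x. L (f x)))" for v
    by (rule Ck_on_cong[OF assms(1), rotated])
      (use Suc.prems in \<open>auto simp: Ck_on_Suc_iff dir_deriv_bounded_linear[OF assms(2)]\<close>)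
  moreover have "(\<lambda>x. L (f x)) differentiable (at x)" if "x \<in> S" for x
    using Ck_on_differentiable[OF Suc.prems that] bounded_linear.has_derivative[OF assms(2)]
    unfolding differentiable_def by blast
  ultimately show ?case by (simp add: Ck_on_Suc_iff)
qed

lemma Ck_on_bilinear:
  assumes "open S" "bounded_bilinear pr"
  shows "Ck_on k S f \<Longrightarrow> Ck_on k S g \<Longrightarrow> Ck_on k S (\<lambda>x. pr (f x) (g x))"
proof (induction k arbitrary: f g)
  case 0
  then show ?case using assms(2) by (simp add: bounded_bilinear.continuous_on)
next
  case (Suc k)
  have "Ck_on k S (\<lambda>x. pr (f x) (dir_deriv v g x) + pr (dir_deriv v f x) (g x))" for v
    using Suc.IH Suc.prems Ck_on_SucD[OF Suc.prems(1)] Ck_on_SucD[OF Suc.prems(2)]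
    by (intro Ck_on_add[OF assms(1)]) (auto simp: Ck_on_Suc_iff)
  then have "Ck_on k S (dir_deriv v (\<lambda>x. pr (f x) (g x)))" for v
    by (rule Ck_on_cong[OF assms(1), rotated])
      (use Suc.prems in \<open>auto simp: Ck_on_Suc_iff dir_deriv_bilinear[OF assms(2)]\<close>)
  moreover have "(\<lambda>x. pr (f x) (g x)) differentiable (at x)" if "x \<in> S" for x
    using Ck_on_differentiable[OF Suc.prems(1) that] Ck_on_differentiable[OF Suc.prems(2) that]
      bounded_bilinear.FDERIV[OF assms(2)]
    unfolding differentiable_def by blast
  ultimately show ?case by (simp add: Ck_on_Suc_iff)
qed

lemma Ck_on_sum:
  assumes "open S" "\<And>i. i \<in> I \<Longrightarrow> Ck_on k S (F i)"
  shows "Ck_on k S (\<lambda>x. \<Sum>i\<in>I. F i x)"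
  using assms(2) by (induction I rule: infinite_finite_induct) (auto simp: Ck_on_const Ck_on_add[OF assms(1)])

lemma Ck_on_prod:
  fixes F :: "'i \<Rightarrow> 'a::euclidean_space \<Rightarrow> real"
  assumes "open S" "\<And>i. i \<in> I \<Longrightarrow> Ck_on k S (F i)"
  shows "Ck_on k S (\<lambda>x. \<Prod>i\<in>I. F i x)"
  using assms(2)
  by (induction I rule: infinite_finite_induct)
    (auto simp: Ck_on_const Ck_on_bilinear[OF assms(1) bounded_bilinear_mult])

lemma Ck_on_inverse:
  fixes f :: "'a::euclidean_space \<Rightarrow> real"
  assumes "open S" "\<And>x. x \<in> S \<Longrightarrow> f x \<noteq> 0"
  shows "Ck_on k S f \<Longrightarrow> Ck_on k S (\<lambda>x. inverse (f x))"
proof (induction k)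
  case 0
  then show ?case using assms by (simp add: continuous_on_inverse)
next
  case (Suc k)
  have D: "((\<lambda>x. inverse (f x)) has_derivative (\<lambda>v. - (inverse (f x) * dir_deriv v f x * inverse (f x)))) (at x)"
    if "x \<in> S" for x
    using Deriv.has_derivative_inverse[OF assms(2)[OF that] has_derivative_dir_deriv[OF Ck_on_differentiable[OF Suc.prems that]]] .
  have "Ck_on k S (\<lambda>x. - (inverse (f x) * dir_deriv v f x * inverse (f x)))" for v
    using Suc Ck_on_SucD[OF Suc.prems]
    by (intro Ck_on_bounded_linear[OF assms(1) bounded_linear_minus[OF bounded_linear_ident]]
        Ck_on_bilinear[OF assms(1) bounded_bilinear_mult]) (auto simp: Ck_on_Suc_iff)
  then have "Ck_on k S (dir_deriv v (\<lambda>x. inverse (f x)))" for v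
    by (rule Ck_on_cong[OF assms(1), rotated]) (rule dir_deriv_eqI[OF D, symmetric])
  then show ?case using D by (auto simp: Ck_on_Suc_iff differentiable_def)
qed

text \<open>
  The predicate \<open>Ck_on\<close> only speaks about derivatives in fixed directions, whereas the chain rule
  differentiates \<open>g\<close> in the moving direction of the derivative of \<open>f\<close>.  Expanding that direction in
  the standard basis gives products of functions to which the induction hypothesis applies.
\<close>

lemma Ck_on_compose:
  fixes f :: "'a::euclidean_space \<Rightarrow> 'b::euclidean_space"
  assumes "open S" "open T" "f ` S \<subseteq> T"
  shows "Ck_on k S f \<Longrightarrow> Ck_on k T g \<Longrightarrow> Ck_on k S (\<lambda>x. g (f x))"
proof (induction k arbitrary: g)
  case 0
  then show ?case using assms(3) by (simp add: continuous_on_compose2)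
next
  case (Suc k)
  have dg: "g differentiable (at (f x))" if "x \<in> S" for x
    using Suc.prems(2) that assms(3) Ck_on_differentiable by blast
  have df: "f differentiable (at x)" if "x \<in> S" for x
    using Suc.prems(1) that Ck_on_differentiable by blast
  have "Ck_on k S (\<lambda>x. \<Sum>b\<in>Basis. (dir_deriv v f x \<bullet> b) *\<^sub>R dir_deriv b g (f x))" for v
  proof (intro Ck_on_sum[OF assms(1)] Ck_on_bilinear[OF assms(1) bounded_bilinear_scaleR])
    fix b :: 'b assume "b \<in> Basis"
    show "Ck_on k S (\<lambda>x. dir_deriv v f x \<bullet> b)"
      using Suc.prems(1) Ck_on_bounded_linear[OF assms(1) bounded_linear_inner_left, of k "dir_deriv v f" b]
      unfolding Ck_on_Suc_iff by blast
    show "Ck_on k S (\<lambda>x. dir_deriv b g (f x))"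
      using Suc.IH[OF Ck_on_SucD[OF Suc.prems(1)], of "dir_deriv b g"] Suc.prems(2) unfolding Ck_on_Suc_iff by blast
  qed
  then have "Ck_on k S (dir_deriv v (\<lambda>x. g (f x)))" for v
    by (rule Ck_on_cong[OF assms(1), rotated])
      (simp add: dir_deriv_compose df dg dir_deriv_Basis[where v="dir_deriv v f _", OF dg])
  moreover have "(\<lambda>x. g (f x)) differentiable (at x)" if "x \<in> S" for x
    using differentiable_compose[OF dg df, OF that that] .
  ultimately show ?case by (simp add: Ck_on_Suc_iff)
qed

lemma matrix_inv_inverse:
  assumes "invertible (M :: real^'n^'n::finite)"
  shows "M ** matrix_inv M = mat 1" "matrix_inv M ** M = mat 1"
  using someI_ex[OF assms[unfolded invertible_def]] unfolding matrix_inv_def by blast+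

text \<open>Cramer's rule turns the smoothness of a matrix inverse into that of quotients of determinants.\<close>

lemma matrix_inv_cramer:
  fixes M :: "real^'n^'n::finite"
  assumes "invertible M"
  shows "matrix_inv M $ k $ l = det (\<chi> i j. if j = k then (axis l 1 :: real^'n) $ i else M $ i $ j) * inverse (det M)"
proof -
  have d: "det M \<noteq> 0" using assms invertible_det_nz by blast
  have "M *v (matrix_inv M *v axis l 1) = (axis l 1 :: real^'n)"
    by (simp add: matrix_vector_mul_assoc matrix_inv_inverse(1)[OF assms])
  then have "matrix_inv M *v axis l 1 =
      (\<chi> k. det (\<chi> i j. if j = k then (axis l 1 :: real^'n) $ i else M $ i $ j) / det M)"
    using cramer[OF d] by blast
  moreover have "(matrix_inv M *v axis l 1) $ k = matrix_inv M $ k $ l"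
    by (simp add: matrix_vector_mult_basis column_def)
  ultimately show ?thesis by (simp add: field_simps)
qed

lemma Ck_on_det:
  fixes M :: "'a::euclidean_space \<Rightarrow> real^'n^'n::finite"
  assumes "open S" "\<And>i j. Ck_on k S (\<lambda>x. M x $ i $ j)"
  shows "Ck_on k S (\<lambda>x. det (M x))"
  unfolding det_def
  by (intro Ck_on_sum[OF assms(1)] Ck_on_bilinear[OF assms(1) bounded_bilinear_mult]
      Ck_on_prod[OF assms(1)] assms(2) Ck_on_const)

lemma Ck_on_matrix_inv:
  fixes M :: "'a::euclidean_space \<Rightarrow> real^'n^'n::finite"
  assumes "open S" "\<And>i j. Ck_on k S (\<lambda>x. M x $ i $ j)" "\<And>x. x \<in> S \<Longrightarrow> invertible (M x)"
  shows "Ck_on k S (\<lambda>x. matrix_inv (M x) $ i $ j)"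
proof -
  have "Ck_on k S (\<lambda>x. if b = i then (axis j 1 :: real^'n) $ a else M x $ a $ b)" for a b
    using assms(2) by (cases "b = i") (auto simp: Ck_on_const)
  then have "Ck_on k S (\<lambda>x. det (\<chi> a b. if b = i then (axis j 1 :: real^'n) $ a else M x $ a $ b) * inverse (det (M x)))"
    by (intro Ck_on_bilinear[OF assms(1) bounded_bilinear_mult] Ck_on_inverse Ck_on_det assms(1,2))
      (use assms(3) invertible_det_nz in auto)
  then show ?thesis
    by (rule Ck_on_cong[OF assms(1), rotated]) (simp add: matrix_inv_cramer assms(3))
qed

lemma smooth_on_differentiable: "smooth_on S F \<Longrightarrow> x \<in> S \<Longrightarrow> F differentiable (at x)"
  unfolding smooth_on_def using Ck_on_differentiable by blast

lemma smooth_on_has_derivative: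
  "smooth_on S F \<Longrightarrow> x \<in> S \<Longrightarrow> (F has_derivative (\<lambda>v. dir_deriv v F x)) (at x)"
  by (simp add: has_derivative_dir_deriv smooth_on_differentiable)

lemma smooth_on_dir_deriv: "smooth_on S F \<Longrightarrow> smooth_on S (dir_deriv v F)"
  unfolding smooth_on_def using Ck_on_Suc_iff by blast

lemma smooth_on_imp_continuous_on: "smooth_on S F \<Longrightarrow> continuous_on S F"
  unfolding smooth_on_def using Ck_on.simps(1) by blast

lemma smooth_on_const: "smooth_on S (\<lambda>x. c)"
  by (simp add: smooth_on_def Ck_on_const)

context
  fixes S :: "'a::euclidean_space set"
  assumes S: "open S"
begin

lemma smooth_on_cong: "(\<And>x. x \<in> S \<Longrightarrow> F x = G x) \<Longrightarrow> smooth_on S F \<Longrightarrow> smooth_on S G"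
  unfolding smooth_on_def using Ck_on_cong[OF S] by blast

lemma smooth_on_add: "smooth_on S F \<Longrightarrow> smooth_on S G \<Longrightarrow> smooth_on S (\<lambda>x. F x + G x)"
  by (simp add: smooth_on_def Ck_on_add[OF S])

lemma smooth_on_bounded_linear: "bounded_linear L \<Longrightarrow> smooth_on S F \<Longrightarrow> smooth_on S (\<lambda>x. L (F x))"
  by (simp add: smooth_on_def Ck_on_bounded_linear[OF S])

lemma smooth_on_bilinear:
  "bounded_bilinear pr \<Longrightarrow> smooth_on S F \<Longrightarrow> smooth_on S G \<Longrightarrow> smooth_on S (\<lambda>x. pr (F x) (G x))"
  by (simp add: smooth_on_def Ck_on_bilinear[OF S])

lemmas smooth_on_inner = smooth_on_bilinear[OF bounded_bilinear_inner]
  and smooth_on_mult = smooth_on_bilinear[OF bounded_bilinear_mult]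
  and smooth_on_scaleR = smooth_on_bilinear[OF bounded_bilinear_scaleR]

lemma smooth_on_uminus: "smooth_on S F \<Longrightarrow> smooth_on S (\<lambda>x. - F x)"
  by (rule smooth_on_bounded_linear[OF bounded_linear_minus[OF bounded_linear_ident]])

lemma smooth_on_diff: "smooth_on S F \<Longrightarrow> smooth_on S G \<Longrightarrow> smooth_on S (\<lambda>x. F x - G x)"
  using smooth_on_add[OF _ smooth_on_uminus] by force

lemma smooth_on_sum: "(\<And>i. i \<in> I \<Longrightarrow> smooth_on S (F i)) \<Longrightarrow> smooth_on S (\<lambda>x. \<Sum>i\<in>I. F i x)"
  by (simp add: smooth_on_def Ck_on_sum[OF S])

lemma smooth_on_compose:
  fixes F :: "'a \<Rightarrow> 'b::euclidean_space"
  shows "open T \<Longrightarrow> F ` S \<subseteq> T \<Longrightarrow> smooth_on S F \<Longrightarrow> smooth_on T G \<Longrightarrow> smooth_on S (\<lambda>x. G (F x))"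
  by (simp add: smooth_on_def Ck_on_compose[OF S])

lemma smooth_on_matrix_inv:
  fixes M :: "'a \<Rightarrow> real^'n^'n::finite"
  assumes "\<And>i j. smooth_on S (\<lambda>x. M x $ i $ j)" "\<And>x. x \<in> S \<Longrightarrow> invertible (M x)"
  shows "smooth_on S (\<lambda>x. matrix_inv (M x) $ i $ j)"
  using assms by (simp add: smooth_on_def Ck_on_matrix_inv[OF S])

end

subsection \<open>Symmetry of second derivatives\<close>

text \<open>
  Both mixed derivatives are limits of the same second difference quotient, which the mean value
  theorem evaluates in either order.
\<close>

lemma second_difference_mean_value:
  fixes F :: "'a::euclidean_space \<Rightarrow> real"
  assumes "0 < t" and U: "\<And>r s. r \<in> {0..t} \<Longrightarrow> s \<in> {0..t} \<Longrightarrow> x + r *\<^sub>R u + s *\<^sub>R v \<in> U"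
    and F: "smooth_on U F"
  obtains r s where "r \<in> {0..t}" "s \<in> {0..t}"
    "F (x + t *\<^sub>R u + t *\<^sub>R v) - F (x + t *\<^sub>R u) - F (x + t *\<^sub>R v) + F x
      = t * t * dir_deriv v (dir_deriv u F) (x + r *\<^sub>R u + s *\<^sub>R v)"
proof -
  have line: "((\<lambda>r. G (y + r *\<^sub>R w)) has_real_derivative dir_deriv w G (y + r *\<^sub>R w)) (at r)"
    if "G differentiable (at (y + r *\<^sub>R w))" for G :: "'a \<Rightarrow> real" and y w :: 'a and r
  proof -
    have "((\<lambda>r. y + r *\<^sub>R w) has_derivative (\<lambda>h. h *\<^sub>R w)) (at r)"
      by (auto intro!: derivative_eq_intros)
    from diff_chain_at[OF this has_derivative_dir_deriv[OF that]]
    have "((\<lambda>r. G (y + r *\<^sub>R w)) has_derivative (\<lambda>h. dir_deriv (h *\<^sub>R w) G (y + r *\<^sub>R w))) (at r)"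
      by (simp add: o_def)
    moreover have "dir_deriv (h *\<^sub>R w) G (y + r *\<^sub>R w) = h * dir_deriv w G (y + r *\<^sub>R w)" for h
      using linear_cmul[OF has_derivative_linear[OF has_derivative_dir_deriv[OF that]], of h w] by simp
    ultimately show ?thesis by (simp add: has_field_derivative_def mult.commute[of _ "dir_deriv w G (y + r *\<^sub>R w)"])
  qed
  define \<phi> where "\<phi> r = F (x + r *\<^sub>R u + t *\<^sub>R v) - F (x + r *\<^sub>R u)" for r
  have D\<phi>: "(\<phi> has_real_derivative (dir_deriv u F (x + r *\<^sub>R u + t *\<^sub>R v) - dir_deriv u F (x + r *\<^sub>R u))) (at r)"
    if "0 \<le> r" "r \<le> t" for r
  proof -
    have "F differentiable (at (x + t *\<^sub>R v + r *\<^sub>R u))" "F differentiable (at (x + r *\<^sub>R u))"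
      using U[of r t] U[of r 0] that assms(1) smooth_on_differentiable[OF F] by (auto simp: algebra_simps)
    from line[OF this(1)] line[OF this(2)] show ?thesis
      unfolding \<phi>_def by (auto intro!: DERIV_diff simp: algebra_simps)
  qed
  then obtain r where r: "0 < r" "r < t"
    and \<phi>: "\<phi> t - \<phi> 0 = t * (dir_deriv u F (x + r *\<^sub>R u + t *\<^sub>R v) - dir_deriv u F (x + r *\<^sub>R u))"
    using MVT2[OF assms(1) D\<phi>] by auto
  have D\<psi>: "((\<lambda>s. dir_deriv u F (x + r *\<^sub>R u + s *\<^sub>R v)) has_real_derivative
      dir_deriv v (dir_deriv u F) (x + r *\<^sub>R u + s *\<^sub>R v)) (at s)" if "0 \<le> s" "s \<le> t" for s
    using line smooth_on_differentiable[OF smooth_on_dir_deriv[OF F]] U[of r s] that r by auto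
  then obtain s where s: "0 < s" "s < t"
    and "dir_deriv u F (x + r *\<^sub>R u + t *\<^sub>R v) - dir_deriv u F (x + r *\<^sub>R u + 0 *\<^sub>R v)
      = t * dir_deriv v (dir_deriv u F) (x + r *\<^sub>R u + s *\<^sub>R v)"
    using MVT2[OF assms(1) D\<psi>] by auto
  then show ?thesis using r \<phi> by (intro that[of r s]) (auto simp: \<phi>_def)
qed

lemma dir_deriv_commute_real:
  fixes F :: "'a::euclidean_space \<Rightarrow> real"
  assumes "open U" "x \<in> U" and F: "smooth_on U F"
  shows "dir_deriv v (dir_deriv u F) x = dir_deriv u (dir_deriv v F) x"
proof (rule ccontr)
  define P where "P = dir_deriv v (dir_deriv u F)"
  define Q where "Q = dir_deriv u (dir_deriv v F)"
  assume "dir_deriv v (dir_deriv u F) x \<noteq> dir_deriv u (dir_deriv v F) x"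
  then have e: "\<bar>P x - Q x\<bar> / 2 > 0" by (simp add: P_def Q_def)
  have cP: "isCont P x" and cQ: "isCont Q x"
    using assms(1,2) smooth_on_imp_continuous_on[OF smooth_on_dir_deriv[OF smooth_on_dir_deriv[OF F]]]
    unfolding P_def Q_def by (auto simp: continuous_on_eq_continuous_at)
  obtain d1 where d1: "d1 > 0" "\<And>y. dist y x < d1 \<Longrightarrow> dist (P y) (P x) < \<bar>P x - Q x\<bar> / 2"
    using cP e unfolding continuous_at by (metis LIM_def dist_self)
  obtain d2 where d2: "d2 > 0" "\<And>y. dist y x < d2 \<Longrightarrow> dist (Q y) (Q x) < \<bar>P x - Q x\<bar> / 2"
    using cQ e unfolding continuous_at by (metis LIM_def dist_self)
  obtain d3 where d3: "d3 > 0" "\<And>y. dist y x < d3 \<Longrightarrow> y \<in> U"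
    using assms(1,2) unfolding open_dist by metis
  define d where "d = Min {d1, d2, d3}"
  have d: "d > 0" "d \<le> d1" "d \<le> d2" "d \<le> d3" using d1 d2 d3 by (auto simp: d_def)
  define t where "t = d / (2 * (norm u + norm v + 1))"
  have "t > 0" using d by (simp add: t_def pos_add_strict add_nonneg_pos)
  have near: "dist (x + r *\<^sub>R u + s *\<^sub>R v) x < d" if "r \<in> {0..t}" "s \<in> {0..t}" for r s
  proof -
    have "dist (x + r *\<^sub>R u + s *\<^sub>R v) x = norm (r *\<^sub>R u + s *\<^sub>R v)" by (simp add: dist_norm add.assoc)
    also have "\<dots> \<le> norm (r *\<^sub>R u) + norm (s *\<^sub>R v)" by (rule norm_triangle_ineq)
    also have "\<dots> \<le> t * norm u + t * norm v"
      using that by (intro add_mono) (auto intro!: mult_right_mono)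
    also have "\<dots> < t * (2 * (norm u + norm v + 1))"
    proof -
      have "0 \<le> t * norm u" "0 \<le> t * norm v" using \<open>t > 0\<close> by simp_all
      moreover have "t * (2 * (norm u + norm v + 1)) = 2 * (t * norm u) + 2 * (t * norm v) + 2 * t"
        by (simp add: algebra_simps)
      ultimately show ?thesis using \<open>t > 0\<close> by linarith
    qed
    also have "\<dots> = d"
    proof -
      have "2 * (norm u + norm v + 1) > 0" by (simp add: add_nonneg_pos)
      then show ?thesis unfolding t_def by (metis nonzero_eq_divide_eq order_less_irrefl)
    qed
    finally show ?thesis .
  qed
  have U: "x + r *\<^sub>R u + s *\<^sub>R v \<in> U" if "r \<in> {0..t}" "s \<in> {0..t}" for r s
    using near[OF that] d d3 by force
  have U': "x + r *\<^sub>R v + s *\<^sub>R u \<in> U" if "r \<in> {0..t}" "s \<in> {0..t}" for r s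
    using U[OF that(2,1)] by (simp add: algebra_simps)
  obtain r s where rs: "r \<in> {0..t}" "s \<in> {0..t}"
    "F (x + t *\<^sub>R u + t *\<^sub>R v) - F (x + t *\<^sub>R u) - F (x + t *\<^sub>R v) + F x
      = t * t * P (x + r *\<^sub>R u + s *\<^sub>R v)"
    using second_difference_mean_value[OF \<open>t > 0\<close> U F] unfolding P_def by blast
  obtain r' s' where rs': "r' \<in> {0..t}" "s' \<in> {0..t}"
    "F (x + t *\<^sub>R v + t *\<^sub>R u) - F (x + t *\<^sub>R v) - F (x + t *\<^sub>R u) + F x
      = t * t * Q (x + r' *\<^sub>R v + s' *\<^sub>R u)"
    using second_difference_mean_value[OF \<open>t > 0\<close> U' F] unfolding Q_def by blast
  have "t * t * P (x + r *\<^sub>R u + s *\<^sub>R v) = t * t * Q (x + s' *\<^sub>R u + r' *\<^sub>R v)"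
    using rs(3) rs'(3) by (simp add: algebra_simps)
  then have "P (x + r *\<^sub>R u + s *\<^sub>R v) = Q (x + s' *\<^sub>R u + r' *\<^sub>R v)" using \<open>t > 0\<close> by simp
  moreover have "dist (P (x + r *\<^sub>R u + s *\<^sub>R v)) (P x) < \<bar>P x - Q x\<bar> / 2"
    using d1(2) near[OF rs(1,2)] d by force
  moreover have "dist (Q (x + s' *\<^sub>R u + r' *\<^sub>R v)) (Q x) < \<bar>P x - Q x\<bar> / 2"
    using d2(2) near[OF rs'(2,1)] d by force
  ultimately show False unfolding dist_real_def by argo
qed

lemma dir_deriv_commute:
  fixes F :: "'a::euclidean_space \<Rightarrow> 'b::euclidean_space"
  assumes "open U" "x \<in> U" and F: "smooth_on U F"
  shows "dir_deriv v (dir_deriv u F) x = dir_deriv u (dir_deriv v F) x"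
proof (rule euclidean_eqI)
  fix b :: 'b assume "b \<in> Basis"
  have comp: "dir_deriv w G y \<bullet> b = dir_deriv w (\<lambda>y. G y \<bullet> b) y" if "smooth_on U G" "y \<in> U" for G w y
    using dir_deriv_bounded_linear[OF bounded_linear_inner_left smooth_on_differentiable[OF that]] by simp
  have two: "dir_deriv w' (dir_deriv w F) x \<bullet> b = dir_deriv w' (dir_deriv w (\<lambda>y. F y \<bullet> b)) x" for w w'
    using comp[OF smooth_on_dir_deriv[OF F] assms(2)] comp[OF F]
      dir_deriv_cong[OF assms(1,2), of "\<lambda>y. dir_deriv w F y \<bullet> b"] by metis
  show "dir_deriv v (dir_deriv u F) x \<bullet> b = dir_deriv u (dir_deriv v F) x \<bullet> b"
    unfolding two
    by (rule dir_deriv_commute_real[OF assms(1,2)]) (rule smooth_on_bounded_linear[OF assms(1) bounded_linear_inner_left F])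
qed

section \<open>Self-adjoint operators and symmetric functions of eigenvalues\<close>

text \<open>
  Let \<open>m\<close> maximize the Rayleigh quotient on the unit sphere, with maximum \<open>k\<close>.  The quadratic form
  \<open>k \<bar>x\<bar>\<^sup>2 - x \<bullet> T x\<close> is nonnegative and vanishes at \<open>m\<close>, hence so does its first variation, which says
  that \<open>T m - k m\<close> is orthogonal to everything, in particular to itself.
\<close>

lemma selfadjoint_eigenvector:
  fixes V :: "'e::euclidean_space set"
  assumes "subspace V" "V \<noteq> {0}" "linear T" "\<And>v. v \<in> V \<Longrightarrow> T v \<in> V"
    and sym: "\<And>v w. v \<in> V \<Longrightarrow> w \<in> V \<Longrightarrow> T v \<bullet> w = v \<bullet> T w"
  obtains m k where "m \<in> V" "norm m = 1" "T m = k *\<^sub>R m"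
proof -
  have cT: "continuous_on S T" for S using assms(3) by (simp add: linear_continuous_on linear_conv_bounded_linear)
  obtain v0 where v0: "v0 \<in> V" "v0 \<noteq> 0" using assms(1,2) subspace_0 by fastforce
  have "compact (sphere 0 1 \<inter> V)" using closed_subspace[OF assms(1)] by (simp add: compact_Int_closed)
  moreover have "v0 /\<^sub>R norm v0 \<in> sphere 0 1 \<inter> V" using v0 assms(1) by (simp add: subspace_mul)
  moreover have "continuous_on (sphere 0 1 \<inter> V) (\<lambda>x. x \<bullet> T x)" by (intro continuous_intros cT)
  ultimately obtain m where m: "m \<in> sphere 0 1 \<inter> V" "\<And>y. y \<in> sphere 0 1 \<inter> V \<Longrightarrow> y \<bullet> T y \<le> m \<bullet> T m"
    using continuous_attains_sup[of "sphere 0 1 \<inter> V"] by blast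
  define k where "k = m \<bullet> T m"
  define q where "q v = k * (v \<bullet> v) - v \<bullet> T v" for v
  have T0: "T 0 = 0" using assms(3) linear_0 by blast
  have q_nonneg: "0 \<le> q v" if "v \<in> V" for v
  proof (cases "v = 0")
    case False
    have "(v /\<^sub>R norm v) \<bullet> T (v /\<^sub>R norm v) \<le> k"
      using m(2)[of "v /\<^sub>R norm v"] False that assms(1) by (simp add: subspace_mul k_def)
    then have "(v \<bullet> T v) / (norm v)\<^sup>2 \<le> k"
      by (simp add: linear_cmul[OF assms(3)] power2_eq_square field_simps)
    then show ?thesis using False by (simp add: q_def dot_square_norm field_simps)
  qed (simp add: q_def T0)
  define w where "w = T m - k *\<^sub>R m"
  have wV: "w \<in> V" using m(1) assms(1,4) by (simp add: w_def subspace_diff subspace_mul)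
  have mm: "m \<bullet> m = 1" using m(1) by (simp add: norm_eq_1)
  have q: "q (m + t *\<^sub>R w) = t\<^sup>2 * q w - 2 * t * (w \<bullet> w)" for t
  proof -
    have "w \<bullet> T m = w \<bullet> w + k * (w \<bullet> m)" by (simp add: w_def inner_diff_right inner_diff_left algebra_simps)
    moreover have "m \<bullet> T w = w \<bullet> T m" using sym[of m w] m(1) wV by (simp add: inner_commute)
    ultimately show ?thesis
      by (simp add: q_def linear_add[OF assms(3)] linear_cmul[OF assms(3)] inner_add_left inner_add_right
          mm k_def[symmetric] inner_commute[of m w] power2_eq_square algebra_simps)
  qed
  have "w \<bullet> w = 0"
  proof (rule ccontr)
    assume "w \<bullet> w \<noteq> 0"
    then have pos: "w \<bullet> w > 0" by simp
    \<comment> \<open>small enough for the term of \<open>q (m + t w)\<close> linear in \<open>t\<close> to dominate the quadratic one\<close>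
    define t where "t = (w \<bullet> w) / (q w + 1)"
    have qw: "q w \<ge> 0" by (rule q_nonneg[OF wV])
    then have t: "t > 0" "t * q w < w \<bullet> w" using pos by (simp_all add: t_def field_simps)
    have "t * (2 * (w \<bullet> w)) \<le> t * (t * q w)"
      using q_nonneg[of "m + t *\<^sub>R w"] q[of t] m(1) wV assms(1)
      by (simp add: subspace_add subspace_mul power2_eq_square algebra_simps)
    then show False using t pos by simp
  qed
  then show ?thesis using m(1) by (intro that[of m k]) (auto simp: w_def)
qed

text \<open>The orthogonal complement of an eigenvector is invariant, so the dimension can be reduced.\<close>

lemma selfadjoint_eigenbasis:
  fixes V :: "'e::euclidean_space set"
  assumes "subspace V" "linear T" "\<And>v. v \<in> V \<Longrightarrow> T v \<in> V"
    and "\<And>v w. v \<in> V \<Longrightarrow> w \<in> V \<Longrightarrow> T v \<bullet> w = v \<bullet> T w"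
  shows "\<exists>B. B \<subseteq> V \<and> pairwise orthogonal B \<and> (\<forall>b\<in>B. norm b = 1) \<and> card B = dim V \<and> finite B \<and>
           (\<forall>b\<in>B. \<exists>k. T b = k *\<^sub>R b)"
  using assms
proof (induction "dim V" arbitrary: V)
  case 0
  then show ?case by (intro exI[of _ "{}"]) auto
next
  case (Suc d)
  then have "V \<noteq> {0}" by auto
  then obtain m k where m: "m \<in> V" "norm m = 1" "T m = k *\<^sub>R m"
    using selfadjoint_eigenvector[OF Suc.prems(1) _ Suc.prems(2-4)] by metis
  define W where "W = {v \<in> V. orthogonal m v}"
  have W: "subspace W" "W \<subseteq> V"
    using Suc.prems(1) by (auto simp: W_def subspace_def orthogonal_def inner_add_right)
  have "dim W + dim {m} = dim V"
  proof -
    have "{v \<in> span V. \<forall>x \<in> span {m}. orthogonal x v} = W"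
      using Suc.prems(1) unfolding W_def
      by (auto simp: span_eq_iff[THEN iffD2] orthogonal_def span_singleton)
    then show ?thesis using dim_subspace_orthogonal_to_vectors[of "span {m}" V] m(1) Suc.prems(1)
      by (simp add: span_eq_iff[THEN iffD2] span_minimal)
  qed
  moreover have "dim {m} = 1" using m(2) by (simp add: dim_insert) auto
  ultimately have dW: "d = dim W" using Suc.hyps(2) by simp
  have inv: "T v \<in> W" if "v \<in> W" for v
  proof -
    have "m \<bullet> T v = T m \<bullet> v" using Suc.prems(4)[of m v] m(1) that W by auto
    then show ?thesis using that Suc.prems(3) m(3) by (auto simp: W_def orthogonal_def)
  qed
  obtain B where B: "B \<subseteq> W" "pairwise orthogonal B" "\<forall>b\<in>B. norm b = 1" "card B = dim W" "finite B"
    "\<forall>b\<in>B. \<exists>k. T b = k *\<^sub>R b"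
    using Suc.hyps(1)[OF dW W(1) Suc.prems(2) inv] Suc.prems(4) W(2) by (smt (verit) in_mono)
  have "m \<notin> B" using B(1) m(2) by (auto simp: W_def orthogonal_def)
  moreover have "pairwise orthogonal (insert m B)"
    using B(1,2) by (auto simp: pairwise_insert W_def orthogonal_commute)
  ultimately show ?case
    using B m W dW Suc.hyps(2) by (intro exI[of _ "insert m B"]) auto
qed

definition orthonormal :: "('n \<Rightarrow> 'e::euclidean_space) \<Rightarrow> bool" where
  "orthonormal b \<longleftrightarrow> (\<forall>i j. b i \<bullet> b j = (if i = j then 1 else 0))"

lemma orthonormal_inner: "orthonormal b \<Longrightarrow> b i \<bullet> b j = (if i = j then 1 else 0)"
  by (simp add: orthonormal_def)

lemma orthonormal_sum_inner:
  fixes b :: "'n::finite \<Rightarrow> 'e::euclidean_space"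
  assumes "orthonormal b"
  shows "(\<Sum>i\<in>UNIV. c i *\<^sub>R b i) \<bullet> b j = c j"
  by (simp add: inner_sum_left orthonormal_inner[OF assms] if_distrib[of "\<lambda>x. _ * x"] cong: if_cong)

lemma selfadjoint_orthonormal_eigenframe:
  fixes V :: "'e::euclidean_space set"
  assumes "subspace V" "linear T" "\<And>v. v \<in> V \<Longrightarrow> T v \<in> V"
    and "\<And>v w. v \<in> V \<Longrightarrow> w \<in> V \<Longrightarrow> T v \<bullet> w = v \<bullet> T w" and "dim V = CARD('n::finite)"
  obtains b :: "'n::finite \<Rightarrow> 'e" and \<kappa> where "orthonormal b" "\<And>i. b i \<in> V" "\<And>i. T (b i) = \<kappa> i *\<^sub>R b i"
proof -
  obtain B where B: "B \<subseteq> V" "pairwise orthogonal B" "\<forall>b\<in>B. norm b = 1" "card B = dim V" "finite B"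
    "\<forall>b\<in>B. \<exists>k. T b = k *\<^sub>R b"
    using selfadjoint_eigenbasis[OF assms(1-4)] by metis
  obtain b where b: "bij_betw b (UNIV :: 'n set) B"
    using finite_same_card_bij[OF finite[of "UNIV :: 'n set"] B(5)] B(4) assms(5) by metis
  have bB: "b i \<in> B" for i using b by (auto simp: bij_betw_def)
  have "\<forall>i. \<exists>k. T (b i) = k *\<^sub>R b i" using B(6) bB by blast
  from choice[OF this] obtain \<kappa> where "\<And>i. T (b i) = \<kappa> i *\<^sub>R b i" by blast
  moreover have "orthonormal b"
    unfolding orthonormal_def
  proof (intro allI)
    fix i j
    show "b i \<bullet> b j = (if i = j then 1 else 0)"
    proof (cases "i = j")
      case True
      then show ?thesis using B(3) bB by (simp add: norm_eq_1)
    next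
      case False
      then have "b i \<noteq> b j" using b by (auto simp: bij_betw_def inj_on_def)
      then show ?thesis using False B(2) bB by (auto simp: pairwise_def orthogonal_def)
    qed
  qed
  ultimately show ?thesis using that bB B(1) by blast
qed

lemma trace_similar:
  fixes A W D :: "real^'n^'n::finite"
  assumes "A ** W = W ** D" "invertible W"
  shows "trace A = trace D" "trace (A ** A) = trace (D ** D)"
proof -
  obtain W' where W': "W ** W' = mat 1" "W' ** W = mat 1" using assms(2) unfolding invertible_def by blast
  have A: "A = W ** D ** W'" using assms(1) W'(1) by (metis matrix_mul_assoc matrix_mul_rid)
  show "trace A = trace D"
    unfolding A by (metis trace_mul_sym W'(2) matrix_mul_assoc matrix_mul_lid)
  have "A ** A = W ** (D ** D) ** W'"
    unfolding A by (metis W'(2) matrix_mul_assoc matrix_mul_lid)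
  then show "trace (A ** A) = trace (D ** D)"
    by (metis trace_mul_sym W'(2) matrix_mul_assoc matrix_mul_lid)
qed

subsection \<open>Elementary symmetric functions\<close>

definition esym :: "nat \<Rightarrow> ('i \<Rightarrow> real) \<Rightarrow> 'i set \<Rightarrow> real" where
  "esym r \<kappa> A = (\<Sum>I | I \<subseteq> A \<and> card I = r. \<Prod>i\<in>I. \<kappa> i)"

lemma esym_0: "finite A \<Longrightarrow> esym 0 \<kappa> A = 1"
proof -
  assume "finite A"
  then have "{I. I \<subseteq> A \<and> card I = 0} = {{}}" by (auto dest: finite_subset)
  then show ?thesis by (simp add: esym_def)
qed

lemma esym_empty: "esym (Suc r) \<kappa> {} = 0"
  by (simp add: esym_def)

lemma esym_insert:
  assumes "finite A" "x \<notin> A"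
  shows "esym (Suc r) \<kappa> (insert x A) = esym (Suc r) \<kappa> A + \<kappa> x * esym r \<kappa> A"
proof -
  let ?P = "\<lambda>s. {I. I \<subseteq> A \<and> card I = s}"
  have fin: "finite (?P s)" for s using assms(1) by auto
  have "{I. I \<subseteq> insert x A \<and> card I = Suc r} = ?P (Suc r) \<union> insert x ` ?P r" (is "?L = ?R")
  proof (intro equalityI subsetI)
    fix I assume I: "I \<in> ?L"
    show "I \<in> ?R"
    proof (cases "x \<in> I")
      case True
      have "finite I" using I assms(1) by (auto dest: finite_subset)
      then have "I - {x} \<in> ?P r" using I True by auto
      moreover have "I = insert x (I - {x})" using True by auto
      ultimately show ?thesis by blast
    qed (use I in auto)
  next
    fix I assume "I \<in> ?R"
    moreover have "finite J" "x \<notin> J" if "J \<subseteq> A" for J using that assms by (auto dest: finite_subset)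
    ultimately show "I \<in> ?L" by auto
  qed
  moreover have "?P (Suc r) \<inter> insert x ` ?P r = {}" using assms(2) by auto
  moreover have "(\<Sum>I\<in>insert x ` ?P r. \<Prod>i\<in>I. \<kappa> i) = \<kappa> x * esym r \<kappa> A"
  proof -
    have "inj_on (insert x) (?P r)" using assms(2) by (intro inj_onI) (metis (lifting) insert_ident mem_Collect_eq subsetD)
    then have "(\<Sum>I\<in>insert x ` ?P r. \<Prod>i\<in>I. \<kappa> i) = (\<Sum>I\<in>?P r. \<Prod>i\<in>insert x I. \<kappa> i)"
      by (simp add: sum.reindex)
    also have "\<dots> = (\<Sum>I\<in>?P r. \<kappa> x * (\<Prod>i\<in>I. \<kappa> i))"
    proof (rule sum.cong[OF refl])
      fix I assume "I \<in> ?P r"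
      then have "finite I" "x \<notin> I" using assms by (auto dest: finite_subset)
      then show "(\<Prod>i\<in>insert x I. \<kappa> i) = \<kappa> x * (\<Prod>i\<in>I. \<kappa> i)" by simp
    qed
    finally show ?thesis by (simp add: esym_def sum_distrib_left)
  qed
  ultimately show ?thesis using fin by (simp add: esym_def sum.union_disjoint)
qed

text \<open>
  All three identities follow by adding one element at a time, since \<open>e\<^sub>r\<close> of the larger set is
  \<open>e\<^sub>r + \<kappa> x e\<^sub>r\<^sub>-\<^sub>1\<close> of the smaller one.
\<close>

lemma newton_power_sums:
  assumes "finite A"
  shows "esym 1 \<kappa> A = (\<Sum>i\<in>A. \<kappa> i)"
    and "(\<Sum>i\<in>A. (\<kappa> i)^2) = (esym 1 \<kappa> A)^2 - 2 * esym 2 \<kappa> A"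
    and "(\<Sum>i\<in>A. (\<kappa> i)^3) = (esym 1 \<kappa> A)^3 - 3 * esym 1 \<kappa> A * esym 2 \<kappa> A + 3 * esym 3 \<kappa> A"
proof -
  have num: "(2::nat) = Suc 1" "(3::nat) = Suc 2" "(1::nat) = Suc 0" by auto
  have rec: "esym 1 \<kappa> (insert x F) = esym 1 \<kappa> F + \<kappa> x" "esym 2 \<kappa> (insert x F) = esym 2 \<kappa> F + \<kappa> x * esym 1 \<kappa> F"
    "esym 3 \<kappa> (insert x F) = esym 3 \<kappa> F + \<kappa> x * esym 2 \<kappa> F" if "finite F" "x \<notin> F" for x F
    using esym_insert[OF that, of 0] esym_insert[OF that, of 1] esym_insert[OF that, of 2] esym_0[OF that(1)]
    by (simp_all add: numeral_2_eq_2 numeral_3_eq_3)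
  have base: "esym 1 \<kappa> {} = 0" "esym 2 \<kappa> {} = 0" "esym 3 \<kappa> {} = 0"
    using esym_empty[of 0] esym_empty[of 1] esym_empty[of 2] by (simp_all add: numeral_2_eq_2 numeral_3_eq_3)
  show "esym 1 \<kappa> A = (\<Sum>i\<in>A. \<kappa> i)"
    using assms
  proof (induction A)
    case (insert x F)
    show ?case unfolding rec[OF insert(1,2)] sum.insert[OF insert(1,2)] insert(3) by simp
  qed (use base in simp)
  show "(\<Sum>i\<in>A. (\<kappa> i)^2) = (esym 1 \<kappa> A)^2 - 2 * esym 2 \<kappa> A"
    using assms
  proof (induction A)
    case (insert x F)
    show ?case unfolding rec[OF insert(1,2)] sum.insert[OF insert(1,2)] insert(3)
      by (simp add: power2_eq_square algebra_simps)
  qed (use base in simp)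
  show "(\<Sum>i\<in>A. (\<kappa> i)^3) = (esym 1 \<kappa> A)^3 - 3 * esym 1 \<kappa> A * esym 2 \<kappa> A + 3 * esym 3 \<kappa> A"
    using assms
  proof (induction A)
    case (insert x F)
    show ?case unfolding rec[OF insert(1,2)] sum.insert[OF insert(1,2)] insert(3)
      by (simp add: power3_eq_cube algebra_simps)
  qed (use base in simp)
qed

lemma prod_linear_factors:
  assumes "finite A"
  shows "(\<Prod>i\<in>A. t - \<kappa> i) = (\<Sum>r\<le>card A. (-1)^r * esym r \<kappa> A * t ^ (card A - r))"
  using assms
proof (induction A)
  case (insert x F)
  let ?n = "card F" and ?e = "\<lambda>r. esym r \<kappa> F"
  have over: "esym (Suc ?n) \<kappa> F = 0"
  proof -
    have "{I. I \<subseteq> F \<and> card I = Suc ?n} = {}" using insert(1) by (auto dest: card_mono)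
    then show ?thesis unfolding esym_def by (simp only: sum.empty)
  qed
  have "(\<Prod>i\<in>insert x F. t - \<kappa> i) = t * (\<Sum>r\<le>?n. (-1)^r * ?e r * t ^ (?n - r)) - \<kappa> x * (\<Sum>r\<le>?n. (-1)^r * ?e r * t ^ (?n - r))"
    using insert by (simp add: algebra_simps)
  also have "t * (\<Sum>r\<le>?n. (-1)^r * ?e r * t ^ (?n - r)) = (\<Sum>r\<le>?n. (-1)^r * ?e r * t ^ (Suc ?n - r))"
    by (simp add: sum_distrib_left Suc_diff_le algebra_simps)
  also have "\<dots> = (\<Sum>r\<le>Suc ?n. (-1)^r * ?e r * t ^ (Suc ?n - r))" by (simp add: over)
  also have "\<dots> = t ^ Suc ?n + (\<Sum>r\<le>?n. (-1)^Suc r * ?e (Suc r) * t ^ (?n - r))"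
    by (subst sum.atMost_Suc_shift) (simp add: esym_0[OF insert(1)])
  also have "\<dots> - \<kappa> x * (\<Sum>r\<le>?n. (-1)^r * ?e r * t ^ (?n - r)) =
      t ^ Suc ?n + (\<Sum>r\<le>?n. (-1)^Suc r * esym (Suc r) \<kappa> (insert x F) * t ^ (?n - r))"
    by (simp add: esym_insert[OF insert(1,2)] sum_distrib_left sum_subtractf[symmetric] sum.distrib[symmetric] algebra_simps
        flip: sum_negf)
  also have "\<dots> = (\<Sum>r\<le>Suc ?n. (-1)^r * esym r \<kappa> (insert x F) * t ^ (Suc ?n - r))"
    using insert(1) by (subst sum.atMost_Suc_shift) (simp add: esym_0)
  finally show ?case using insert(1,2) by simp
qed (simp add: esym_0)

text \<open>
  For \<open>t > 0\<close> every summand of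
  \<open>t\<^sup>4 (t - a)\<^sup>2 - e\<^sub>3 t\<^sup>3 + e\<^sub>4 t\<^sup>2 - e\<^sub>5 t + e\<^sub>6\<close> is nonnegative, and this
  polynomial vanishes at a positive principal curvature, which exists since the trace is positive.
  Hence all the summands vanish there, and the characteristic polynomial is \<open>t\<^sup>4 (t - a)\<^sup>2\<close>.
\<close>

lemma six_curvatures_two_valued:
  fixes \<kappa> :: "'n::finite \<Rightarrow> real"
  assumes "CARD('n) = 6" "a > 0"
    and e: "esym 1 \<kappa> UNIV = 2 * a" "esym 2 \<kappa> UNIV = a\<^sup>2" "esym 3 \<kappa> UNIV \<le> 0"
      "esym 4 \<kappa> UNIV \<ge> 0" "esym 5 \<kappa> UNIV \<le> 0" "esym 6 \<kappa> UNIV \<ge> 0"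
  shows "esym 3 \<kappa> UNIV = 0" "\<kappa> i = 0 \<or> \<kappa> i = a"
proof -
  define P where "P t = t^4 * (t - a)^2 - esym 3 \<kappa> UNIV * t^3 + esym 4 \<kappa> UNIV * t^2 - esym 5 \<kappa> UNIV * t + esym 6 \<kappa> UNIV" for t
  have P: "(\<Prod>i\<in>UNIV. t - \<kappa> i) = P t" for t
  proof -
    have "(\<Prod>i\<in>UNIV. t - \<kappa> i) = (\<Sum>r\<le>6. (-1)^r * esym r \<kappa> UNIV * t ^ (6 - r))"
      using prod_linear_factors[of "UNIV :: 'n set" t \<kappa>] assms(1) by simp
    also have "\<dots> = t^6 - esym 1 \<kappa> UNIV * t^5 + esym 2 \<kappa> UNIV * t^4 - esym 3 \<kappa> UNIV * t^3
        + esym 4 \<kappa> UNIV * t^2 - esym 5 \<kappa> UNIV * t + esym 6 \<kappa> UNIV"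
      by (simp add: numeral_eq_Suc esym_0)
    finally show ?thesis unfolding e(1,2) P_def by (simp add: power2_eq_square power4_eq_xxxx algebra_simps numeral_eq_Suc)
  qed
  have root: "P (\<kappa> i) = 0" for i unfolding P[symmetric] by (rule prod_zero) auto
  have "\<exists>i. \<kappa> i > 0"
  proof (rule ccontr)
    assume "\<not> ?thesis"
    then have "(\<Sum>i\<in>UNIV. \<kappa> i) \<le> 0" by (intro sum_nonpos) (simp add: not_less)
    then show False using e(1) assms(2) newton_power_sums(1)[of UNIV \<kappa>] by simp
  qed
  then obtain j where j: "\<kappa> j > 0" by blast
  have "(\<kappa> j)^4 * (\<kappa> j - a)^2 \<ge> 0" "esym 3 \<kappa> UNIV * (\<kappa> j)^3 \<le> 0" "esym 4 \<kappa> UNIV * (\<kappa> j)^2 \<ge> 0"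
    "esym 5 \<kappa> UNIV * \<kappa> j \<le> 0"
    using j e by (simp_all add: mult_nonpos_nonneg)
  then have "esym 3 \<kappa> UNIV * (\<kappa> j)^3 = 0" "esym 4 \<kappa> UNIV * (\<kappa> j)^2 = 0" "esym 5 \<kappa> UNIV * \<kappa> j = 0"
    "esym 6 \<kappa> UNIV = 0"
    using root[of j] e(6) unfolding P_def by linarith+
  then have z: "esym 3 \<kappa> UNIV = 0" "esym 4 \<kappa> UNIV = 0" "esym 5 \<kappa> UNIV = 0" "esym 6 \<kappa> UNIV = 0"
    using j by auto
  show "esym 3 \<kappa> UNIV = 0" by (rule z)
  show "\<kappa> i = 0 \<or> \<kappa> i = a" using root[of i] unfolding P_def z by simp
qed

section \<open>The shape operator and the Gauss equation\<close>

lemma partial_eq_dir_deriv: "partial i h = dir_deriv (axis i 1) h"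
  by (simp add: partial_def dir_deriv_def fun_eq_iff)

text \<open>
  An orthonormal frame is a basis, so that \<open>A\<close> and its matrix \<open>D\<close> in the frame are similar.
\<close>

lemma trace_in_orthonormal_frame:
  fixes A D :: "real^'n^'n::finite"
  assumes "orthonormal_frame G e" "\<And>j. A *v e j = (\<Sum>i\<in>UNIV. D $ i $ j *\<^sub>R e i)"
  shows "trace A = trace D" "trace (A ** A) = trace (D ** D)"
proof -
  define E where "E = (\<chi> i j. e j $ i)"
  have "(transpose E ** (G ** E)) $ i $ j = e i \<bullet> (G *v e j)" for i j
    by (simp add: E_def matrix_matrix_mult_def transpose_def inner_vec_def matrix_vector_mult_def)
  then have "transpose E ** G ** E = mat 1"
    using assms(1) by (simp add: vec_eq_iff orthonormal_frame_def mat_def matrix_mul_assoc)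
  then have inv: "invertible E" by (metis invertible_left_inverse)
  have "(A ** E) $ i $ j = (A *v e j) $ i" for i j
    by (simp add: E_def matrix_matrix_mult_def matrix_vector_mult_def)
  moreover have "(E ** D) $ i $ j = (\<Sum>k\<in>UNIV. D $ k $ j *\<^sub>R e k) $ i" for i j
    by (simp add: E_def matrix_matrix_mult_def mult.commute)
  ultimately have "A ** E = E ** D" by (simp add: vec_eq_iff assms(2))
  from trace_similar[OF this inv] show "trace A = trace D" "trace (A ** A) = trace (D ** D)" by auto
qed

text \<open>
  A parametrized piece of an immersed hypersurface with a unit normal.  No metric is mentioned here: the
  induced one is \<open>dir_deriv u X x \<bullet> dir_deriv v X x\<close>, and \<open>hypersurface_metric\<close> below adds its Gram
  matrices, which the intrinsic notions of curvature are built from.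
\<close>

locale hypersurface_patch =
  fixes U :: "(real^'n::finite) set" and X N :: "real^'n \<Rightarrow> 'e::euclidean_space"
  assumes open_U: "open U" and smooth_X: "smooth_on U X" and smooth_N: "smooth_on U N"
    and immersion: "x \<in> U \<Longrightarrow> dir_deriv v X x = 0 \<Longrightarrow> v = 0"
    and normal: "x \<in> U \<Longrightarrow> N x \<bullet> dir_deriv v X x = 0"
    and unit: "x \<in> U \<Longrightarrow> norm (N x) = 1"
    and codim: "DIM('e) = Suc CARD('n)"
begin

abbreviation "Xd i \<equiv> dir_deriv (axis i (1::real)) X"
abbreviation "Xdd i j \<equiv> dir_deriv (axis i (1::real)) (Xd j)"

lemma smooth_Xd: "smooth_on U (dir_deriv v X)" and smooth_Xdd: "smooth_on U (dir_deriv u (dir_deriv v X))"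
  and smooth_Nd: "smooth_on U (dir_deriv v N)"
  using smooth_X smooth_N by (simp_all add: smooth_on_dir_deriv)

lemma linear_dX: "x \<in> U \<Longrightarrow> linear (\<lambda>v. dir_deriv v X x)"
  and linear_dN: "x \<in> U \<Longrightarrow> linear (\<lambda>v. dir_deriv v N x)"
  using smooth_on_has_derivative[OF smooth_X] smooth_on_has_derivative[OF smooth_N] has_derivative_linear by blast+

lemma dX_expand: "x \<in> U \<Longrightarrow> dir_deriv v X x = (\<Sum>i\<in>UNIV. (v $ i) *\<^sub>R Xd i x)"
  and dN_expand: "x \<in> U \<Longrightarrow> dir_deriv v N x = (\<Sum>i\<in>UNIV. (v $ i) *\<^sub>R dir_deriv (axis i 1) N x)"
  using dir_deriv_axis smooth_on_differentiable smooth_X smooth_N by blast+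

lemma N_inner_N: "x \<in> U \<Longrightarrow> N x \<bullet> N x = 1"
  using unit by (simp add: norm_eq_1)

lemma dN_tangent: "x \<in> U \<Longrightarrow> N x \<bullet> dir_deriv v N x = 0"
proof -
  assume x: "x \<in> U"
  have d: "N differentiable (at x)" using smooth_on_differentiable smooth_N x by blast
  have "dir_deriv v (\<lambda>y. N y \<bullet> N y) x = dir_deriv v (\<lambda>y. 1) x"
    by (rule dir_deriv_cong[OF open_U x]) (rule N_inner_N)
  then show ?thesis by (simp add: dir_deriv_inner[OF d d] inner_commute)
qed

lemma inj_dX: "x \<in> U \<Longrightarrow> inj (\<lambda>v. dir_deriv v X x)"
  using linear_dX immersion by (simp add: linear_injective_0)

lemma range_dX: "x \<in> U \<Longrightarrow> range (\<lambda>v. dir_deriv v X x) = {w. N x \<bullet> w = 0}"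
proof (rule subspace_dim_equal)
  assume x: "x \<in> U"
  show "subspace (range (\<lambda>v. dir_deriv v X x))"
    using linear_subspace_image[OF linear_dX[OF x] subspace_UNIV] .
  show "subspace {w. N x \<bullet> w = 0}" by (rule subspace_hyperplane)
  show "range (\<lambda>v. dir_deriv v X x) \<subseteq> {w. N x \<bullet> w = 0}" using normal[OF x] by auto
  have "N x \<noteq> 0" using unit[OF x] by auto
  then have "dim {w. N x \<bullet> w = 0} = CARD('n)" using codim by (simp add: dim_hyperplane)
  moreover have "dim (range (\<lambda>v. dir_deriv v X x)) = CARD('n)"
    using dim_image_eq[OF linear_dX[OF x], of UNIV] inj_dX[OF x] by simp
  ultimately show "dim {w. N x \<bullet> w = 0} \<le> dim (range (\<lambda>v. dir_deriv v X x))" by simp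
qed

lemma tangent_obtain:
  assumes "x \<in> U" "N x \<bullet> w = 0"
  obtains v where "dir_deriv v X x = w"
  using range_dX[OF assms(1)] assms(2) by (metis (mono_tags, lifting) mem_Collect_eq rangeE)

text \<open>
  By the dimension count in \<open>range_dX\<close> the normal and the coordinate tangent vectors span the ambient space.
\<close>

lemma eq_if_inner_eq:
  assumes x: "x \<in> U" and "N x \<bullet> w = N x \<bullet> w'" "\<And>i. w \<bullet> Xd i x = w' \<bullet> Xd i x"
  shows "w = w'"
proof -
  have "N x \<bullet> (w - w') = 0" using assms(2) by (simp add: inner_diff_right)
  then obtain v where v: "dir_deriv v X x = w - w'" using tangent_obtain[OF x] by blast
  have "(w - w') \<bullet> (w - w') = (w - w') \<bullet> (\<Sum>i\<in>UNIV. (v $ i) *\<^sub>R Xd i x)"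
    using v dX_expand[OF x] by metis
  also have "\<dots> = 0" using assms(3) by (simp add: inner_sum_right inner_diff_left)
  finally show ?thesis by simp
qed

definition shape :: "real^'n \<Rightarrow> real^'n \<Rightarrow> real^'n" where
  "shape x v = (THE w. dir_deriv w X x = - dir_deriv v N x)"

lemma weingarten: "x \<in> U \<Longrightarrow> dir_deriv (shape x v) X x = - dir_deriv v N x"
proof -
  assume x: "x \<in> U"
  obtain w where w: "dir_deriv w X x = - dir_deriv v N x"
    using tangent_obtain[OF x] dN_tangent[OF x] by (metis inner_minus_right neg_equal_0_iff_equal)
  have "v' = w" if "dir_deriv v' X x = - dir_deriv v N x" for v'
    using injD[OF inj_dX[OF x], of v' w] that w by simp
  then show ?thesis unfolding shape_def using theI[of "\<lambda>w. dir_deriv w X x = - dir_deriv v N x", OF w] by blast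
qed

lemma shape_eqI: "x \<in> U \<Longrightarrow> dir_deriv w X x = - dir_deriv v N x \<Longrightarrow> shape x v = w"
  using weingarten inj_dX by (metis injD)

lemma linear_shape: "x \<in> U \<Longrightarrow> linear (shape x)"
  by (rule linearI; rule shape_eqI)
    (simp_all add: linear_add[OF linear_dX] linear_add[OF linear_dN] linear_cmul[OF linear_dX] linear_cmul[OF linear_dN] weingarten)

text \<open>
  The second fundamental form, with the sign for which it is the bilinear form of the shape operator.
\<close>

definition sff :: "real^'n \<Rightarrow> real^'n \<Rightarrow> real^'n \<Rightarrow> real" where
  "sff x u v = - (dir_deriv u N x \<bullet> dir_deriv v X x)"

text \<open>Differentiating \<open>N \<bullet> X\<^sub>v = 0\<close>.\<close>

lemma sff_second_derivative: "x \<in> U \<Longrightarrow> sff x u v = N x \<bullet> dir_deriv u (dir_deriv v X) x"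
proof -
  assume x: "x \<in> U"
  have "dir_deriv u (\<lambda>y. N y \<bullet> dir_deriv v X y) x = dir_deriv u (\<lambda>y. 0) x"
    by (rule dir_deriv_cong[OF open_U x]) (rule normal)
  then show ?thesis
    unfolding sff_def using smooth_on_differentiable[OF smooth_N x] smooth_on_differentiable[OF smooth_Xd x]
    by (simp add: dir_deriv_inner)
qed

lemma sff_sym: "x \<in> U \<Longrightarrow> sff x u v = sff x v u"
  using sff_second_derivative dir_deriv_commute[OF open_U _ smooth_X] by metis

lemma sff_shape: "x \<in> U \<Longrightarrow> sff x u v = dir_deriv (shape x u) X x \<bullet> dir_deriv v X x"
  by (simp add: sff_def weingarten)

lemma sff_expand:
  "x \<in> U \<Longrightarrow> sff x u v = (\<Sum>i\<in>UNIV. \<Sum>j\<in>UNIV. u $ i * v $ j * sff x (axis i 1) (axis j 1))"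
  by (subst sum.swap) (simp add: sff_def dX_expand[of x v] dN_expand[of x u] inner_sum_left inner_sum_right sum_negf
      sum_distrib_left algebra_simps)

text \<open>
  The shape operator is transported to the hyperplane orthogonal to \<open>N x\<close> in the ambient Euclidean space,
  so that the spectral theorem for the standard inner product applies.
\<close>

lemma principal_frame:
  assumes x: "x \<in> U"
  obtains w \<kappa> where "orthonormal (\<lambda>i::'n. dir_deriv (w i) X x)" "\<And>i. shape x (w i) = \<kappa> i *\<^sub>R w i"
proof -
  let ?V = "{w. N x \<bullet> w = 0}"
  obtain L where L: "linear L" "L \<circ> (\<lambda>v. dir_deriv v X x) = id"
    using linear_injective_left_inverse[OF linear_dX[OF x] inj_dX[OF x]] by blast
  have LX: "L (dir_deriv v X x) = v" for v using L(2) by (metis comp_apply id_apply)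
  define T where "T z = - dir_deriv (L z) N x" for z
  have lin: "linear T"
    using linear_compose_neg[OF linear_compose[OF L(1) linear_dN[OF x]]] by (simp add: o_def T_def[abs_def])
  have TX: "T (dir_deriv v X x) = dir_deriv (shape x v) X x" for v by (simp add: T_def LX weingarten[OF x])
  have sym: "T v \<bullet> w = v \<bullet> T w" if "v \<in> ?V" "w \<in> ?V" for v w
  proof -
    have "N x \<bullet> v = 0" "N x \<bullet> w = 0" using that by auto
    then obtain v' w' where "dir_deriv v' X x = v" "dir_deriv w' X x = w" using tangent_obtain[OF x] by metis
    then show ?thesis
      using TX[of v'] TX[of w'] sff_shape[OF x, of v' w'] sff_shape[OF x, of w' v'] sff_sym[OF x, of v' w']
      by (simp add: inner_commute)
  qed
  have "N x \<noteq> 0" using unit[OF x] by auto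
  then have "dim ?V = CARD('n)" using codim by (simp add: dim_hyperplane)
  moreover have "T v \<in> ?V" for v by (simp add: T_def dN_tangent[OF x])
  ultimately obtain b :: "'n \<Rightarrow> 'e" and \<kappa> where
    b: "orthonormal b" "\<And>i. b i \<in> ?V" "\<And>i. T (b i) = \<kappa> i *\<^sub>R b i"
    using selfadjoint_orthonormal_eigenframe[OF subspace_hyperplane lin, of "N x"] sym by metis
  have "\<exists>v. dir_deriv v X x = b i" for i using tangent_obtain[OF x] b(2) by blast
  then obtain w where w: "\<And>i. dir_deriv (w i) X x = b i" by metis
  have "dir_deriv (shape x (w i)) X x = dir_deriv (\<kappa> i *\<^sub>R w i) X x" for i
    using TX[of "w i"] b(3)[of i] w by (simp add: linear_cmul[OF linear_dX[OF x]])
  then have "shape x (w i) = \<kappa> i *\<^sub>R w i" for i using inj_dX[OF x] by (auto dest: injD)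
  then show ?thesis using that[of w \<kappa>] b(1) w by (simp add: fun_eq_iff)
qed

end

locale hypersurface_metric = hypersurface_patch U X N
  for U :: "(real^'n::finite) set" and X N :: "real^'n \<Rightarrow> 'e::euclidean_space" +
  fixes G :: "real^'n \<Rightarrow> real^'n^'n"
  assumes first_ff: "x \<in> U \<Longrightarrow> dir_deriv u X x \<bullet> dir_deriv v X x = u \<bullet> (G x *v v)"
begin

lemma G_nth: "x \<in> U \<Longrightarrow> G x $ i $ j = Xd i x \<bullet> Xd j x"
  using first_ff[of x "axis i 1" "axis j 1"] by (simp add: matrix_vector_mult_basis column_def inner_axis')

lemma invertible_G: "x \<in> U \<Longrightarrow> invertible (G x)"
proof -
  assume x: "x \<in> U"
  have "v = 0" if "G x *v v = 0" for v
    using first_ff[OF x, of v v] immersion[OF x, of v] that by simp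
  then show ?thesis using matrix_left_invertible_ker[of "G x"] invertible_left_inverse by blast
qed

lemma partial_G:
  assumes x: "x \<in> U"
  shows "partial i (\<lambda>y. G y $ j $ l) x = Xdd i j x \<bullet> Xd l x + Xd j x \<bullet> Xdd i l x"
proof -
  have "partial i (\<lambda>y. G y $ j $ l) x = dir_deriv (axis i 1) (\<lambda>y. Xd j y \<bullet> Xd l y) x"
    unfolding partial_eq_dir_deriv by (rule dir_deriv_cong[OF open_U x]) (rule G_nth)
  also have "\<dots> = Xdd i j x \<bullet> Xd l x + Xd j x \<bullet> Xdd i l x"
    using smooth_on_differentiable[OF smooth_Xd x] by (simp add: dir_deriv_inner)
  finally show ?thesis .
qed

lemma Xdd_commute: "x \<in> U \<Longrightarrow> Xdd i j x = Xdd j i x"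
  by (rule dir_deriv_commute[OF open_U _ smooth_X])

lemma christoffel_eq:
  assumes x: "x \<in> U"
  shows "christoffel G k i j x = (\<Sum>l\<in>UNIV. matrix_inv (G x) $ k $ l * (Xdd i j x \<bullet> Xd l x))"
proof -
  have "partial i (\<lambda>y. G y $ j $ l) x + partial j (\<lambda>y. G y $ i $ l) x - partial l (\<lambda>y. G y $ i $ j) x
      = 2 * (Xdd i j x \<bullet> Xd l x)" for l
    unfolding partial_G[OF x]
    using Xdd_commute[OF x, of i j] Xdd_commute[OF x, of l j] Xdd_commute[OF x, of l i]
    by (simp add: inner_commute)
  then show ?thesis unfolding christoffel_def by (simp add: sum_distrib_left algebra_simps)
qed

lemma smooth_sff: "smooth_on U (\<lambda>x. sff x u v)"
  unfolding sff_def by (intro smooth_on_uminus[OF open_U] smooth_on_inner[OF open_U] smooth_Nd smooth_Xd)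

lemma smooth_christoffel: "smooth_on U (christoffel G k i j)"
proof (rule smooth_on_cong[OF open_U])
  show "(\<Sum>l\<in>UNIV. matrix_inv (G x) $ k $ l * (Xdd i j x \<bullet> Xd l x)) = christoffel G k i j x" if "x \<in> U" for x
    by (rule christoffel_eq[OF that, symmetric])
  have "smooth_on U (\<lambda>x. G x $ a $ b)" for a b
    by (rule smooth_on_cong[OF open_U G_nth[symmetric]]) (assumption | intro smooth_on_inner[OF open_U] smooth_Xd)+
  then show "smooth_on U (\<lambda>x. \<Sum>l\<in>UNIV. matrix_inv (G x) $ k $ l * (Xdd i j x \<bullet> Xd l x))"
    by (intro smooth_on_sum[OF open_U] smooth_on_mult[OF open_U] smooth_on_inner[OF open_U] smooth_Xd smooth_Xdd
        smooth_on_matrix_inv[OF open_U] invertible_G)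
qed

lemma christoffel_contract:
  assumes x: "x \<in> U"
  shows "(\<Sum>k\<in>UNIV. christoffel G k i j x * (Xd k x \<bullet> Xd m x)) = Xdd i j x \<bullet> Xd m x"
proof -
  have inv: "(\<Sum>k\<in>UNIV. G x $ m $ k * matrix_inv (G x) $ k $ l) = (if m = l then 1 else 0)" for l
    using matrix_inv_inverse(1)[OF invertible_G[OF x]] by (simp add: vec_eq_iff matrix_matrix_mult_def mat_def)
  have "(\<Sum>k\<in>UNIV. christoffel G k i j x * (Xd k x \<bullet> Xd m x))
      = (\<Sum>k\<in>UNIV. \<Sum>l\<in>UNIV. (G x $ m $ k * matrix_inv (G x) $ k $ l) * (Xdd i j x \<bullet> Xd l x))"
    by (simp add: christoffel_eq[OF x] G_nth[OF x] sum_distrib_left sum_distrib_right inner_commute mult_ac)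
  also have "\<dots> = (\<Sum>l\<in>UNIV. \<Sum>k\<in>UNIV. (G x $ m $ k * matrix_inv (G x) $ k $ l) * (Xdd i j x \<bullet> Xd l x))"
    by (rule sum.swap)
  also have "\<dots> = (\<Sum>l\<in>UNIV. (if m = l then 1 else 0) * (Xdd i j x \<bullet> Xd l x))"
    by (simp add: inv flip: sum_distrib_right)
  also have "\<dots> = Xdd i j x \<bullet> Xd m x" by (simp add: if_distrib[of "\<lambda>z. z * _"] cong: if_cong)
  finally show ?thesis .
qed

text \<open>The Gauss formula: the Christoffel symbols give the tangential part of the second derivatives.\<close>

lemma gauss_formula:
  assumes x: "x \<in> U"
  shows "(\<Sum>k\<in>UNIV. christoffel G k i j x *\<^sub>R Xd k x) = Xdd i j x - sff x (axis i 1) (axis j 1) *\<^sub>R N x"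
proof (rule eq_if_inner_eq[OF x])
  show "N x \<bullet> (\<Sum>k\<in>UNIV. christoffel G k i j x *\<^sub>R Xd k x) =
      N x \<bullet> (Xdd i j x - sff x (axis i 1) (axis j 1) *\<^sub>R N x)"
    using x by (simp add: inner_sum_right normal inner_diff_right N_inner_N sff_second_derivative)
  show "(\<Sum>k\<in>UNIV. christoffel G k i j x *\<^sub>R Xd k x) \<bullet> Xd m x =
      (Xdd i j x - sff x (axis i 1) (axis j 1) *\<^sub>R N x) \<bullet> Xd m x" for m
    using x by (simp add: inner_sum_left christoffel_contract normal inner_diff_left)
qed

lemma gauss_formula_derivative:
  assumes x: "x \<in> U"
  shows "(\<Sum>l\<in>UNIV. partial i (christoffel G l j k) x * (Xd l x \<bullet> Xd m x))
      + (\<Sum>l\<in>UNIV. christoffel G l j k x * (Xdd i l x \<bullet> Xd m x))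
    = dir_deriv (axis i 1) (Xdd j k) x \<bullet> Xd m x + sff x (axis j 1) (axis k 1) * sff x (axis i 1) (axis m 1)"
proof -
  have dc: "christoffel G l a b differentiable (at x)" for l a b
    using smooth_christoffel smooth_on_differentiable x by blast
  have dX: "Xd a differentiable (at x)" "Xdd a b differentiable (at x)" for a b
    using smooth_Xd smooth_Xdd smooth_on_differentiable x by blast+
  have dN: "N differentiable (at x)" using smooth_N smooth_on_differentiable x by blast
  have ds: "(\<lambda>x. sff x u v) differentiable (at x)" for u v
    using smooth_sff smooth_on_differentiable x by blast
  have prod: "(\<lambda>x. f x *\<^sub>R g x) differentiable (at x)" if "f differentiable (at x)" "g differentiable (at x)"
    for f :: "real^'n \<Rightarrow> real" and g :: "real^'n \<Rightarrow> 'e"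
    using that by (rule differentiable_scaleR)
  let ?D = "\<lambda>F. dir_deriv (axis i 1) F x"
  have "?D (\<lambda>x. \<Sum>l\<in>UNIV. christoffel G l j k x *\<^sub>R Xd l x)
      = ?D (\<lambda>x. Xdd j k x - sff x (axis j 1) (axis k 1) *\<^sub>R N x)"
    by (rule dir_deriv_cong[OF open_U x]) (rule gauss_formula)
  then have "(\<Sum>l\<in>UNIV. christoffel G l j k x *\<^sub>R Xdd i l x + ?D (christoffel G l j k) *\<^sub>R Xd l x)
      = ?D (Xdd j k) - (sff x (axis j 1) (axis k 1) *\<^sub>R ?D N + ?D (\<lambda>x. sff x (axis j 1) (axis k 1)) *\<^sub>R N x)"
    by (simp add: dir_deriv_sum dir_deriv_diff dir_deriv_scaleR prod dc dX dN ds)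
  from arg_cong[OF this, of "\<lambda>z. z \<bullet> Xd m x"] show ?thesis
    using x by (simp add: inner_sum_left inner_add_left inner_diff_left normal sum.distrib
        partial_eq_dir_deriv sff_def[of x "axis i 1" "axis m 1"])
qed

text \<open>
  The third derivatives of the immersion are symmetric, so antisymmetrizing the derivative of the
  Gauss formula leaves the curvature on one side and products of the second fundamental form on the other.
\<close>

lemma gauss_equation:
  assumes x: "x \<in> U"
  shows "(\<Sum>l\<in>UNIV. riemann_coeff G l k i j x * (Xd l x \<bullet> Xd m x))
    = sff x (axis j 1) (axis k 1) * sff x (axis i 1) (axis m 1)
      - sff x (axis i 1) (axis k 1) * sff x (axis j 1) (axis m 1)"
proof -
  have quad: "(\<Sum>l\<in>UNIV. (\<Sum>q\<in>UNIV. christoffel G l i q x * christoffel G q j k x) * (Xd l x \<bullet> Xd m x))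
      = (\<Sum>l\<in>UNIV. christoffel G l j k x * (Xdd i l x \<bullet> Xd m x))" for i j
  proof -
    have "(\<Sum>l\<in>UNIV. (\<Sum>q\<in>UNIV. christoffel G l i q x * christoffel G q j k x) * (Xd l x \<bullet> Xd m x))
       = (\<Sum>l\<in>UNIV. \<Sum>q\<in>UNIV. christoffel G q j k x * (christoffel G l i q x * (Xd l x \<bullet> Xd m x)))"
      by (simp add: sum_distrib_left sum_distrib_right mult_ac)
    also have "\<dots> = (\<Sum>q\<in>UNIV. \<Sum>l\<in>UNIV. christoffel G q j k x * (christoffel G l i q x * (Xd l x \<bullet> Xd m x)))"
      by (rule sum.swap)
    finally show ?thesis by (simp add: christoffel_contract[OF x] flip: sum_distrib_left)
  qed
  have third: "dir_deriv (axis i 1) (Xdd j k) x = dir_deriv (axis j 1) (Xdd i k) x"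
    by (rule dir_deriv_commute[OF open_U x smooth_Xd])
  have "(\<Sum>l\<in>UNIV. riemann_coeff G l k i j x * (Xd l x \<bullet> Xd m x)) =
      ((\<Sum>l\<in>UNIV. partial i (christoffel G l j k) x * (Xd l x \<bullet> Xd m x))
        + (\<Sum>l\<in>UNIV. (\<Sum>q\<in>UNIV. christoffel G l i q x * christoffel G q j k x) * (Xd l x \<bullet> Xd m x)))
      - ((\<Sum>l\<in>UNIV. partial j (christoffel G l i k) x * (Xd l x \<bullet> Xd m x))
        + (\<Sum>l\<in>UNIV. (\<Sum>q\<in>UNIV. christoffel G l j q x * christoffel G q i k x) * (Xd l x \<bullet> Xd m x)))"
    by (simp add: riemann_coeff_def sum_subtractf sum.distrib distrib_right left_diff_distrib)
  also have "\<dots> = sff x (axis j 1) (axis k 1) * sff x (axis i 1) (axis m 1)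
      - sff x (axis i 1) (axis k 1) * sff x (axis j 1) (axis m 1)"
    unfolding quad gauss_formula_derivative[OF x] third by simp
  finally show ?thesis .
qed

lemma riemann_tensor_sff:
  assumes x: "x \<in> U"
  shows "riemann_tensor G x u v v \<bullet> (G x *v u) = sff x u u * sff x v v - (sff x u v)\<^sup>2"
proof -
  let ?h = "\<lambda>i j. sff x (axis i 1) (axis j 1)"
  have prod: "(\<Sum>i\<in>UNIV. \<Sum>j\<in>UNIV. \<Sum>k\<in>UNIV. \<Sum>m\<in>UNIV. a i m * b j k)
      = (\<Sum>i\<in>UNIV. \<Sum>m\<in>UNIV. a i m) * (\<Sum>j\<in>UNIV. \<Sum>k\<in>UNIV. b j k)"
    "(\<Sum>i\<in>UNIV. \<Sum>j\<in>UNIV. \<Sum>k\<in>UNIV. \<Sum>m\<in>UNIV. a i k * b j m)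
      = (\<Sum>i\<in>UNIV. \<Sum>m\<in>UNIV. a i m) * (\<Sum>j\<in>UNIV. \<Sum>k\<in>UNIV. b j k)" for a b :: "'n \<Rightarrow> 'n \<Rightarrow> real"
    by (simp_all flip: sum_distrib_left sum_distrib_right)
  have "riemann_tensor G x u v v \<bullet> (G x *v u)
      = (\<Sum>l\<in>UNIV. \<Sum>i\<in>UNIV. \<Sum>j\<in>UNIV. \<Sum>k\<in>UNIV. \<Sum>m\<in>UNIV.
          u $ i * v $ j * v $ k * u $ m * (riemann_coeff G l k i j x * (Xd l x \<bullet> Xd m x)))"
    by (simp add: inner_vec_def riemann_tensor_def matrix_vector_mult_def G_nth[OF x]
        sum_distrib_left sum_distrib_right mult_ac)
  also have "\<dots> = (\<Sum>i\<in>UNIV. \<Sum>j\<in>UNIV. \<Sum>k\<in>UNIV. \<Sum>m\<in>UNIV.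
          u $ i * v $ j * v $ k * u $ m * (\<Sum>l\<in>UNIV. riemann_coeff G l k i j x * (Xd l x \<bullet> Xd m x)))"
    unfolding sum_distrib_left
    apply (rule trans[OF sum.swap], rule sum.cong[OF refl])
    apply (rule trans[OF sum.swap], rule sum.cong[OF refl])
    apply (rule trans[OF sum.swap], rule sum.cong[OF refl])
    apply (rule sum.swap)
    done
  also have "\<dots> = (\<Sum>i\<in>UNIV. \<Sum>j\<in>UNIV. \<Sum>k\<in>UNIV. \<Sum>m\<in>UNIV. (u $ i * u $ m * ?h i m) * (v $ j * v $ k * ?h j k))
      - (\<Sum>i\<in>UNIV. \<Sum>j\<in>UNIV. \<Sum>k\<in>UNIV. \<Sum>m\<in>UNIV. (u $ i * v $ k * ?h i k) * (v $ j * u $ m * ?h j m))"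
    unfolding gauss_equation[OF x] by (simp add: sum_subtractf[symmetric] algebra_simps)
  also have "\<dots> = sff x u u * sff x v v - sff x u v * sff x v u"
    unfolding prod sff_expand[OF x, of u u] sff_expand[OF x, of v v] sff_expand[OF x, of u v] sff_expand[OF x, of v u] ..
  finally show ?thesis using sff_sym[OF x, of v u] by (simp add: power2_eq_square)
qed

lemma sectional_curvature_sff:
  assumes "x \<in> U" "orthonormal_frame (G x) e" "i \<noteq> j"
  shows "sectional_curvature G x (e i) (e j) = sff x (e i) (e i) * sff x (e j) (e j) - (sff x (e i) (e j))\<^sup>2"
  using assms by (simp add: sectional_curvature_def riemann_tensor_sff orthonormal_frame_def)

lemma matrix_shape: "x \<in> U \<Longrightarrow> matrix (shape x) *v v = shape x v"
  using linear_shape by (simp add: matrix_works)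

lemma orthonormal_frame_iff: "x \<in> U \<Longrightarrow> orthonormal_frame (G x) e \<longleftrightarrow> orthonormal (\<lambda>i. dir_deriv (e i) X x)"
  by (simp add: orthonormal_frame_def orthonormal_def first_ff)

lemma trace_shape:
  assumes "x \<in> U" "orthonormal_frame (G x) w" "\<And>i. shape x (w i) = \<kappa> i *\<^sub>R w i"
  shows "trace (matrix (shape x)) = (\<Sum>i\<in>UNIV. \<kappa> i)"
    "trace (matrix (shape x) ** matrix (shape x)) = (\<Sum>i\<in>UNIV. (\<kappa> i)\<^sup>2)"
proof -
  let ?D = "(\<chi> i j. if i = j then \<kappa> i else 0) :: real^'n^'n"
  have "matrix (shape x) *v w j = (\<Sum>i\<in>UNIV. ?D $ i $ j *\<^sub>R w i)" for j
    by (simp add: matrix_shape assms(1,3) if_distrib[of "\<lambda>z. z *\<^sub>R _"] cong: if_cong)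
  from trace_in_orthonormal_frame[OF assms(2) this]
  show "trace (matrix (shape x)) = (\<Sum>i\<in>UNIV. \<kappa> i)"
    "trace (matrix (shape x) ** matrix (shape x)) = (\<Sum>i\<in>UNIV. (\<kappa> i)\<^sup>2)"
    by (simp_all add: trace_def matrix_matrix_mult_def power2_eq_square if_distrib[of "\<lambda>z. z * _"] cong: if_cong)
qed

lemma trace_sff:
  assumes x: "x \<in> U" and e: "orthonormal_frame (G x) e"
  shows "trace (matrix (shape x)) = (\<Sum>i\<in>UNIV. sff x (e i) (e i))"
    "trace (matrix (shape x) ** matrix (shape x)) = (\<Sum>i\<in>UNIV. \<Sum>j\<in>UNIV. (sff x (e i) (e j))\<^sup>2)"
proof -
  let ?D = "(\<chi> i j. sff x (e i) (e j)) :: real^'n^'n"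
  have on: "orthonormal (\<lambda>i. dir_deriv (e i) X x)" using e orthonormal_frame_iff[OF x] by blast
  have "shape x (e j) = (\<Sum>i\<in>UNIV. sff x (e i) (e j) *\<^sub>R e i)" for j
  proof -
    obtain E where E: "E = (\<chi> i j. e j $ i)" by blast
    have "(transpose E ** (G x ** E)) $ a $ b = e a \<bullet> (G x *v e b)" for a b
      by (simp add: E matrix_matrix_mult_def transpose_def inner_vec_def matrix_vector_mult_def)
    then have "(transpose E ** G x) ** E = mat 1"
      using e by (simp add: vec_eq_iff orthonormal_frame_def mat_def matrix_mul_assoc)
    then have EE: "E ** (transpose E ** G x) = mat 1" by (simp add: matrix_left_right_inverse)
    have "shape x (e j) = E *v ((transpose E ** G x) *v shape x (e j))"
      by (simp add: matrix_vector_mul_assoc EE)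
    also have "(transpose E ** G x) *v shape x (e j) = (\<chi> i. sff x (e i) (e j))"
    proof -
      have "(transpose E *v z) $ i = e i \<bullet> z" for z i
        by (simp add: E transpose_def matrix_vector_mult_def inner_vec_def)
      then have "((transpose E ** G x) *v shape x (e j)) $ i = e i \<bullet> (G x *v shape x (e j))" for i
        by (simp flip: matrix_vector_mul_assoc)
      also have "\<dots> i = sff x (e i) (e j)" for i
        using sff_shape[OF x, of "e j" "e i"] sff_sym[OF x, of "e i" "e j"]
        by (simp add: first_ff[OF x, symmetric] inner_commute)
      finally show ?thesis by (simp add: vec_eq_iff)
    qed
    also have "E *v (\<chi> i. sff x (e i) (e j)) = (\<Sum>i\<in>UNIV. sff x (e i) (e j) *\<^sub>R e i)"
      by (simp add: E vec_eq_iff matrix_vector_mult_def mult.commute)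
    finally show ?thesis .
  qed
  then have "matrix (shape x) *v e j = (\<Sum>i\<in>UNIV. ?D $ i $ j *\<^sub>R e i)" for j
    by (simp add: matrix_shape[OF x])
  from trace_in_orthonormal_frame[OF e this]
  show "trace (matrix (shape x)) = (\<Sum>i\<in>UNIV. sff x (e i) (e i))"
    "trace (matrix (shape x) ** matrix (shape x)) = (\<Sum>i\<in>UNIV. \<Sum>j\<in>UNIV. (sff x (e i) (e j))\<^sup>2)"
    using sff_sym[OF x] by (simp_all add: trace_def matrix_matrix_mult_def power2_eq_square) 
qed

end

lemma sum_pairs_less:
  fixes f :: "'n::{finite,linorder} \<Rightarrow> 'n \<Rightarrow> real"
  assumes "\<And>i j. f i j = f j i"
  shows "(\<Sum>i\<in>UNIV. \<Sum>j\<in>UNIV. f i j) = (\<Sum>i\<in>UNIV. f i i) + 2 * (\<Sum>(i,j)\<in>{(i,j). i < j}. f i j)"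
proof -
  have U: "(UNIV :: ('n \<times> 'n) set) = (range (\<lambda>i. (i,i)) \<union> {(i,j). i < j}) \<union> (\<lambda>(i,j). (j,i)) ` {(i,j). i < j}"
    by (auto simp: image_iff)
  have "(\<Sum>i\<in>UNIV. \<Sum>j\<in>UNIV. f i j) = (\<Sum>(i,j)\<in>UNIV. f i j)"
    by (simp add: sum.cartesian_product)
  also have "\<dots> = (\<Sum>(i,j)\<in>range (\<lambda>i. (i,i)). f i j) + (\<Sum>(i,j)\<in>{(i,j). i < j}. f i j)
      + (\<Sum>(i,j)\<in>(\<lambda>(i,j). (j,i)) ` {(i,j). i < j}. f i j)"
    unfolding U by (subst sum.union_disjoint; (force simp: image_iff)?)+ 
  also have "(\<Sum>(i,j)\<in>range (\<lambda>i. (i,i)). f i j) = (\<Sum>i\<in>UNIV. f i i)"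
    by (subst sum.reindex) (auto simp: inj_on_def)
  also have "(\<Sum>(i,j)\<in>(\<lambda>(i,j). (j,i)) ` {(i,j). i < j}. f i j) = (\<Sum>(i,j)\<in>{(i,j). i < j}. f i j)"
    by (subst sum.reindex) (auto simp: inj_on_def assms intro!: sum.cong)
  finally show ?thesis by simp
qed

text \<open>
  By the Gauss equation the sum is \<open>((tr A)\<^sup>2 - tr A\<^sup>2) / 2\<close> for the shape operator \<open>A\<close>, whichever orthonormal
  frame is used.
\<close>

lemma sum_sectional_curvatures:
  fixes U :: "(real, 'n::{finite,linorder}) vec set" and X N :: "(real, 'n) vec \<Rightarrow> 'e::euclidean_space"
  assumes "hypersurface_metric U X N G" and x: "x \<in> U" and e: "orthonormal_frame (G x) e"
    and w: "orthonormal_frame (G x) w" "\<And>i. hypersurface_patch.shape X N x (w i) = \<kappa> i *\<^sub>R w i"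
  shows "(\<Sum>(i,j)\<in>{(i,j). i < j}. sectional_curvature G x (e i) (e j)) = esym 2 \<kappa> UNIV"
proof -
  interpret hypersurface_metric U X N G by (rule assms(1))
  let ?h = "\<lambda>i j. sff x (e i) (e j)"
  let ?f = "\<lambda>i j. ?h i i * ?h j j - (?h i j)\<^sup>2"
  have "(\<Sum>(i,j)\<in>{(i,j). i < j}. sectional_curvature G x (e i) (e j)) = (\<Sum>(i,j)\<in>{(i,j). i < j}. ?f i j)"
    by (intro sum.cong) (auto intro!: sectional_curvature_sff[OF x e])
  moreover have "(\<Sum>i\<in>UNIV. \<Sum>j\<in>UNIV. ?f i j) = (\<Sum>i\<in>UNIV. ?f i i) + 2 * (\<Sum>(i,j)\<in>{(i,j). i < j}. ?f i j)"
    by (rule sum_pairs_less) (simp add: sff_sym[OF x] mult.commute)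
  moreover have "(\<Sum>i\<in>UNIV. ?f i i) = 0" by (simp add: power2_eq_square)
  moreover have "(\<Sum>i\<in>UNIV. \<Sum>j\<in>UNIV. ?f i j) = (\<Sum>i\<in>UNIV. ?h i i)\<^sup>2 - (\<Sum>i\<in>UNIV. \<Sum>j\<in>UNIV. (?h i j)\<^sup>2)"
    by (simp add: sum_subtractf sum_product power2_eq_square)
  moreover have "(\<Sum>i\<in>UNIV. ?h i i) = esym 1 \<kappa> UNIV"
    using trace_sff(1)[OF x e] trace_shape(1)[OF x w] newton_power_sums(1)[of UNIV \<kappa>] by simp
  moreover have "(\<Sum>i\<in>UNIV. \<Sum>j\<in>UNIV. (?h i j)\<^sup>2) = (esym 1 \<kappa> UNIV)\<^sup>2 - 2 * esym 2 \<kappa> UNIV"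
    using trace_sff(2)[OF x e] trace_shape(2)[OF x w] newton_power_sums(2)[of UNIV \<kappa>] by simp
  ultimately show ?thesis by simp
qed

section \<open>Graph coordinates\<close>

text \<open>
  The derivative of the inverse is the inverse of the Jacobian matrix of \<open>\<phi>\<close>, evaluated at the inverse.
  If the inverse is \<open>k\<close> times continuously differentiable, so are therefore its first derivatives.
\<close>

lemma smooth_local_inverse:
  fixes \<phi> :: "real^'n::finite \<Rightarrow> real^'n"
  assumes U: "open U" and \<phi>: "smooth_on U \<phi>" and x0: "x0 \<in> U" and inj: "inj (\<lambda>v. dir_deriv v \<phi> x0)"
  obtains U' V \<psi> where "open U'" "U' \<subseteq> U" "x0 \<in> U'" "open V" "homeomorphism U' V \<phi> \<psi>" "smooth_on V \<psi>"
proof -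
  define f' where "f' x = Blinfun (\<lambda>v. dir_deriv v \<phi> x)" for x
  have lin: "bounded_linear (\<lambda>v. dir_deriv v \<phi> x)" if "x \<in> U" for x
    using smooth_on_has_derivative[OF \<phi> that] has_derivative_bounded_linear by blast
  have f': "blinfun_apply (f' x) = (\<lambda>v. dir_deriv v \<phi> x)" if "x \<in> U" for x
    unfolding f'_def by (rule bounded_linear_Blinfun_apply[OF lin[OF that]])
  have der: "(\<phi> has_derivative blinfun_apply (f' x)) (at x)" if "x \<in> U" for x
    unfolding f'[OF that] by (rule smooth_on_has_derivative[OF \<phi> that])
  have cont: "continuous_on U f'"
  proof (rule continuous_on_blinfun_componentwise)
    fix i :: "real^'n" assume "i \<in> Basis"
    have "continuous_on U (dir_deriv i \<phi>)"
      using smooth_on_imp_continuous_on smooth_on_dir_deriv[OF \<phi>] by blast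
    then show "continuous_on U (\<lambda>x. blinfun_apply (f' x) i)"
      by (rule continuous_on_eq) (simp add: f')
  qed
  obtain L where L: "linear L" "L \<circ> (\<lambda>v. dir_deriv v \<phi> x0) = id"
    using linear_injective_left_inverse[OF _ inj] lin[OF x0] by (auto simp: linear_conv_bounded_linear)
  have "Blinfun L o\<^sub>L f' x0 = id_blinfun"
    using L f'[OF x0] by (intro blinfun_eqI) (simp add: bounded_linear_Blinfun_apply linear_conv_bounded_linear fun_eq_iff)
  from inverse_function_theorem[OF U der cont x0 this]
  obtain U' V \<psi> \<psi>' where *: "open U'" "U' \<subseteq> U" "x0 \<in> U'" "open V" "homeomorphism U' V \<phi> \<psi>"
    and d\<psi>: "\<And>y. y \<in> V \<Longrightarrow> (\<psi> has_derivative (\<psi>' y)) (at y)"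
    and \<psi>': "\<And>y. y \<in> V \<Longrightarrow> \<psi>' y = inv (blinfun_apply (f' (\<psi> y)))"
    and bij: "\<And>y. y \<in> V \<Longrightarrow> bij (blinfun_apply (f' (\<psi> y)))"
    by metis
  have \<psi>U: "\<psi> y \<in> U" if "y \<in> V" for y using *(2,5) that by (auto simp: homeomorphism_def)
  define J where "J x = matrix (\<lambda>v. dir_deriv v \<phi> x)" for x
  have J: "J x *v v = dir_deriv v \<phi> x" if "x \<in> U" for x v
    unfolding J_def using lin[OF that] by (simp add: matrix_works linear_conv_bounded_linear)
  have inv: "invertible (J (\<psi> y))" if "y \<in> V" for y
  proof -
    have "v = 0" if "J (\<psi> y) *v v = 0" for v
    proof -
      have "blinfun_apply (f' (\<psi> y)) v = blinfun_apply (f' (\<psi> y)) 0"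
        using that linear_0[OF bounded_linear.linear[OF lin[OF \<psi>U[OF \<open>y \<in> V\<close>]]]]
        by (simp add: f' J \<psi>U[OF \<open>y \<in> V\<close>])
      then show ?thesis using bij[OF \<open>y \<in> V\<close>] by (meson bij_is_inj injD)
    qed
    then show ?thesis using matrix_left_invertible_ker[of "J (\<psi> y)"] invertible_left_inverse by blast
  qed
  have d: "dir_deriv v \<psi> y = matrix_inv (J (\<psi> y)) *v v" if "y \<in> V" for v y
  proof -
    have "blinfun_apply (f' (\<psi> y)) (matrix_inv (J (\<psi> y)) *v v) = v"
      by (simp add: f'[OF \<psi>U[OF that]] J[OF \<psi>U[OF that], symmetric] matrix_vector_mul_assoc
          matrix_inv_inverse(1)[OF inv[OF that]])
    then have "\<psi>' y v = matrix_inv (J (\<psi> y)) *v v"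
      unfolding \<psi>'[OF that] using bij[OF that] by (metis bij_inv_eq_iff)
    then show ?thesis using dir_deriv_eqI[OF d\<psi>[OF that]] by simp
  qed
  have "Ck_on k V \<psi>" for k
  proof (induction k)
    case 0
    then show ?case using *(5) by (simp add: homeomorphism_def)
  next
    case (Suc k)
    have "Ck_on k V (\<lambda>y. J (\<psi> y) $ i $ j)" for i j
    proof -
      have "Ck_on k U (\<lambda>x. dir_deriv (axis j 1) \<phi> x $ i)"
        using smooth_on_bounded_linear[OF U bounded_linear_vec_nth[of i] smooth_on_dir_deriv[OF \<phi>, of "axis j 1"]]
        unfolding smooth_on_def by blast
      from Ck_on_compose[OF *(4) U _ Suc this]
      show ?thesis using \<psi>U by (simp add: J_def matrix_def image_subset_iff)
    qed
    then have entry: "Ck_on k V (\<lambda>y. matrix_inv (J (\<psi> y)) $ i $ j)" for i j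
      by (rule Ck_on_matrix_inv[OF *(4)]) (rule inv)
    have "Ck_on k V (dir_deriv v \<psi>)" for v
    proof (rule Ck_on_cong[OF *(4)])
      show "(\<Sum>i\<in>UNIV. (\<Sum>j\<in>UNIV. matrix_inv (J (\<psi> y)) $ i $ j * v $ j) *\<^sub>R axis i 1) = dir_deriv v \<psi> y" if "y \<in> V" for y
        unfolding d[OF that] using basis_expansion[of "matrix_inv (J (\<psi> y)) *v v"]
        by (simp add: scalar_mult_eq_scaleR matrix_vector_mult_def)
      show "Ck_on k V (\<lambda>y. \<Sum>i\<in>UNIV. (\<Sum>j\<in>UNIV. matrix_inv (J (\<psi> y)) $ i $ j * v $ j) *\<^sub>R axis i 1)"
        by (intro Ck_on_sum[OF *(4)] Ck_on_bilinear[OF *(4) bounded_bilinear_scaleR]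
            Ck_on_bilinear[OF *(4) bounded_bilinear_mult] Ck_on_const entry)
    qed
    then show ?case using d\<psi> by (auto simp: Ck_on_Suc_iff differentiable_def)
  qed
  then show ?thesis using that * by (simp add: smooth_on_def)
qed

text \<open>
  A patch parametrized by the orthogonal projection to its tangent hyperplane at \<open>y0\<close>, in which the
  coordinate axes are principal directions.
\<close>

locale graph_patch = hypersurface_patch U X N
  for U :: "(real^'n::finite) set" and X N :: "real^'n \<Rightarrow> 'e::euclidean_space" +
  fixes y0 :: "real^'n" and \<kappa> :: "'n \<Rightarrow> real" and b :: "'n \<Rightarrow> 'e"
  assumes y0: "y0 \<in> U" and orthonormal_b: "orthonormal b" and Xd_y0: "Xd i y0 = b i"
    and graph: "y \<in> U \<Longrightarrow> b i \<bullet> X y = y $ i"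
    and principal: "dir_deriv (axis i 1) N y0 = - (\<kappa> i *\<^sub>R b i)"

text \<open>
  Projecting to the principal directions at \<open>x0\<close> is a local diffeomorphism of the parameter domain, because
  its derivative sends \<open>w i\<close> to the \<open>i\<close>-th axis.
\<close>

lemma (in hypersurface_patch) graph_coordinates:
  assumes x0: "x0 \<in> U" and w: "orthonormal (\<lambda>i::'n. dir_deriv (w i) X x0)" "\<And>i. shape x0 (w i) = \<kappa> i *\<^sub>R w i"
  defines "\<phi> \<equiv> \<lambda>x. \<chi> i. dir_deriv (w i) X x0 \<bullet> X x"
  obtains U' V \<psi> where "open U'" "U' \<subseteq> U" "x0 \<in> U'" "homeomorphism U' V \<phi> \<psi>" "smooth_on V \<psi>" "smooth_on U \<phi>"
    "graph_patch V (\<lambda>y. X (\<psi> y)) (\<lambda>y. N (\<psi> y)) (\<phi> x0) \<kappa> (\<lambda>i. dir_deriv (w i) X x0)"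
    "\<And>y v. y \<in> V \<Longrightarrow> dir_deriv (dir_deriv v \<psi> y) \<phi> (\<psi> y) = v"
proof -
  let ?b = "\<lambda>i. dir_deriv (w i) X x0"
  have \<phi>: "smooth_on U \<phi>"
  proof (rule smooth_on_cong[OF open_U])
    show "(\<Sum>i\<in>UNIV. (?b i \<bullet> X x) *\<^sub>R axis i 1) = \<phi> x" for x
      using basis_expansion[of "\<phi> x"] by (simp add: \<phi>_def scalar_mult_eq_scaleR)
    show "smooth_on U (\<lambda>x. \<Sum>i\<in>UNIV. (?b i \<bullet> X x) *\<^sub>R axis i 1)"
      by (intro smooth_on_sum[OF open_U] smooth_on_scaleR[OF open_U] smooth_on_inner[OF open_U] smooth_on_const smooth_X)
  qed
  have d\<phi>: "dir_deriv v \<phi> x = (\<chi> i. ?b i \<bullet> dir_deriv v X x)" if "x \<in> U" for v x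
  proof -
    have "dir_deriv v \<phi> x $ i = ?b i \<bullet> dir_deriv v X x" for i
      using dir_deriv_bounded_linear[OF bounded_linear_vec_nth[of i] smooth_on_differentiable[OF \<phi> that], of v]
        dir_deriv_bounded_linear[OF bounded_linear_inner_right[of "?b i"] smooth_on_differentiable[OF smooth_X that], of v]
      by (simp add: \<phi>_def)
    then show ?thesis by (simp add: vec_eq_iff)
  qed
  have dw: "dir_deriv (w i) \<phi> x0 = axis i 1" for i
    using w(1) by (simp add: d\<phi>[OF x0] orthonormal_def vec_eq_iff axis_def) 
  have lin: "linear (\<lambda>v. dir_deriv v \<phi> x0)"
    using has_derivative_linear smooth_on_has_derivative[OF \<phi> x0] by blast
  have "surj (\<lambda>v. dir_deriv v \<phi> x0)"
  proof (rule surjI)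
    fix v :: "real^'n"
    show "dir_deriv (\<Sum>i\<in>UNIV. (v $ i) *\<^sub>R w i) \<phi> x0 = v"
      using basis_expansion[of v]
      by (simp add: linear_sum[OF lin] linear_cmul[OF lin] dw scalar_mult_eq_scaleR)
  qed
  then have inj: "inj (\<lambda>v. dir_deriv v \<phi> x0)" using linear_surjective_imp_injective[OF lin] by blast
  from smooth_local_inverse[OF open_U \<phi> x0 inj]
  obtain U' V \<psi> where *: "open U'" "U' \<subseteq> U" "x0 \<in> U'" "open V" "homeomorphism U' V \<phi> \<psi>" "smooth_on V \<psi>"
    by metis
  have \<psi>: "\<psi> y \<in> U'" "\<psi> y \<in> U" "\<phi> (\<psi> y) = y" if "y \<in> V" for y
    using *(2,5) that by (auto simp: homeomorphism_def)
  have \<psi>\<phi>: "\<psi> (\<phi> x) = x" "\<phi> x \<in> V" if "x \<in> U'" for x using *(5) that by (auto simp: homeomorphism_def)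
  have d\<psi>: "\<psi> differentiable (at y)" if "y \<in> V" for y using *(6) smooth_on_differentiable that by blast
  have right: "dir_deriv (dir_deriv v \<psi> y) \<phi> (\<psi> y) = v" if "y \<in> V" for v y
  proof -
    have "dir_deriv v (\<lambda>y. \<phi> (\<psi> y)) y = dir_deriv v (\<lambda>y. y) y"
      by (rule dir_deriv_cong[OF *(4) that]) (rule \<psi>(3))
    also have "\<dots> = v" by (rule dir_deriv_eqI) (rule has_derivative_ident)
    finally show ?thesis
      using dir_deriv_compose[OF d\<psi>[OF that] smooth_on_differentiable[OF \<phi> \<psi>(2)[OF that]]] by simp
  qed
  have chain: "dir_deriv v (\<lambda>y. F (\<psi> y)) y = dir_deriv (dir_deriv v \<psi> y) F (\<psi> y)" if "y \<in> V" "smooth_on U F"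
    for F :: "real^'n \<Rightarrow> 'e" and v y
    by (rule dir_deriv_compose[OF d\<psi>[OF that(1)] smooth_on_differentiable[OF that(2) \<psi>(2)[OF that(1)]]])
  have d\<psi>0: "dir_deriv (axis i 1) \<psi> (\<phi> x0) = w i" for i
    using right[OF \<psi>\<phi>(2)[OF *(3)], of "axis i 1"] dw[of i] injD[OF inj] by (simp add: \<psi>\<phi>(1)[OF *(3)])
  have "graph_patch V (\<lambda>y. X (\<psi> y)) (\<lambda>y. N (\<psi> y)) (\<phi> x0) \<kappa> ?b"
  proof
    show "open V" by fact
    show "smooth_on V (\<lambda>y. X (\<psi> y))" "smooth_on V (\<lambda>y. N (\<psi> y))"
      using \<psi>(2) by (auto intro!: smooth_on_compose[OF *(4) open_U _ *(6)] smooth_X smooth_N)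
    show "v = 0" if "y \<in> V" "dir_deriv v (\<lambda>y. X (\<psi> y)) y = 0" for v y
    proof -
      have "dir_deriv v \<psi> y = 0"
        using immersion[OF \<psi>(2)[OF that(1)]] that(2) chain[OF that(1) smooth_X] by simp
      then have "v = dir_deriv 0 \<phi> (\<psi> y)" using right[OF that(1), of v] by simp
      also have "\<dots> = 0"
        using linear_0[OF has_derivative_linear[OF smooth_on_has_derivative[OF \<phi> \<psi>(2)[OF that(1)]]]] .
      finally show ?thesis .
    qed
    show "N (\<psi> y) \<bullet> dir_deriv v (\<lambda>y. X (\<psi> y)) y = 0" if "y \<in> V" for v y
      using that by (simp add: chain smooth_X normal \<psi>)
    show "norm (N (\<psi> y)) = 1" if "y \<in> V" for y using that by (simp add: unit \<psi>)
    show "DIM('e) = Suc CARD('n)" by (rule codim)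
    show "\<phi> x0 \<in> V" by (rule \<psi>\<phi>(2)[OF *(3)])
    show "orthonormal ?b" by (rule w(1))
    show "dir_deriv (axis i 1) (\<lambda>y. X (\<psi> y)) (\<phi> x0) = ?b i" for i
      by (simp add: chain[OF \<psi>\<phi>(2)[OF *(3)] smooth_X] d\<psi>0 \<psi>\<phi>(1)[OF *(3)])
    show "?b i \<bullet> X (\<psi> y) = y $ i" if "y \<in> V" for y i
      using \<psi>(3)[OF that] by (auto simp: \<phi>_def vec_eq_iff)
    show "dir_deriv (axis i 1) (\<lambda>y. N (\<psi> y)) (\<phi> x0) = - (\<kappa> i *\<^sub>R ?b i)" for i
      using weingarten[OF x0, of "w i"] w(2)[of i]
      by (simp add: chain[OF \<psi>\<phi>(2)[OF *(3)] smooth_N] d\<psi>0 \<psi>\<phi>(1)[OF *(3)] linear_cmul[OF linear_dX[OF x0]])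
  qed
  then show ?thesis using that *(1,2,3,5,6) \<phi> right by blast
qed

section \<open>Simons' formula\<close>

context
  fixes U :: "'a::euclidean_space set"
  assumes U: "open U"
begin

lemma smooth_dir_deriv_mult:
  fixes F G :: "'a \<Rightarrow> real"
  assumes "smooth_on U F" "smooth_on U G" "x \<in> U"
  shows "dir_deriv v (\<lambda>x. F x * G x) x = F x * dir_deriv v G x + dir_deriv v F x * G x"
  using assms by (intro dir_deriv_mult smooth_on_differentiable)

lemma smooth_dir_deriv_sum:
  assumes "\<And>i. i \<in> I \<Longrightarrow> smooth_on U (F i)" "x \<in> U"
  shows "dir_deriv v (\<lambda>x. \<Sum>i\<in>I. F i x) x = (\<Sum>i\<in>I. dir_deriv v (F i) x)"
  using assms by (intro dir_deriv_sum smooth_on_differentiable)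

lemma smooth_dir_deriv2_mult:
  fixes F G :: "'a \<Rightarrow> real"
  assumes F: "smooth_on U F" and G: "smooth_on U G" and x: "x \<in> U"
  shows "dir_deriv u (dir_deriv v (\<lambda>x. F x * G x)) x =
    F x * dir_deriv u (dir_deriv v G) x + dir_deriv u F x * dir_deriv v G x
    + dir_deriv v F x * dir_deriv u G x + dir_deriv u (dir_deriv v F) x * G x"
proof -
  have "dir_deriv u (dir_deriv v (\<lambda>x. F x * G x)) x = dir_deriv u (\<lambda>x. F x * dir_deriv v G x + dir_deriv v F x * G x) x"
    by (rule dir_deriv_cong[OF U x]) (rule smooth_dir_deriv_mult[OF F G])
  also have "\<dots> = dir_deriv u (\<lambda>x. F x * dir_deriv v G x) x + dir_deriv u (\<lambda>x. dir_deriv v F x * G x) x"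
    using F G x by (intro dir_deriv_add) (auto intro!: smooth_on_differentiable smooth_on_mult[OF U] smooth_on_dir_deriv)
  finally show ?thesis using F G x by (simp add: smooth_on_dir_deriv smooth_dir_deriv_mult)
qed

lemma smooth_dir_deriv2_sum:
  assumes F: "\<And>i. i \<in> I \<Longrightarrow> smooth_on U (F i)" and x: "x \<in> U"
  shows "dir_deriv u (dir_deriv v (\<lambda>x. \<Sum>i\<in>I. F i x)) x = (\<Sum>i\<in>I. dir_deriv u (dir_deriv v (F i)) x)"
proof -
  have "dir_deriv u (dir_deriv v (\<lambda>x. \<Sum>i\<in>I. F i x)) x = dir_deriv u (\<lambda>x. \<Sum>i\<in>I. dir_deriv v (F i) x) x"
    by (rule dir_deriv_cong[OF U x]) (rule smooth_dir_deriv_sum[OF F])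
  then show ?thesis using F x by (simp add: smooth_dir_deriv_sum smooth_on_dir_deriv)
qed

lemma dir_deriv2_eq_const:
  assumes "\<And>y. y \<in> U \<Longrightarrow> F y = c" "x \<in> U"
  shows "dir_deriv v F x = 0" "dir_deriv u (dir_deriv v F) x = 0"
proof -
  have F: "dir_deriv v F y = 0" if "y \<in> U" for v y
  proof -
    have "dir_deriv v F y = dir_deriv v (\<lambda>_. c) y" by (rule dir_deriv_cong[OF U that]) (rule assms(1))
    then show ?thesis by simp
  qed
  show "dir_deriv v F x = 0" by (rule F[OF assms(2)])
  have "dir_deriv u (dir_deriv v F) x = dir_deriv u (\<lambda>_. 0) x" by (rule dir_deriv_cong[OF U assms(2)]) (rule F)
  then show "dir_deriv u (dir_deriv v F) x = 0" by simp
qed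

end

text \<open>
  In graph coordinates the shape operator is the Jacobian matrix of \<open>V = \<nabla>h / sqrt (1 + \<bar>\<nabla>h\<bar>\<^sup>2)\<close>.
  Since \<open>V\<close> is a multiple \<open>\<omega>\<close> of a gradient, it is curl free to first order at the base point, and the
  second order term of its curl there is a polynomial in the principal curvatures.  Exchanging two derivatives
  in the Laplacian of \<open>tr A\<^sup>2\<close> therefore costs exactly the curvature term of Simons' formula.
\<close>

lemma simons_formula_gradient:
  fixes h \<omega> :: "real^'n::finite \<Rightarrow> real" and V :: "'n \<Rightarrow> real^'n \<Rightarrow> real" and \<kappa> :: "'n \<Rightarrow> real"
  defines "P \<equiv> \<lambda>i F. dir_deriv (axis i (1::real)) F"
  assumes U: "open U" and y0: "y0 \<in> U"
    and smooth: "smooth_on U h" "smooth_on U \<omega>" "\<And>i. smooth_on U (V i)"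
    and V: "\<And>y i. y \<in> U \<Longrightarrow> V i y = \<omega> y * P i h y"
    and unit: "\<And>y. y \<in> U \<Longrightarrow> \<omega> y * \<omega> y + (\<Sum>i\<in>UNIV. V i y * V i y) = 1" and \<omega>0: "\<omega> y0 = 1"
    and A0: "\<And>i j. P j (V i) y0 = (if i = j then \<kappa> i else 0)"
    and tr1: "\<And>y. y \<in> U \<Longrightarrow> (\<Sum>i\<in>UNIV. P i (V i) y) = c1"
    and tr2: "\<And>y. y \<in> U \<Longrightarrow> (\<Sum>i\<in>UNIV. \<Sum>j\<in>UNIV. P j (V i) y * P i (V j) y) = c2"
  shows "V i y0 = 0" "P i h y0 = 0" "P k \<omega> y0 = 0" "P l (P k \<omega>) y0 = (if k = l then - (\<kappa> k)\<^sup>2 else 0)"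
    "P j (P i h) y0 = (if i = j then \<kappa> i else 0)"
    "(\<Sum>k\<in>UNIV. \<Sum>i\<in>UNIV. \<Sum>j\<in>UNIV. (P k (P j (V i)) y0)\<^sup>2)
      = (\<Sum>i\<in>UNIV. (\<kappa> i)^2)^2 - (\<Sum>i\<in>UNIV. \<kappa> i) * (\<Sum>i\<in>UNIV. (\<kappa> i)^3)"
proof -
  have sP: "smooth_on U F \<Longrightarrow> smooth_on U (P i F)" for i and F :: "real^'n \<Rightarrow> real"
    unfolding P_def by (rule smooth_on_dir_deriv)
  have mult: "P i (\<lambda>y. F y * G y) y = F y * P i G y + P i F y * G y" if "smooth_on U F" "smooth_on U G" "y \<in> U"
    for F G :: "real^'n \<Rightarrow> real" and i y
    unfolding P_def using that by (rule smooth_dir_deriv_mult[OF U])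
  have mult2: "P i (P j (\<lambda>y. F y * G y)) y = F y * P i (P j G) y + P i F y * P j G y + P j F y * P i G y + P i (P j F) y * G y"
    if "smooth_on U F" "smooth_on U G" "y \<in> U" for F G :: "real^'n \<Rightarrow> real" and i j y
    unfolding P_def using that by (rule smooth_dir_deriv2_mult[OF U])
  have sum2: "P i (P j (\<lambda>y. \<Sum>k\<in>UNIV. F k y)) y = (\<Sum>k\<in>UNIV. P i (P j (F k)) y)"
    if "\<And>k. smooth_on U (F k)" "y \<in> U" for F :: "'n \<Rightarrow> real^'n \<Rightarrow> real" and i j y
    unfolding P_def using that by (intro smooth_dir_deriv2_sum[OF U])
  have sum1: "P i (\<lambda>y. \<Sum>k\<in>UNIV. F k y) y = (\<Sum>k\<in>UNIV. P i (F k) y)"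
    if "\<And>k. smooth_on U (F k)" "y \<in> U" for F :: "'n \<Rightarrow> real^'n \<Rightarrow> real" and i y
    unfolding P_def using that by (intro smooth_dir_deriv_sum[OF U])
  have comm: "P i (P j F) y = P j (P i F) y" if "smooth_on U F" "y \<in> U" for F :: "real^'n \<Rightarrow> real" and i j y
    unfolding P_def using that by (intro dir_deriv_commute[OF U])
  have cong: "P i F y = P i G y" if "\<And>y. y \<in> U \<Longrightarrow> F y = G y" "y \<in> U" for F G :: "real^'n \<Rightarrow> real" and i y
    unfolding P_def by (rule dir_deriv_cong[OF U that(2)]) (rule that(1))
  have diff1: "P i (\<lambda>y. F y - G y) y = P i F y - P i G y" if "smooth_on U F" "smooth_on U G" "y \<in> U"
    for F G :: "real^'n \<Rightarrow> real" and i y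
    unfolding P_def using that by (intro dir_deriv_diff smooth_on_differentiable)
  have diff2: "P i (P j (\<lambda>y. F y - G y)) y = P i (P j F) y - P i (P j G) y" if "smooth_on U F" "smooth_on U G" "y \<in> U"
    for F G :: "real^'n \<Rightarrow> real" and i j y
    using cong[of "P j (\<lambda>y. F y - G y)" "\<lambda>y. P j F y - P j G y", OF diff1] that diff1 sP by presburger
  have add1: "P i (\<lambda>y. F y + G y) y = P i F y + P i G y" if "smooth_on U F" "smooth_on U G" "y \<in> U"
    for F G :: "real^'n \<Rightarrow> real" and i y
    unfolding P_def using that by (intro dir_deriv_add smooth_on_differentiable)
  have add2: "P i (P j (\<lambda>y. F y + G y)) y = P i (P j F) y + P i (P j G) y" if "smooth_on U F" "smooth_on U G" "y \<in> U"
    for F G :: "real^'n \<Rightarrow> real" and i j y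
    using cong[of "P j (\<lambda>y. F y + G y)" "\<lambda>y. P j F y + P j G y", OF add1] that add1 sP by presburger
  note smooths = smooth smooth_on_mult[OF U] smooth_on_sum[OF U] sP
  have delta: "(\<Sum>i\<in>UNIV. (if i = j then f i else 0) * g i) = f j * g j"
    "(\<Sum>i\<in>UNIV. (if j = i then f i else 0) * g i) = f j * g j" for f g :: "'n \<Rightarrow> real" and j
    by (simp_all add: if_distrib[of "\<lambda>z. z * _"] cong: if_cong)
  have V0: "V i y0 = 0" for i
  proof -
    have "(\<Sum>i\<in>UNIV. V i y0 * V i y0) = 0" using unit[OF y0] \<omega>0 by simp
    then show ?thesis by (subst (asm) sum_nonneg_eq_0_iff) auto
  qed
  have h0: "P i h y0 = 0" for i using V[OF y0, of i] V0[of i] \<omega>0 by simp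
  have sq: "smooth_on U (\<lambda>y. \<omega> y * \<omega> y)" "smooth_on U (\<lambda>y. \<Sum>i\<in>UNIV. V i y * V i y)" "\<And>i. smooth_on U (\<lambda>y. V i y * V i y)"
    by (intro smooths)+
  have \<omega>1: "P k \<omega> y0 = 0" for k
  proof -
    have "P k (\<lambda>y. \<omega> y * \<omega> y + (\<Sum>i\<in>UNIV. V i y * V i y)) y0 = 0"
      unfolding P_def by (rule dir_deriv2_eq_const[OF U unit y0])
    then show ?thesis by (simp add: add1[OF sq(1,2) y0] sum1[OF sq(3) y0] mult smooth y0 V0 \<omega>0)
  qed
  have \<omega>2: "P l (P k \<omega>) y0 = (if k = l then - (\<kappa> k)\<^sup>2 else 0)" for k l
  proof -
    have "P l (P k (\<lambda>y. \<omega> y * \<omega> y + (\<Sum>i\<in>UNIV. V i y * V i y))) y0 = 0"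
      unfolding P_def by (rule dir_deriv2_eq_const[OF U unit y0])
    then have "2 * P l (P k \<omega>) y0 + 2 * (\<Sum>i\<in>UNIV. P l (V i) y0 * P k (V i) y0) = 0"
      by (simp add: add2[OF sq(1,2) y0] sum2[OF sq(3) y0] mult2 smooth y0 V0 \<omega>0 \<omega>1 mult.commute flip: sum_distrib_left)
    moreover have "(\<Sum>i\<in>UNIV. P l (V i) y0 * P k (V i) y0) = \<kappa> l * (if l = k then \<kappa> l else 0)"
      unfolding A0 by (rule delta)
    ultimately show ?thesis by (auto simp: power2_eq_square)
  qed
  have h2: "P j (P i h) y0 = (if i = j then \<kappa> i else 0)" for i j
  proof -
    have "P j (V i) y0 = P j (\<lambda>y. \<omega> y * P i h y) y0" by (rule cong[OF V y0])
    then show ?thesis by (simp add: mult smooths y0 \<omega>0 \<omega>1 h0 A0)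
  qed
  show "V i y0 = 0" "P i h y0 = 0" "P k \<omega> y0 = 0" "P l (P k \<omega>) y0 = (if k = l then - (\<kappa> k)\<^sup>2 else 0)"
    "P j (P i h) y0 = (if i = j then \<kappa> i else 0)"
    by (rule V0 h0 \<omega>1 \<omega>2 h2)+
  have curl: "P k (V i) y - P i (V k) y = P k \<omega> y * P i h y - P i \<omega> y * P k h y" if "y \<in> U" for i k y
  proof -
    have "P k (V i) y = P k (\<lambda>y. \<omega> y * P i h y) y" by (rule cong[OF V that])
    moreover have "P i (V k) y = P i (\<lambda>y. \<omega> y * P k h y) y" by (rule cong[OF V that])
    ultimately show ?thesis using comm[OF smooth(1) that, of i k] by (simp add: mult smooths that)
  qed
  \<comment> \<open>at the base point the first derivatives of \<open>h\<close> and \<open>\<omega>\<close> vanish, so only second derivatives survive\<close>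
  have curl1: "P j (P k (V i)) y0 = P j (P i (V k)) y0" for i j k
  proof -
    have "P j (\<lambda>y. P k (V i) y - P i (V k) y) y0 = P j (\<lambda>y. P k \<omega> y * P i h y - P i \<omega> y * P k h y) y0"
      by (rule cong[OF curl y0])
    then show ?thesis by (simp add: diff1 mult smooths y0 \<omega>1 h0)
  qed
  have curl2: "P i (P k (P k (V i))) y0 = P i (P k (P i (V k))) y0 + ((\<kappa> i)\<^sup>2 * \<kappa> k - (\<kappa> k)\<^sup>2 * \<kappa> i)" for i k
  proof -
    have "P i (P k (\<lambda>y. P k (V i) y - P i (V k) y)) y0 = P i (P k (\<lambda>y. P k \<omega> y * P i h y - P i \<omega> y * P k h y)) y0"
      by (rule cong[OF cong[OF curl] y0])
    then show ?thesis by (simp add: diff2 mult2 smooths y0 \<omega>1 h0 \<omega>2 h2 split: if_splits)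
  qed
  \<comment> \<open>commuting \<open>P k P k P i V\<^sub>i\<close> into \<open>P i P i P k V\<^sub>k\<close> crosses the curl once; the sum over \<open>k\<close> of the latter is a
    second derivative of the constant trace\<close>
  have lap: "(\<Sum>k\<in>UNIV. P k (P k (P i (V i))) y0) = (\<kappa> i)\<^sup>2 * (\<Sum>k\<in>UNIV. \<kappa> k) - \<kappa> i * (\<Sum>k\<in>UNIV. (\<kappa> k)\<^sup>2)" for i
  proof -
    have "P k (P k (P i (V i))) y0 = P i (P i (P k (V k))) y0 + ((\<kappa> i)\<^sup>2 * \<kappa> k - (\<kappa> k)\<^sup>2 * \<kappa> i)" for k
    proof -
      have "P k (P k (P i (V i))) y0 = P k (P i (P k (V i))) y0"
        by (rule cong[OF comm y0]) (intro smooths | assumption)+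
      also have "\<dots> = P i (P k (P k (V i))) y0" by (intro comm smooths y0)
      also have "\<dots> = P i (P k (P i (V k))) y0 + ((\<kappa> i)\<^sup>2 * \<kappa> k - (\<kappa> k)\<^sup>2 * \<kappa> i)" by (rule curl2)
      also have "P i (P k (P i (V k))) y0 = P i (P i (P k (V k))) y0"
        by (rule cong[OF comm y0]) (intro smooths | assumption)+
      finally show ?thesis .
    qed
    moreover have "(\<Sum>k\<in>UNIV. P i (P i (P k (V k))) y0) = 0"
    proof -
      have "P i (P i (\<lambda>y. \<Sum>k\<in>UNIV. P k (V k) y)) y0 = 0"
        unfolding P_def by (rule dir_deriv2_eq_const(2)[OF U tr1[unfolded P_def] y0])
      then show ?thesis by (simp add: sum2 smooths y0)
    qed
    moreover have "(\<Sum>k\<in>UNIV. (\<kappa> i)\<^sup>2 * \<kappa> k - (\<kappa> k)\<^sup>2 * \<kappa> i)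
        = (\<kappa> i)\<^sup>2 * (\<Sum>k\<in>UNIV. \<kappa> k) - \<kappa> i * (\<Sum>k\<in>UNIV. (\<kappa> k)\<^sup>2)"
      unfolding sum_subtractf sum_distrib_left[symmetric] sum_distrib_right[symmetric] by simp
    ultimately show ?thesis by (simp add: sum.distrib)
  qed
  have second: "(\<Sum>i\<in>UNIV. \<Sum>j\<in>UNIV. (P k (P j (V i)) y0)\<^sup>2) = - (\<Sum>i\<in>UNIV. \<kappa> i * P k (P k (P i (V i))) y0)" for k
  proof -
    have "P k (P k (\<lambda>y. \<Sum>i\<in>UNIV. \<Sum>j\<in>UNIV. P j (V i) y * P i (V j) y)) y0 = 0"
      unfolding P_def by (rule dir_deriv2_eq_const(2)[OF U tr2[unfolded P_def] y0])
    then have "(\<Sum>i\<in>UNIV. \<Sum>j\<in>UNIV. P j (V i) y0 * P k (P k (P i (V j))) y0 + P k (P j (V i)) y0 * P k (P i (V j)) y0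
        + P k (P j (V i)) y0 * P k (P i (V j)) y0 + P k (P k (P j (V i))) y0 * P i (V j) y0) = 0"
      by (simp add: sum2 mult2 smooths y0)
    then have "(\<Sum>i\<in>UNIV. \<Sum>j\<in>UNIV. P j (V i) y0 * P k (P k (P i (V j))) y0)
        + (2 * (\<Sum>i\<in>UNIV. \<Sum>j\<in>UNIV. (P k (P j (V i)) y0)\<^sup>2)
        + (\<Sum>i\<in>UNIV. \<Sum>j\<in>UNIV. P i (V j) y0 * P k (P k (P j (V i))) y0)) = 0"
      by (simp add: curl1[of k _ _] sum.distrib power2_eq_square sum_distrib_left mult.commute)
    moreover have "(\<Sum>i\<in>UNIV. \<Sum>j\<in>UNIV. P j (V i) y0 * P k (P k (P i (V j))) y0) = (\<Sum>i\<in>UNIV. \<kappa> i * P k (P k (P i (V i))) y0)"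
      "(\<Sum>i\<in>UNIV. \<Sum>j\<in>UNIV. P i (V j) y0 * P k (P k (P j (V i))) y0) = (\<Sum>i\<in>UNIV. \<kappa> i * P k (P k (P i (V i))) y0)"
      unfolding A0 using delta by (simp_all add: if_distrib[of "\<lambda>z. z * _"] cong: if_cong)
    ultimately show ?thesis by simp
  qed
  have "(\<Sum>k\<in>UNIV. \<Sum>i\<in>UNIV. \<Sum>j\<in>UNIV. (P k (P j (V i)) y0)\<^sup>2) = - (\<Sum>i\<in>UNIV. \<kappa> i * (\<Sum>k\<in>UNIV. P k (P k (P i (V i))) y0))"
    unfolding second sum_negf sum_distrib_left by (subst sum.swap) (rule refl)
  also have "\<dots> = (\<Sum>i\<in>UNIV. (\<kappa> i)^2 * (\<Sum>k\<in>UNIV. (\<kappa> k)\<^sup>2)) - (\<Sum>i\<in>UNIV. (\<kappa> i)^3 * (\<Sum>k\<in>UNIV. \<kappa> k))"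
    unfolding lap by (simp add: sum_subtractf[symmetric] sum_negf[symmetric] power2_eq_square power3_eq_cube algebra_simps)
  also have "\<dots> = (\<Sum>i\<in>UNIV. (\<kappa> i)^2)^2 - (\<Sum>i\<in>UNIV. \<kappa> i) * (\<Sum>i\<in>UNIV. (\<kappa> i)^3)"
    unfolding sum_distrib_right[symmetric] by (simp add: power2_eq_square[of "\<Sum>i\<in>UNIV. (\<kappa> i)\<^sup>2"])
  finally show "(\<Sum>k\<in>UNIV. \<Sum>i\<in>UNIV. \<Sum>j\<in>UNIV. (P k (P j (V i)) y0)\<^sup>2)
      = (\<Sum>i\<in>UNIV. (\<kappa> i)^2)^2 - (\<Sum>i\<in>UNIV. \<kappa> i) * (\<Sum>i\<in>UNIV. (\<kappa> i)^3)" .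
qed

context graph_patch
begin

abbreviation "n0 \<equiv> N y0"

lemma n0: "n0 \<bullet> n0 = 1" "n0 \<bullet> b i = 0" "b i \<bullet> n0 = 0"
  using N_inner_N[OF y0] normal[OF y0, of "axis i 1"] by (simp_all add: Xd_y0 inner_commute)

lemma b_expand: "z = (n0 \<bullet> z) *\<^sub>R n0 + (\<Sum>i\<in>UNIV. (b i \<bullet> z) *\<^sub>R b i)" (is "z = ?r")
proof (rule eq_if_inner_eq[OF y0])
  show "n0 \<bullet> z = n0 \<bullet> ?r" by (simp add: inner_add_right inner_sum_right n0)
  show "z \<bullet> Xd i y0 = ?r \<bullet> Xd i y0" for i
    using orthonormal_sum_inner[OF orthonormal_b, of "\<lambda>i. b i \<bullet> z" i]
    by (simp add: Xd_y0 inner_add_left n0 inner_commute[of z])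
qed

lemma b_inner: "b i \<bullet> b j = (if i = j then 1 else 0)"
  using orthonormal_b by (simp add: orthonormal_def)

lemma b_eqI:
  assumes "n0 \<bullet> z = n0 \<bullet> z'" "\<And>i. b i \<bullet> z = b i \<bullet> z'"
  shows "z = z'"
  using b_expand[of z] b_expand[of z'] assms by simp

lemma b_parseval: "z \<bullet> z' = (n0 \<bullet> z) * (n0 \<bullet> z') + (\<Sum>i\<in>UNIV. (b i \<bullet> z) * (b i \<bullet> z'))"
  by (subst b_expand[of z]) (simp add: inner_add_left inner_sum_left)

text \<open>
  In the orthonormal basis formed by \<open>n0\<close> and the \<open>b i\<close>, the immersion is \<open>X y = \<Sum>\<^sub>i y\<^sub>i b\<^sub>i + height y n0\<close>
  and its normal is \<open>N y = tilt y n0 - \<Sum>\<^sub>i gauss_proj i y b\<^sub>i\<close>; these are the functions \<open>h\<close>, \<open>\<omega>\<close> and \<open>V\<close> of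
  Simons' formula above.
\<close>

definition height :: "real^'n \<Rightarrow> real" where "height y = n0 \<bullet> X y"
definition tilt :: "real^'n \<Rightarrow> real" where "tilt y = n0 \<bullet> N y"
definition gauss_proj :: "'n \<Rightarrow> real^'n \<Rightarrow> real" where "gauss_proj i y = - (b i \<bullet> N y)"

lemma smooth_graph: "smooth_on U height" "smooth_on U tilt" "smooth_on U (gauss_proj i)"
  unfolding height_def[abs_def] tilt_def[abs_def] gauss_proj_def[abs_def]
  by (intro smooth_on_uminus[OF open_U] smooth_on_inner[OF open_U] smooth_on_const smooth_X smooth_N)+

lemma dir_deriv_inner_const:
  "smooth_on U F \<Longrightarrow> y \<in> U \<Longrightarrow> dir_deriv v (\<lambda>y. z \<bullet> F y) y = z \<bullet> dir_deriv v F y" for F :: "real^'n \<Rightarrow> 'e"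
  by (rule dir_deriv_bounded_linear[OF bounded_linear_inner_right smooth_on_differentiable])

lemma dir_deriv_graph:
  assumes "y \<in> U"
  shows "dir_deriv v height y = n0 \<bullet> dir_deriv v X y" "dir_deriv v tilt y = n0 \<bullet> dir_deriv v N y"
    "dir_deriv v (gauss_proj i) y = - (b i \<bullet> dir_deriv v N y)"
proof -
  show "dir_deriv v height y = n0 \<bullet> dir_deriv v X y" "dir_deriv v tilt y = n0 \<bullet> dir_deriv v N y"
    unfolding height_def[abs_def] tilt_def[abs_def] by (rule dir_deriv_inner_const[OF _ assms], rule smooth_X smooth_N)+
  have "gauss_proj i = (\<lambda>y. (- b i) \<bullet> N y)" by (simp add: gauss_proj_def fun_eq_iff)
  then show "dir_deriv v (gauss_proj i) y = - (b i \<bullet> dir_deriv v N y)"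
    using dir_deriv_inner_const[OF smooth_N assms, of v "- b i"] by simp
qed

lemma dir_deriv2_graph:
  assumes "y \<in> U"
  shows "dir_deriv u (dir_deriv v height) y = n0 \<bullet> dir_deriv u (dir_deriv v X) y"
    "dir_deriv u (dir_deriv v tilt) y = n0 \<bullet> dir_deriv u (dir_deriv v N) y"
    "dir_deriv u (dir_deriv v (gauss_proj i)) y = - (b i \<bullet> dir_deriv u (dir_deriv v N) y)"
proof -
  show "dir_deriv u (dir_deriv v height) y = n0 \<bullet> dir_deriv u (dir_deriv v X) y"
    using dir_deriv_cong[OF open_U assms dir_deriv_graph(1)] dir_deriv_inner_const[OF smooth_Xd assms] by simp
  show "dir_deriv u (dir_deriv v tilt) y = n0 \<bullet> dir_deriv u (dir_deriv v N) y"
    using dir_deriv_cong[OF open_U assms dir_deriv_graph(2)] dir_deriv_inner_const[OF smooth_Nd assms] by simp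
  show "dir_deriv u (dir_deriv v (gauss_proj i)) y = - (b i \<bullet> dir_deriv u (dir_deriv v N) y)"
  proof -
    have "dir_deriv u (dir_deriv v (gauss_proj i)) y = dir_deriv u (\<lambda>y. (- b i) \<bullet> dir_deriv v N y) y"
      by (rule dir_deriv_cong[OF open_U assms]) (simp add: dir_deriv_graph)
    then show ?thesis using dir_deriv_inner_const[OF smooth_Nd assms, of u "- b i" v] by simp
  qed
qed

lemma b_Xd: "y \<in> U \<Longrightarrow> b i \<bullet> Xd j y = (if i = j then 1 else 0)"
proof -
  assume y: "y \<in> U"
  have "b i \<bullet> Xd j y = dir_deriv (axis j 1) (\<lambda>y. b i \<bullet> X y) y"
    by (rule dir_deriv_inner_const[OF smooth_X y, symmetric])
  also have "\<dots> = dir_deriv (axis j 1) (\<lambda>y. y $ i) y"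
    by (rule dir_deriv_cong[OF open_U y]) (rule graph)
  also have "\<dots> = axis j 1 $ i"
    by (rule dir_deriv_eqI) (rule bounded_linear_imp_has_derivative[OF bounded_linear_vec_nth])
  finally show ?thesis by (simp add: axis_def)
qed

text \<open>
  The component of \<open>dir_deriv v X y\<close> along \<open>b i\<close> is \<open>v $ i\<close>, so that the entries of the shape operator can be
  read off from the Weingarten formula.
\<close>

lemma shape_graph: "y \<in> U \<Longrightarrow> matrix (shape y) $ i $ j = dir_deriv (axis j 1) (gauss_proj i) y"
proof -
  assume y: "y \<in> U"
  have "b i \<bullet> dir_deriv v X y = v $ i" for v
    by (subst dX_expand[OF y]) (simp add: inner_sum_right b_Xd[OF y] if_distrib[of "\<lambda>z. _ * z"] cong: if_cong)
  then have "shape y (axis j 1) $ i = b i \<bullet> dir_deriv (shape y (axis j 1)) X y" by simp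
  then show ?thesis by (simp add: weingarten[OF y] dir_deriv_graph[OF y] matrix_def)
qed

lemma gauss_proj_eq: "y \<in> U \<Longrightarrow> gauss_proj i y = tilt y * dir_deriv (axis i 1) height y"
  using normal[of y "axis i 1"] b_parseval[of "N y" "Xd i y"]
  by (simp add: b_Xd tilt_def gauss_proj_def dir_deriv_graph if_distrib[of "\<lambda>z. _ * z"] cong: if_cong)

lemma tilt_eq: "y \<in> U \<Longrightarrow> tilt y * tilt y + (\<Sum>i\<in>UNIV. gauss_proj i y * gauss_proj i y) = 1"
  using N_inner_N[of y] b_parseval[of "N y" "N y"] by (simp add: tilt_def gauss_proj_def)

lemma gauss_proj_deriv_y0: "dir_deriv (axis j 1) (gauss_proj i) y0 = (if i = j then \<kappa> i else 0)"
  by (simp add: dir_deriv_graph[OF y0] principal b_inner)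

lemma simons:
  assumes "\<And>y. y \<in> U \<Longrightarrow> trace (matrix (shape y)) = c1"
    and "\<And>y. y \<in> U \<Longrightarrow> trace (matrix (shape y) ** matrix (shape y)) = c2"
  shows "gauss_proj i y0 = 0" "dir_deriv (axis i 1) height y0 = 0" "dir_deriv (axis k 1) tilt y0 = 0"
    "dir_deriv (axis l 1) (dir_deriv (axis k 1) tilt) y0 = (if k = l then - (\<kappa> k)\<^sup>2 else 0)"
    "dir_deriv (axis j 1) (dir_deriv (axis i 1) height) y0 = (if i = j then \<kappa> i else 0)"
    "(\<Sum>k\<in>UNIV. \<Sum>i\<in>UNIV. \<Sum>j\<in>UNIV. (dir_deriv (axis k 1) (dir_deriv (axis j 1) (gauss_proj i)) y0)\<^sup>2)
      = (\<Sum>i\<in>UNIV. (\<kappa> i)^2)^2 - (\<Sum>i\<in>UNIV. \<kappa> i) * (\<Sum>i\<in>UNIV. (\<kappa> i)^3)"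
proof -
  have t0: "tilt y0 = 1" by (simp add: tilt_def n0)
  have "(\<Sum>i\<in>UNIV. dir_deriv (axis i 1) (gauss_proj i) y) = c1" if "y \<in> U" for y
    using assms(1)[OF that] by (simp add: trace_def shape_graph[OF that])
  moreover have "(\<Sum>i\<in>UNIV. \<Sum>j\<in>UNIV. dir_deriv (axis j 1) (gauss_proj i) y * dir_deriv (axis i 1) (gauss_proj j) y) = c2"
    if "y \<in> U" for y
    using assms(2)[OF that] by (simp add: trace_def matrix_matrix_mult_def shape_graph[OF that])
  ultimately have tr: "\<And>y. y \<in> U \<Longrightarrow> (\<Sum>i\<in>UNIV. dir_deriv (axis i 1) (gauss_proj i) y) = c1"
    "\<And>y. y \<in> U \<Longrightarrow> (\<Sum>i\<in>UNIV. \<Sum>j\<in>UNIV. dir_deriv (axis j 1) (gauss_proj i) y * dir_deriv (axis i 1) (gauss_proj j) y) = c2"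
    by blast+
  note S = simons_formula_gradient[OF open_U y0 smooth_graph(1,2) smooth_graph(3) gauss_proj_eq tilt_eq t0 gauss_proj_deriv_y0 tr]
  show "gauss_proj i y0 = 0" by (rule S(1))
  show "dir_deriv (axis i 1) height y0 = 0" by (rule S(2))
  show "dir_deriv (axis k 1) tilt y0 = 0" by (rule S(3))
  show "dir_deriv (axis l 1) (dir_deriv (axis k 1) tilt) y0 = (if k = l then - (\<kappa> k)\<^sup>2 else 0)" by (rule S(4))
  show "dir_deriv (axis j 1) (dir_deriv (axis i 1) height) y0 = (if i = j then \<kappa> i else 0)" by (rule S(5))
  show "(\<Sum>k\<in>UNIV. \<Sum>i\<in>UNIV. \<Sum>j\<in>UNIV. (dir_deriv (axis k 1) (dir_deriv (axis j 1) (gauss_proj i)) y0)\<^sup>2)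
      = (\<Sum>i\<in>UNIV. (\<kappa> i)^2)^2 - (\<Sum>i\<in>UNIV. \<kappa> i) * (\<Sum>i\<in>UNIV. (\<kappa> i)^3)"
    by (rule S(6))
qed

text \<open>
  The fixed vectors \<open>n0\<close> and \<open>b j\<close> are explicit combinations of the normal and the coordinate
  tangent vectors at any point \<open>y\<close>, so that the values of \<open>pr y\<close> on them are explicit as well; the
  derivatives of these at \<open>y0\<close> vanish because the covariant derivative of the shape operator does
  and \<open>\<kappa>\<^sup>2 = a \<kappa>\<close>.
\<close>

lemma normal_projection_stationary:
  assumes tr: "\<And>y. y \<in> U \<Longrightarrow> trace (matrix (shape y)) = c1"
    "\<And>y. y \<in> U \<Longrightarrow> trace (matrix (shape y) ** matrix (shape y)) = c2"
    and zero: "(\<Sum>i\<in>UNIV. (\<kappa> i)^2)^2 = (\<Sum>i\<in>UNIV. \<kappa> i) * (\<Sum>i\<in>UNIV. (\<kappa> i)^3)"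
    and a: "a \<noteq> 0" "\<And>i. \<kappa> i = 0 \<or> \<kappa> i = a"
    and lin: "\<And>y. y \<in> U \<Longrightarrow> linear (pr y)"
    and prN: "\<And>y. y \<in> U \<Longrightarrow> pr y (N y) = N y"
    and prX: "\<And>y i. y \<in> U \<Longrightarrow> pr y (Xd i y) = (- 1 / a) *\<^sub>R dir_deriv (axis i 1) N y"
  shows "((\<lambda>y. pr y v) has_derivative (\<lambda>_. 0)) (at y0)"
proof -
  note S = simons[OF tr]
  let ?Nd = "\<lambda>i. dir_deriv (axis i (1::real)) N"
  have "(\<Sum>k\<in>UNIV. \<Sum>i\<in>UNIV. \<Sum>j\<in>UNIV. (dir_deriv (axis k 1) (dir_deriv (axis j 1) (gauss_proj i)) y0)\<^sup>2) = 0"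
    using S(6) zero by simp
  then have third: "dir_deriv (axis k 1) (dir_deriv (axis j 1) (gauss_proj i)) y0 = 0" for i j k
    by (simp add: sum_nonneg_eq_0_iff sum_nonneg)
  have Ndd: "dir_deriv (axis k 1) (?Nd j) y0 = (if j = k then - (\<kappa> j)\<^sup>2 else 0) *\<^sub>R n0" for j k
  proof (rule b_eqI)
    show "n0 \<bullet> dir_deriv (axis k 1) (?Nd j) y0 = n0 \<bullet> ((if j = k then - (\<kappa> j)\<^sup>2 else 0) *\<^sub>R n0)"
      using S(4)[of k j] dir_deriv2_graph(2)[OF y0, of "axis k 1" "axis j 1"] by (simp add: n0)
    show "b i \<bullet> dir_deriv (axis k 1) (?Nd j) y0 = b i \<bullet> ((if j = k then - (\<kappa> j)\<^sup>2 else 0) *\<^sub>R n0)" for i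
      using third[of k j i] dir_deriv2_graph(3)[OF y0, of "axis k 1" "axis j 1" i] by (simp add: n0)
  qed
  define p where "p y = tilt y *\<^sub>R (N y - (1/a) *\<^sub>R (\<Sum>i\<in>UNIV. gauss_proj i y *\<^sub>R ?Nd i y))" for y
  define q where "q j y = (- 1 / a) *\<^sub>R ?Nd j y - dir_deriv (axis j 1) height y *\<^sub>R p y" for j y
  have prn: "pr y n0 = p y" if y: "y \<in> U" for y
  proof -
    have "n0 = tilt y *\<^sub>R (N y + (\<Sum>i\<in>UNIV. gauss_proj i y *\<^sub>R Xd i y))"
    proof (rule b_eqI)
      have "tilt y * (\<Sum>i\<in>UNIV. gauss_proj i y * dir_deriv (axis i 1) height y) = (\<Sum>i\<in>UNIV. gauss_proj i y * gauss_proj i y)"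
        by (simp add: sum_distrib_left gauss_proj_eq[OF y] mult_ac)
      then show "n0 \<bullet> n0 = n0 \<bullet> (tilt y *\<^sub>R (N y + (\<Sum>i\<in>UNIV. gauss_proj i y *\<^sub>R Xd i y)))"
        using tilt_eq[OF y]
        by (simp add: n0 inner_add_right inner_sum_right dir_deriv_graph[OF y] tilt_def distrib_left)
      show "b i \<bullet> n0 = b i \<bullet> (tilt y *\<^sub>R (N y + (\<Sum>i\<in>UNIV. gauss_proj i y *\<^sub>R Xd i y)))" for i
        by (simp add: n0 inner_add_right inner_diff_right inner_sum_right b_Xd[OF y] gauss_proj_def sum_negf if_distrib[of "\<lambda>z. _ * z"] cong: if_cong)
    qed
    from arg_cong[OF this, of "pr y"] show ?thesis
      by (simp add: linear_cmul[OF lin[OF y]] linear_add[OF lin[OF y]] linear_sum[OF lin[OF y]] prN[OF y] prX[OF y]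
          p_def scaleR_sum_right sum_negf mult.commute)
  qed
  have prb: "pr y (b j) = q j y" if y: "y \<in> U" for y j
  proof -
    have "b j = Xd j y - dir_deriv (axis j 1) height y *\<^sub>R n0"
      by (rule b_eqI) (simp_all add: n0 b_inner inner_diff_right b_Xd[OF y] dir_deriv_graph[OF y])
    from arg_cong[OF this, of "pr y"] show ?thesis
      by (simp add: linear_diff[OF lin[OF y]] linear_cmul[OF lin[OF y]] prX[OF y] prn[OF y] q_def)
  qed
  have sp: "smooth_on U p"
    unfolding p_def[abs_def]
    by (intro smooth_on_scaleR[OF open_U] smooth_on_diff[OF open_U] smooth_on_sum[OF open_U] smooth_on_const
        smooth_graph smooth_N smooth_Nd)
  have sq: "smooth_on U (q j)" for j
    unfolding q_def[abs_def]
    by (intro smooth_on_scaleR[OF open_U] smooth_on_diff[OF open_U] smooth_on_const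
        smooth_graph smooth_Nd smooth_on_dir_deriv sp)
  note D = smooth_on_differentiable[OF _ y0]
  have scaleR: "dir_deriv v (\<lambda>y. F y *\<^sub>R H y) y0 = F y0 *\<^sub>R dir_deriv v H y0 + dir_deriv v F y0 *\<^sub>R H y0"
    if "smooth_on U F" "smooth_on U H" for F and H :: "real^'n \<Rightarrow> 'e" and v
    by (rule dir_deriv_scaleR[OF D[OF that(1)] D[OF that(2)]])
  have \<kappa>a: "(\<kappa> k)\<^sup>2 / a = \<kappa> k" for k using a(2)[of k] a(1) by (auto simp: power2_eq_square)
  have p': "dir_deriv (axis k 1) p y0 = 0" for k
  proof -
    let ?s = "\<lambda>y. \<Sum>i\<in>UNIV. gauss_proj i y *\<^sub>R ?Nd i y"
    have ss: "smooth_on U ?s"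
      by (intro smooth_on_scaleR[OF open_U] smooth_on_sum[OF open_U] smooth_graph smooth_Nd)
    have s': "dir_deriv (axis k 1) ?s y0 = \<kappa> k *\<^sub>R ?Nd k y0"
    proof -
      have "dir_deriv (axis k 1) ?s y0 = (\<Sum>i\<in>UNIV. dir_deriv (axis k 1) (\<lambda>y. gauss_proj i y *\<^sub>R ?Nd i y) y0)"
        by (rule smooth_dir_deriv_sum[OF open_U _ y0]) (intro smooth_on_scaleR[OF open_U] smooth_graph smooth_Nd)
      also have "\<dots> = (\<Sum>i\<in>UNIV. (if i = k then \<kappa> i else 0) *\<^sub>R ?Nd i y0)"
        by (simp add: scaleR smooth_graph smooth_Nd S(1) gauss_proj_deriv_y0)
      also have "\<dots> = \<kappa> k *\<^sub>R ?Nd k y0" by (simp add: if_distrib[of "\<lambda>z. z *\<^sub>R _"] cong: if_cong)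
      finally show ?thesis .
    qed
    have "dir_deriv (axis k 1) (\<lambda>y. N y - (1/a) *\<^sub>R ?s y) y0 = ?Nd k y0 - (1/a) *\<^sub>R dir_deriv (axis k 1) ?s y0"
    proof -
      have "smooth_on U (\<lambda>y. (1/a) *\<^sub>R ?s y)" by (intro smooth_on_scaleR[OF open_U] smooth_on_const ss)
      then show ?thesis
        using dir_deriv_diff[OF D[OF smooth_N] D, of "\<lambda>y. (1/a) *\<^sub>R ?s y" "axis k 1"] scaleR[OF smooth_on_const ss, of "axis k 1" "1/a"] by simp
    qed
    also have "\<dots> = 0"
    proof -
      have "(1/a * \<kappa> k) * \<kappa> k = \<kappa> k" using \<kappa>a[of k] by (simp add: power2_eq_square)
      then show ?thesis by (simp add: s' principal)
    qed
    finally have r': "dir_deriv (axis k 1) (\<lambda>y. N y - (1/a) *\<^sub>R ?s y) y0 = 0" .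
    have "smooth_on U (\<lambda>y. N y - (1/a) *\<^sub>R ?s y)"
      by (intro smooth_on_scaleR[OF open_U] smooth_on_diff[OF open_U] smooth_on_const ss smooth_N)
    then show ?thesis unfolding p_def[abs_def] using scaleR[OF smooth_graph(2)] r' S(3) by simp
  qed
  have p0: "p y0 = n0" using prn[OF y0] prN[OF y0] by simp
  have q': "dir_deriv (axis k 1) (q j) y0 = 0" for k j
  proof -
    have s1: "smooth_on U (\<lambda>y. (- 1 / a) *\<^sub>R ?Nd j y)"
      by (intro smooth_on_scaleR[OF open_U] smooth_on_const smooth_Nd)
    have s2: "smooth_on U (\<lambda>y. dir_deriv (axis j 1) height y *\<^sub>R p y)"
      by (intro smooth_on_scaleR[OF open_U] smooth_on_dir_deriv smooth_graph sp)
    have "dir_deriv (axis k 1) (q j) y0 = (- 1 / a) *\<^sub>R dir_deriv (axis k 1) (?Nd j) y0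
        - dir_deriv (axis k 1) (dir_deriv (axis j 1) height) y0 *\<^sub>R n0"
      unfolding q_def[abs_def] using dir_deriv_diff[OF D[OF s1] D[OF s2], of "axis k 1"]
        scaleR[OF smooth_on_const smooth_Nd, of "axis k 1" "- 1 / a" "axis j 1"]
        scaleR[OF smooth_on_dir_deriv[OF smooth_graph(1)] sp, of "axis k 1" "axis j 1"]
      by (simp add: S(2) p0)
    then show ?thesis using \<kappa>a[of j] by (simp add: Ndd S(5) scaleR_diff_left[symmetric] split: if_splits)
  qed
  define F where "F y = (n0 \<bullet> v) *\<^sub>R p y + (\<Sum>i\<in>UNIV. (b i \<bullet> v) *\<^sub>R q i y)" for y
  have F: "pr y v = F y" if y: "y \<in> U" for y
    by (subst b_expand[of v])
      (simp add: F_def linear_add[OF lin[OF y]] linear_cmul[OF lin[OF y]] linear_sum[OF lin[OF y]] prn[OF y] prb[OF y])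
  have zero': "(G has_derivative (\<lambda>_. 0)) (at y0)" if G: "smooth_on U G" "\<And>k. dir_deriv (axis k 1) G y0 = 0"
    for G :: "real^'n \<Rightarrow> 'e"
  proof -
    have "dir_deriv v G y0 = 0" for v by (subst dir_deriv_axis[OF D[OF G(1)]]) (simp add: G(2))
    then show ?thesis using smooth_on_has_derivative[OF G(1) y0] by simp
  qed
  have "(F has_derivative (\<lambda>h. (n0 \<bullet> v) *\<^sub>R 0 + (\<Sum>i\<in>UNIV. (b i \<bullet> v) *\<^sub>R 0))) (at y0)"
    unfolding F_def[abs_def]
    by (intro has_derivative_add has_derivative_scaleR_right has_derivative_sum zero' sp sq p' q')
  then have "(F has_derivative (\<lambda>_. 0)) (at y0)" by simp
  then show ?thesis by (rule has_derivative_transform_within_open[OF _ open_U y0]) (simp add: F)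
qed

end

section \<open>Immersed hypersurfaces in charts\<close>

context hypersurface_patch
begin

lemma shape_eq_iff: "x \<in> U \<Longrightarrow> shape x w = k *\<^sub>R w \<longleftrightarrow> dir_deriv w N x = - (k *\<^sub>R dir_deriv w X x)"
proof -
  assume x: "x \<in> U"
  have "shape x w = k *\<^sub>R w \<longleftrightarrow> dir_deriv (shape x w) X x = dir_deriv (k *\<^sub>R w) X x"
    using inj_dX[OF x] by (auto dest: injD)
  then show ?thesis unfolding weingarten[OF x] linear_cmul[OF linear_dX[OF x]] by (metis minus_minus)
qed

lemma trace_principal:
  assumes x: "x \<in> U" and w: "orthonormal (\<lambda>i::'n. dir_deriv (w i) X x)"
    "\<And>i. dir_deriv (w i) N x = - (\<kappa> i *\<^sub>R dir_deriv (w i) X x)"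
  shows "trace (matrix (shape x)) = (\<Sum>i\<in>UNIV. \<kappa> i)"
    "trace (matrix (shape x) ** matrix (shape x)) = (\<Sum>i\<in>UNIV. (\<kappa> i)\<^sup>2)"
proof -
  interpret hypersurface_metric U X N "\<lambda>x. \<chi> i j. Xd i x \<bullet> Xd j x"
  proof
    fix y u v assume y: "y \<in> U"
    show "dir_deriv u X y \<bullet> dir_deriv v X y = u \<bullet> ((\<chi> i j. Xd i y \<bullet> Xd j y) *v v)"
      unfolding dX_expand[OF y, of u] dX_expand[OF y, of v]
      unfolding inner_sum_left unfolding inner_sum_right
      by (simp add: inner_vec_def[of u] matrix_vector_mult_def sum_distrib_left mult_ac)
  qed
  show "trace (matrix (shape x)) = (\<Sum>i\<in>UNIV. \<kappa> i)"
    "trace (matrix (shape x) ** matrix (shape x)) = (\<Sum>i\<in>UNIV. (\<kappa> i)\<^sup>2)"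
    using trace_shape[OF x, of w \<kappa>] w orthonormal_frame_iff[OF x] shape_eq_iff[OF x] by auto
qed

lemma dX_principal_frame_expand:
  assumes x: "x \<in> U" and w: "orthonormal (\<lambda>i::'n. dir_deriv (w i) X x)"
  shows "v = (\<Sum>i\<in>UNIV. (dir_deriv (w i) X x \<bullet> dir_deriv v X x) *\<^sub>R w i)"
proof -
  let ?b = "\<lambda>i. dir_deriv (w i) X x"
  have "inj w"
  proof (rule injI)
    fix i j assume "w i = w j"
    then show "i = j" using orthonormal_inner[OF w, of i j] orthonormal_inner[OF w, of i i] by (auto split: if_splits)
  qed
  have lin: "linear (\<lambda>v. dir_deriv v X x)" by (rule linear_dX[OF x])
  have coeff: "dir_deriv (\<Sum>i\<in>UNIV. c i *\<^sub>R w i) X x \<bullet> ?b j = c j" for c j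
    using orthonormal_sum_inner[OF w, of c j] by (simp add: linear_sum[OF lin] linear_cmul[OF lin])
  have "independent (range w)"
  proof (rule independent_if_scalars_zero)
    fix c z assume "(\<Sum>z\<in>range w. c z *\<^sub>R z) = 0" and z: "z \<in> range w"
    then have "(\<Sum>i\<in>UNIV. c (w i) *\<^sub>R w i) = 0" using \<open>inj w\<close> by (simp add: sum.reindex)
    then have "c (w j) = 0" for j using coeff[of "\<lambda>i. c (w i)" j] linear_0[OF lin] by simp
    then show "c z = 0" using z by auto
  qed simp
  moreover have "card (range w) = CARD('n)" using \<open>inj w\<close> by (simp add: card_image)
  ultimately have "span (range w) = UNIV"
    using card_ge_dim_independent[of "range w" UNIV] by auto
  then obtain c where "v = (\<Sum>z\<in>range w. c z *\<^sub>R z)" using span_finite[of "range w"] by auto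
  then have c: "v = (\<Sum>i\<in>UNIV. c (w i) *\<^sub>R w i)" using \<open>inj w\<close> by (simp add: sum.reindex)
  then have "dir_deriv v X x \<bullet> ?b j = c (w j)" for j using coeff[of "\<lambda>i. c (w i)" j] by simp
  then show ?thesis using c by (simp add: inner_commute)
qed

end

locale immersed_hypersurface =
  fixes \<A> :: "('m::t2_space, 'n::finite) chart set" and g :: "('m, 'n) metric_tensor"
    and f \<xi> :: "'m \<Rightarrow> 'e::euclidean_space"
  assumes atlas: "smooth_atlas \<A>" and metric: "riemannian_metric \<A> g"
    and immersed: "isometric_immersion \<A> g f" and normal_field: "unit_normal_field \<A> f \<xi>"
    and codimension: "DIM('e) = Suc CARD('n)"
begin

lemma chart:
  assumes "c \<in> \<A>"
  shows "open (fst c)" "open (chart_image c)" "homeomorphism (fst c) (chart_image c) (snd c) (chart_inv c)"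
  using atlas assms by (auto simp: smooth_atlas_def)

lemma chart_maps:
  assumes "c \<in> \<A>"
  shows "p \<in> fst c \<Longrightarrow> snd c p \<in> chart_image c" "p \<in> fst c \<Longrightarrow> chart_inv c (snd c p) = p"
    "x \<in> chart_image c \<Longrightarrow> chart_inv c x \<in> fst c" "x \<in> chart_image c \<Longrightarrow> snd c (chart_inv c x) = x"
    "continuous_on (fst c) (snd c)" "continuous_on (chart_image c) (chart_inv c)"
  using chart(3)[OF assms] by (auto simp: homeomorphism_def chart_image_def)

lemma chart_at: "chart_at \<A> p \<in> \<A>" "p \<in> fst (chart_at \<A> p)"
proof -
  have "p \<in> (\<Union>c\<in>\<A>. fst c)" using atlas unfolding smooth_atlas_def by (metis UNIV_I)
  then obtain c where "c \<in> \<A> \<and> p \<in> fst c" by blast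
  from someI[of "\<lambda>c. c \<in> \<A> \<and> p \<in> fst c", OF this]
  show "chart_at \<A> p \<in> \<A>" "p \<in> fst (chart_at \<A> p)" by (auto simp: chart_at_def)
qed

lemma differential_eq: "differential c F p u = dir_deriv u (F \<circ> chart_inv c) (snd c p)"
  by (simp add: differential_def dir_deriv_def)

lemma smooth_chart:
  assumes "c \<in> \<A>"
  shows "smooth_on (chart_image c) (f \<circ> chart_inv c)" "smooth_on (chart_image c) (\<xi> \<circ> chart_inv c)"
  using immersed normal_field assms by (auto simp: isometric_immersion_def unit_normal_field_def smooth_map_def)

lemma patch: "c \<in> \<A> \<Longrightarrow> hypersurface_metric (chart_image c) (f \<circ> chart_inv c) (\<xi> \<circ> chart_inv c) (g c)"
proof
  assume c: "c \<in> \<A>"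
  note m = chart_maps[OF c]
  show "open (chart_image c)" by (rule chart(2)[OF c])
  show "smooth_on (chart_image c) (f \<circ> chart_inv c)" "smooth_on (chart_image c) (\<xi> \<circ> chart_inv c)"
    by (rule smooth_chart[OF c])+
  show "DIM('e) = Suc CARD('n)" by (rule codimension)
  fix x u v assume x: "x \<in> chart_image c"
  have *: "inj (differential c f p)" "differential c f p u \<bullet> differential c f p v = u \<bullet> (g c (snd c p) *v v)"
    "\<xi> p \<bullet> differential c f p u = 0" "norm (\<xi> p) = 1" if "p \<in> fst c" for p u v
    using immersed normal_field c that by (auto simp: isometric_immersion_def unit_normal_field_def)
  have e: "dir_deriv u (f \<circ> chart_inv c) x = differential c f (chart_inv c x) u" for u
    by (simp add: differential_eq m(4)[OF x])
  show "dir_deriv u (f \<circ> chart_inv c) x \<bullet> dir_deriv v (f \<circ> chart_inv c) x = u \<bullet> (g c x *v v)"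
    unfolding e using *(2)[OF m(3)[OF x]] by (simp add: m(4)[OF x])
  show "(\<xi> \<circ> chart_inv c) x \<bullet> dir_deriv v (f \<circ> chart_inv c) x = 0"
    unfolding e using *(3)[OF m(3)[OF x]] by simp
  show "norm ((\<xi> \<circ> chart_inv c) x) = 1" using *(4)[OF m(3)[OF x]] by simp
  have "linear (\<lambda>v. dir_deriv v (f \<circ> chart_inv c) x)"
    using has_derivative_linear smooth_on_has_derivative[OF smooth_chart(1)[OF c] x] by blast
  then have "differential c f (chart_inv c x) 0 = 0" using linear_0 unfolding e[symmetric] by fast
  then show "v = 0" if "dir_deriv v (f \<circ> chart_inv c) x = 0"
    using that *(1)[OF m(3)[OF x]] unfolding e by (metis injD)
qed

lemma overlap_open: "c \<in> \<A> \<Longrightarrow> d \<in> \<A> \<Longrightarrow> open (snd c ` (fst c \<inter> fst d))"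
proof -
  assume c: "c \<in> \<A>" and d: "d \<in> \<A>"
  have "snd c ` (fst c \<inter> fst d) = chart_image c \<inter> chart_inv c -` fst d"
    using chart_maps[OF c] by (auto simp: chart_image_def image_iff)
  then show ?thesis
    using continuous_open_preimage[OF chart_maps(6)[OF c] chart(2)[OF c] chart(1)[OF d]] by simp
qed

lemma transition_smooth: "c \<in> \<A> \<Longrightarrow> d \<in> \<A> \<Longrightarrow> smooth_on (snd c ` (fst c \<inter> fst d)) (transition c d)"
  using atlas by (auto simp: smooth_atlas_def)

lemma differential_change:
  assumes "c \<in> \<A>" "d \<in> \<A>" "p \<in> fst c" "p \<in> fst d" and F: "smooth_on (chart_image d) (F \<circ> chart_inv d)"
  shows "dir_deriv u (F \<circ> chart_inv c) (snd c p)
    = dir_deriv (dir_deriv u (transition c d) (snd c p)) (F \<circ> chart_inv d) (snd d p)"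
proof -
  have p: "snd c p \<in> snd c ` (fst c \<inter> fst d)" using assms by blast
  have t: "transition c d (snd c q) = snd d q" if "q \<in> fst c" for q
    using chart_maps(2)[OF assms(1) that] by (simp add: transition_def)
  have "dir_deriv u (F \<circ> chart_inv c) (snd c p) = dir_deriv u (\<lambda>x. (F \<circ> chart_inv d) (transition c d x)) (snd c p)"
    by (rule dir_deriv_cong[OF overlap_open[OF assms(1,2)] p])
      (use chart_maps(2)[OF assms(1)] chart_maps(2)[OF assms(2)] t in auto)
  also have "\<dots> = dir_deriv (dir_deriv u (transition c d) (snd c p)) (F \<circ> chart_inv d) (snd d p)"
    using dir_deriv_compose[of "transition c d" "snd c p" "F \<circ> chart_inv d" u] t[OF assms(3)]
      smooth_on_differentiable[OF transition_smooth[OF assms(1,2)] p]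
      smooth_on_differentiable[OF F chart_maps(1)[OF assms(2,4)]] by simp
  finally show ?thesis .
qed

lemma shape_operator_eq:
  "shape_operator c f \<xi> p u = hypersurface_patch.shape (f \<circ> chart_inv c) (\<xi> \<circ> chart_inv c) (snd c p) u"
  if "c \<in> \<A>"
proof -
  interpret hypersurface_metric "chart_image c" "f \<circ> chart_inv c" "\<xi> \<circ> chart_inv c" "g c" by (rule patch[OF that])
  show ?thesis by (simp add: shape_operator_def shape_def differential_eq)
qed

text \<open>
  The choice of principal curvatures made in \<open>mean_curvature\<close>, named so that mean curvatures of different
  orders are symmetric functions of one and the same family.
\<close>

definition curv :: "'m \<Rightarrow> 'n \<Rightarrow> real" where "curv p = (SOME \<kappa>. principal_curvatures \<A> g f \<xi> p \<kappa>)"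

lemma curv: "principal_curvatures \<A> g f \<xi> p (curv p)"
proof -
  let ?c = "chart_at \<A> p" and ?x = "snd (chart_at \<A> p) p"
  interpret hypersurface_metric "chart_image ?c" "f \<circ> chart_inv ?c" "\<xi> \<circ> chart_inv ?c" "g ?c"
    by (rule patch[OF chart_at(1)])
  have x: "?x \<in> chart_image ?c" using chart_maps(1)[OF chart_at] .
  obtain w \<kappa> where w: "orthonormal (\<lambda>i::'n. dir_deriv (w i) (f \<circ> chart_inv ?c) ?x)" "\<And>i. shape ?x (w i) = \<kappa> i *\<^sub>R w i"
    using principal_frame[OF x] by metis
  have "principal_curvatures \<A> g f \<xi> p \<kappa>"
    unfolding principal_curvatures_def Let_def
    by (rule exI[of _ w]) (use w in \<open>simp add: orthonormal_frame_iff[OF x] shape_operator_eq[OF chart_at(1)]\<close>)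
  then show ?thesis unfolding curv_def by (rule someI[of "principal_curvatures \<A> g f \<xi> p"])
qed

lemma mean_curvature_esym: "mean_curvature \<A> g f \<xi> r p = esym r (curv p) UNIV / real (CARD('n) choose r)"
  by (simp add: mean_curvature_def Let_def esym_def curv_def)

text \<open>
  The derivative of a change of charts transports principal directions from one chart to another without changing
  the vectors of the ambient space that they represent.
\<close>

lemma ambient_frame_exists:
  "\<exists>b :: 'n \<Rightarrow> 'e. orthonormal b \<and> (\<forall>c\<in>\<A>. p \<in> fst c \<longrightarrow> (\<exists>w. \<forall>i.
     dir_deriv (w i) (f \<circ> chart_inv c) (snd c p) = b i \<and>
     dir_deriv (w i) (\<xi> \<circ> chart_inv c) (snd c p) = - (curv p i *\<^sub>R b i)))"
proof -
  let ?d = "chart_at \<A> p" and ?x = "snd (chart_at \<A> p) p"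
  interpret hypersurface_metric "chart_image ?d" "f \<circ> chart_inv ?d" "\<xi> \<circ> chart_inv ?d" "g ?d"
    by (rule patch[OF chart_at(1)])
  have x: "?x \<in> chart_image ?d" using chart_maps(1)[OF chart_at] .
  obtain e where e: "orthonormal_frame (g ?d ?x) e" "\<And>i. shape ?x (e i) = curv p i *\<^sub>R e i"
    using curv[of p] unfolding principal_curvatures_def Let_def shape_operator_eq[OF chart_at(1)] by blast
  let ?b = "\<lambda>i. dir_deriv (e i) (f \<circ> chart_inv ?d) ?x"
  have "\<exists>w. \<forall>i. dir_deriv (w i) (f \<circ> chart_inv c) (snd c p) = ?b i \<and>
     dir_deriv (w i) (\<xi> \<circ> chart_inv c) (snd c p) = - (curv p i *\<^sub>R ?b i)" if c: "c \<in> \<A>" "p \<in> fst c" for c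
  proof (intro exI allI conjI)
    fix i
    let ?w = "\<lambda>i. dir_deriv (e i) (transition ?d c) ?x"
    show "dir_deriv (?w i) (f \<circ> chart_inv c) (snd c p) = ?b i"
      by (rule differential_change[OF chart_at(1) c(1) chart_at(2) c(2) smooth_chart(1)[OF c(1)], symmetric])
    show "dir_deriv (?w i) (\<xi> \<circ> chart_inv c) (snd c p) = - (curv p i *\<^sub>R ?b i)"
      using differential_change[OF chart_at(1) c(1) chart_at(2) c(2) smooth_chart(2)[OF c(1)], of "e i"]
        e(2)[of i] shape_eq_iff[OF x] by simp
  qed
  moreover have "orthonormal ?b" using e(1) orthonormal_frame_iff[OF x] by blast
  ultimately show ?thesis by blast
qed

definition frame :: "'m \<Rightarrow> 'n \<Rightarrow> 'e" where
  "frame p = (SOME b. orthonormal b \<and> (\<forall>c\<in>\<A>. p \<in> fst c \<longrightarrow> (\<exists>w. \<forall>i.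
     dir_deriv (w i) (f \<circ> chart_inv c) (snd c p) = b i \<and>
     dir_deriv (w i) (\<xi> \<circ> chart_inv c) (snd c p) = - (curv p i *\<^sub>R b i))))"

lemma frame_orthonormal: "orthonormal (frame p)"
  and frame_chart: "c \<in> \<A> \<Longrightarrow> p \<in> fst c \<Longrightarrow> \<exists>w. \<forall>i.
     dir_deriv (w i) (f \<circ> chart_inv c) (snd c p) = frame p i \<and>
     dir_deriv (w i) (\<xi> \<circ> chart_inv c) (snd c p) = - (curv p i *\<^sub>R frame p i)"
  using someI_ex[OF ambient_frame_exists[of p]] unfolding frame_def[symmetric] by blast+

text \<open>
  \<open>X\<close> and \<open>N\<close> are to be the immersion and the normal in some coordinates, in which \<open>x\<close> represents the
  point \<open>p\<close>.
\<close>

definition adapted :: "('a::euclidean_space \<Rightarrow> 'e) \<Rightarrow> ('a \<Rightarrow> 'e) \<Rightarrow> 'm \<Rightarrow> 'a \<Rightarrow> bool" where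
  "adapted X N p x \<longleftrightarrow> (\<exists>w. \<forall>i. dir_deriv (w i) X x = frame p i \<and>
     dir_deriv (w i) N x = - (curv p i *\<^sub>R frame p i))"

lemma adaptedE:
  assumes "adapted X N p x"
  obtains w where "\<And>i. dir_deriv (w i) X x = frame p i" "\<And>i. dir_deriv (w i) N x = - (curv p i *\<^sub>R frame p i)"
  using assms unfolding adapted_def by blast

lemma frame_chart_obtain:
  assumes "c \<in> \<A>" "x \<in> chart_image c"
  obtains w where "\<And>i. dir_deriv (w i) (f \<circ> chart_inv c) x = frame (chart_inv c x) i"
    "\<And>i. dir_deriv (w i) (\<xi> \<circ> chart_inv c) x = - (curv (chart_inv c x) i *\<^sub>R frame (chart_inv c x) i)"
  using frame_chart[OF assms(1) chart_maps(3)[OF assms]] chart_maps(4)[OF assms] that by metis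

lemma \<xi>_unit: "\<xi> p \<bullet> \<xi> p = 1"
  using normal_field by (simp add: unit_normal_field_def norm_eq_1)

lemma \<xi>_frame: "\<xi> p \<bullet> frame p i = 0" "frame p i \<bullet> \<xi> p = 0"
proof -
  let ?c = "chart_at \<A> p"
  obtain w where "\<And>i. dir_deriv (w i) (f \<circ> chart_inv ?c) (snd ?c p) = frame p i" using frame_chart[OF chart_at] by blast
  moreover have "\<xi> p \<bullet> differential ?c f p (w i) = 0"
    using normal_field chart_at by (auto simp: unit_normal_field_def)
  ultimately show "\<xi> p \<bullet> frame p i = 0" by (simp add: differential_eq)
  then show "frame p i \<bullet> \<xi> p = 0" by (simp add: inner_commute)
qed

end

text \<open>
  The orthonormal frame chosen in \<open>scalar_curvature\<close> need not consist of principal directions, but both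
  sides are combinations of the traces of the shape operator and of its square.
\<close>

lemma scalar_curvature_esym:
  fixes \<A> :: "('m::t2_space, 'n::{finite,linorder}) chart set" and f :: "'m \<Rightarrow> 'e::euclidean_space"
  assumes "immersed_hypersurface \<A> g f \<xi>"
  shows "scalar_curvature \<A> g p
    = 2 / (real CARD('n) * (real CARD('n) - 1)) * esym 2 (immersed_hypersurface.curv \<A> g f \<xi> p) UNIV"
proof -
  interpret immersed_hypersurface \<A> g f \<xi> by (rule assms)
  let ?c = "chart_at \<A> p" and ?x = "snd (chart_at \<A> p) p"
  interpret hypersurface_metric "chart_image ?c" "f \<circ> chart_inv ?c" "\<xi> \<circ> chart_inv ?c" "g ?c"
    by (rule patch[OF chart_at(1)])
  have x: "?x \<in> chart_image ?c" using chart_maps(1)[OF chart_at] .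
  obtain w where w: "orthonormal_frame (g ?c ?x) w" "\<And>i. shape ?x (w i) = curv p i *\<^sub>R w i"
    using curv[of p] unfolding principal_curvatures_def Let_def shape_operator_eq[OF chart_at(1)] by blast
  define e where "e = (SOME e. orthonormal_frame (g ?c ?x) e)"
  have e: "orthonormal_frame (g ?c ?x) e"
    unfolding e_def by (rule someI[of "orthonormal_frame (g ?c ?x)", OF w(1)])
  show ?thesis
    using sum_sectional_curvatures[OF patch[OF chart_at(1)] x e w]
    by (simp add: scalar_curvature_def Let_def e_def)
qed

context immersed_hypersurface
begin

text \<open>
  All level sets of such a function are open, since it is constant on coordinate balls.
\<close>

lemma constant_if_derivative_zero:
  fixes F :: "'m \<Rightarrow> 'b::real_normed_vector"
  assumes conn: "connected (UNIV :: 'm set)"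
    and F: "\<And>c x. c \<in> \<A> \<Longrightarrow> x \<in> chart_image c \<Longrightarrow> ((F \<circ> chart_inv c) has_derivative (\<lambda>_. 0)) (at x)"
  shows "F p = F q"
proof -
  have op: "open {p. F p = z}" for z
  proof (subst open_subopen, intro ballI)
    fix p assume p: "p \<in> {p. F p = z}"
    let ?c = "chart_at \<A> p"
    note m = chart_maps[OF chart_at(1)[of p]]
    obtain r where r: "r > 0" "ball (snd ?c p) r \<subseteq> chart_image ?c"
      using chart(2)[OF chart_at(1)] m(1)[OF chart_at(2)] open_contains_ball by metis
    have const: "(F \<circ> chart_inv ?c) x = (F \<circ> chart_inv ?c) (snd ?c p)" if "x \<in> ball (snd ?c p) r" for x
    proof (rule has_derivative_zero_unique[OF convex_ball _ that])
      show "((F \<circ> chart_inv ?c) has_derivative (\<lambda>_. 0)) (at y within ball (snd ?c p) r)" if "y \<in> ball (snd ?c p) r" for y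
        using F[OF chart_at(1)] r(2) that has_derivative_at_withinI by blast
      show "snd ?c p \<in> ball (snd ?c p) r" using r(1) by simp
    qed
    let ?T = "fst ?c \<inter> snd ?c -` ball (snd ?c p) r"
    have "open ?T" by (rule continuous_open_preimage[OF m(5) chart(1)[OF chart_at(1)] open_ball])
    moreover have "p \<in> ?T" using chart_at(2) r(1) by simp
    moreover have "?T \<subseteq> {p. F p = z}"
    proof
      fix y assume y: "y \<in> ?T"
      then have "F y = (F \<circ> chart_inv ?c) (snd ?c y)" using m(2)[of y] by simp
      also have "\<dots> = (F \<circ> chart_inv ?c) (snd ?c p)" using const y by blast
      also have "\<dots> = z" using p m(2)[OF chart_at(2)] by simp
      finally show "y \<in> {p. F p = z}" by simp
    qed
    ultimately show "\<exists>T. open T \<and> p \<in> T \<and> T \<subseteq> {p. F p = z}" by blast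
  qed
  have "open (\<Union>z\<in>-{F q}. {p. F p = z})" using op by blast
  moreover have "(\<Union>z\<in>-{F q}. {p. F p = z}) = - {p. F p = F q}" by auto
  ultimately have "closed {p. F p = F q}" by (simp add: closed_def)
  then have "{p. F p = F q} = {} \<or> {p. F p = F q} = UNIV"
    using op[of "F q"] conn by (metis connected_clopen closedin_closed_Int inf_top_left openin_open_Int top_greatest closed_subset openin_subset subtopology_UNIV open_openin closed_closedin)
  then show ?thesis by auto
qed

lemma graph_at:
  assumes c: "c \<in> \<A>" and x0: "x0 \<in> chart_image c"
  defines "\<phi> \<equiv> \<lambda>x. \<chi> i. frame (chart_inv c x0) i \<bullet> f (chart_inv c x)"
  obtains U' V \<psi> where "open U'" "U' \<subseteq> chart_image c" "x0 \<in> U'" "homeomorphism U' V \<phi> \<psi>" "smooth_on V \<psi>"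
    "smooth_on (chart_image c) \<phi>"
    "graph_patch V (\<lambda>y. f (chart_inv c (\<psi> y))) (\<lambda>y. \<xi> (chart_inv c (\<psi> y))) (\<phi> x0) (curv (chart_inv c x0)) (frame (chart_inv c x0))"
    "\<And>y v. y \<in> V \<Longrightarrow> dir_deriv (dir_deriv v \<psi> y) \<phi> (\<psi> y) = v"
proof -
  interpret hypersurface_metric "chart_image c" "f \<circ> chart_inv c" "\<xi> \<circ> chart_inv c" "g c" by (rule patch[OF c])
  obtain w where w: "\<And>i. dir_deriv (w i) (f \<circ> chart_inv c) x0 = frame (chart_inv c x0) i"
    "\<And>i. dir_deriv (w i) (\<xi> \<circ> chart_inv c) x0 = - (curv (chart_inv c x0) i *\<^sub>R frame (chart_inv c x0) i)"
    using frame_chart_obtain[OF c x0] by metis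
  have s: "shape x0 (w i) = curv (chart_inv c x0) i *\<^sub>R w i" for i using shape_eq_iff[OF x0] w by simp
  have o: "orthonormal (\<lambda>i. dir_deriv (w i) (f \<circ> chart_inv c) x0)" using frame_orthonormal w(1) by simp
  show ?thesis
    by (rule graph_coordinates[OF x0 o s, unfolded w(1), unfolded o_def, folded \<phi>_def]) (rule that; (assumption | simp add: \<phi>_def))
qed

end

section \<open>Rigidity: the distribution of curved directions is parallel\<close>

context immersed_hypersurface
begin

text \<open>
  Graph coordinates centred at any point of the hypersurface; the frames of the nearby points can be
  expressed in them as well, since the change of coordinates is a diffeomorphism.
\<close>

lemma graph_with_frames:
  assumes c: "c \<in> \<A>" and x0: "x0 \<in> chart_image c"
  defines "\<phi> \<equiv> \<lambda>x. \<chi> i. frame (chart_inv c x0) i \<bullet> f (chart_inv c x)"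
  obtains U' V \<psi> where "open U'" "U' \<subseteq> chart_image c" "x0 \<in> U'" "homeomorphism U' V \<phi> \<psi>" "smooth_on V \<psi>"
    "smooth_on (chart_image c) \<phi>"
    "graph_patch V (\<lambda>y. f (chart_inv c (\<psi> y))) (\<lambda>y. \<xi> (chart_inv c (\<psi> y))) (\<phi> x0) (curv (chart_inv c x0)) (frame (chart_inv c x0))"
    "\<And>y. y \<in> V \<Longrightarrow> adapted (\<lambda>y. f (chart_inv c (\<psi> y))) (\<lambda>y. \<xi> (chart_inv c (\<psi> y))) (chart_inv c (\<psi> y)) y"
proof (rule graph_at[OF c x0, folded \<phi>_def])
  fix U' V \<psi>
  assume *: "open U'" "U' \<subseteq> chart_image c" "x0 \<in> U'" "homeomorphism U' V \<phi> \<psi>" "smooth_on V \<psi>"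
    "smooth_on (chart_image c) \<phi>"
    "graph_patch V (\<lambda>y. f (chart_inv c (\<psi> y))) (\<lambda>y. \<xi> (chart_inv c (\<psi> y))) (\<chi> i. frame (chart_inv c x0) i \<bullet> f (chart_inv c x0)) (curv (chart_inv c x0)) (frame (chart_inv c x0))"
    and right: "\<And>y v. y \<in> V \<Longrightarrow> dir_deriv (dir_deriv v \<psi> y) \<phi> (\<psi> y) = v"
  have "adapted (\<lambda>y. f (chart_inv c (\<psi> y))) (\<lambda>y. \<xi> (chart_inv c (\<psi> y))) (chart_inv c (\<psi> y)) y"
    if y: "y \<in> V" for y
  proof -
    have x: "\<psi> y \<in> chart_image c" using *(2,4) y by (auto simp: homeomorphism_def)
    obtain w where w: "\<And>i. dir_deriv (w i) (f \<circ> chart_inv c) (\<psi> y) = frame (chart_inv c (\<psi> y)) i"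
      "\<And>i. dir_deriv (w i) (\<xi> \<circ> chart_inv c) (\<psi> y) = - (curv (chart_inv c (\<psi> y)) i *\<^sub>R frame (chart_inv c (\<psi> y)) i)"
      using frame_chart_obtain[OF c x] by metis
    have d\<psi>: "\<psi> differentiable (at y)" by (rule smooth_on_differentiable[OF *(5) y])
    have lin: "linear (\<lambda>v. dir_deriv v \<psi> y)" using has_derivative_linear[OF has_derivative_dir_deriv[OF d\<psi>]] .
    have "inj (\<lambda>v. dir_deriv v \<psi> y)" by (rule inj_on_inverseI[where g="\<lambda>v. dir_deriv v \<phi> (\<psi> y)"]) (rule right[OF y])
    then have "surj (\<lambda>v. dir_deriv v \<psi> y)" by (rule linear_inj_imp_surj[OF lin])
    then have "\<forall>i. \<exists>v. dir_deriv v \<psi> y = w i" by (metis surjD)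
    from choice[OF this] obtain w' where w': "\<And>i. dir_deriv (w' i) \<psi> y = w i" by blast
    have chain: "dir_deriv v (\<lambda>y. F (chart_inv c (\<psi> y))) y = dir_deriv (dir_deriv v \<psi> y) (F \<circ> chart_inv c) (\<psi> y)"
      if "smooth_on (chart_image c) (F \<circ> chart_inv c)" for F :: "'m \<Rightarrow> 'e" and v
      using dir_deriv_compose[OF d\<psi> smooth_on_differentiable[OF that x]] by (simp add: o_def)
    show ?thesis
      unfolding adapted_def by (rule exI[of _ w']) (simp add: chain[OF smooth_chart(1)[OF c]] chain[OF smooth_chart(2)[OF c]] w' w)
  qed
  with * show thesis by (intro that[of U' V \<psi>]) (auto simp: \<phi>_def)
qed

text \<open>
  If all principal curvatures are \<open>0\<close> or \<open>a\<close>, this is the orthogonal projection onto the span of the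
  normal and the principal directions of curvature \<open>a\<close>.
\<close>

definition curved_proj :: "real \<Rightarrow> 'm \<Rightarrow> 'e \<Rightarrow> 'e" where
  "curved_proj a p v = (\<xi> p \<bullet> v) *\<^sub>R \<xi> p + (\<Sum>i\<in>UNIV. (curv p i / a * (frame p i \<bullet> v)) *\<^sub>R frame p i)"

lemma linear_curved_proj: "linear (curved_proj a p)"
  by (rule linearI) (simp_all add: curved_proj_def inner_add_right scaleR_add_left scaleR_add_right distrib_left
      sum.distrib scaleR_sum_right mult_ac)

lemma curved_proj_normal: "curved_proj a p (\<xi> p) = \<xi> p"
  by (simp add: curved_proj_def \<xi>_unit \<xi>_frame)

lemma curved_proj_frame: "curved_proj a p (frame p i) = (curv p i / a) *\<^sub>R frame p i"
  by (simp add: curved_proj_def \<xi>_frame orthonormal_inner[OF frame_orthonormal] if_distrib[of "\<lambda>z. _ * z"]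
      if_distrib[of "\<lambda>z. z *\<^sub>R _"] cong: if_cong)

text \<open>
  On tangent vectors the projection is the shape operator divided by \<open>a\<close>.
\<close>

lemma curved_proj_tangent:
  fixes U :: "(real^'n) set"
  assumes "hypersurface_patch U X N" "x \<in> U" "N x = \<xi> p"
    and w: "\<And>i::'n. dir_deriv (w i) X x = frame p i"
      "\<And>i. dir_deriv (w i) N x = - (curv p i *\<^sub>R frame p i)"
  shows "curved_proj a p (dir_deriv v X x) = (- 1 / a) *\<^sub>R dir_deriv v N x"
proof -
  interpret hypersurface_patch U X N by (rule assms(1))
  let ?c = "\<lambda>i. frame p i \<bullet> dir_deriv v X x"
  have "orthonormal (\<lambda>i::'n. dir_deriv (w i) X x)" using w(1) frame_orthonormal by simp
  from dX_principal_frame_expand[OF assms(2) this, of v]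
  have v: "v = (\<Sum>i\<in>UNIV. ?c i *\<^sub>R w i)" by (simp add: w(1))
  have "dir_deriv v N x = (\<Sum>i\<in>UNIV. ?c i *\<^sub>R dir_deriv (w i) N x)"
    using arg_cong[OF v, of "\<lambda>u. dir_deriv u N x"]
    by (simp only: linear_sum[OF linear_dN[OF assms(2)]] linear_cmul[OF linear_dN[OF assms(2)]])
  then show ?thesis
    using normal[OF assms(2), of v]
    by (simp add: curved_proj_def assms(3) w(2) scaleR_sum_right sum_negf mult_ac)
qed

end

text \<open>
  The hypotheses of the classification, in terms of the principal curvatures and of \<open>a = 3 H\<close>.  The equation
  \<open>e2\<close> combines the Gauss equation with \<open>R = 3/5 H\<^sup>2\<close>.
\<close>

locale special_hypersurface = immersed_hypersurface \<A> g f \<xi>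
  for \<A> :: "('m::t2_space, 'n::finite) chart set" and g :: "('m, 'n) metric_tensor"
    and f \<xi> :: "'m \<Rightarrow> 'e::euclidean_space" +
  fixes a :: real
  assumes connected_M: "connected (UNIV :: 'm set)" and card6: "CARD('n) = 6" and a: "a > 0"
    and e1: "esym 1 (curv p) UNIV = 2 * a" and e2: "esym 2 (curv p) UNIV = a\<^sup>2"
    and e4: "esym 4 (curv p) UNIV \<ge> 0" and e5: "esym 5 (curv p) UNIV \<le> 0" and e6: "esym 6 (curv p) UNIV \<ge> 0"
begin

lemma power_sums:
  "(\<Sum>i\<in>UNIV. curv p i) = 2 * a" "(\<Sum>i\<in>UNIV. (curv p i)^2) = 2 * a^2"
  "(\<Sum>i\<in>UNIV. (curv p i)^3) = 2 * a^3 + 3 * esym 3 (curv p) UNIV"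
  using newton_power_sums[of "UNIV :: 'n set" "curv p"] e1[of p] e2[of p]
  by (simp_all add: power2_eq_square power3_eq_cube)

lemma graph_traces:
  fixes V :: "(real^'n) set"
  assumes "graph_patch V (\<lambda>y. f (chart_inv c (\<psi> y))) (\<lambda>y. \<xi> (chart_inv c (\<psi> y))) y0 \<kappa> b"
    and "\<And>y. y \<in> V \<Longrightarrow> adapted (\<lambda>y. f (chart_inv c (\<psi> y))) (\<lambda>y. \<xi> (chart_inv c (\<psi> y))) (chart_inv c (\<psi> y)) y"
    and y: "y \<in> V"
  defines "S \<equiv> hypersurface_patch.shape (\<lambda>y. f (chart_inv c (\<psi> y))) (\<lambda>y. \<xi> (chart_inv c (\<psi> y)))"
  shows "trace (matrix (S y)) = 2 * a" "trace (matrix (S y) ** matrix (S y)) = 2 * a\<^sup>2"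
proof -
  interpret graph_patch V "\<lambda>y. f (chart_inv c (\<psi> y))" "\<lambda>y. \<xi> (chart_inv c (\<psi> y))" y0 \<kappa> b by (rule assms(1))
  obtain w where w: "\<And>i. dir_deriv (w i) (\<lambda>y. f (chart_inv c (\<psi> y))) y = frame (chart_inv c (\<psi> y)) i"
    "\<And>i. dir_deriv (w i) (\<lambda>y. \<xi> (chart_inv c (\<psi> y))) y = - (curv (chart_inv c (\<psi> y)) i *\<^sub>R frame (chart_inv c (\<psi> y)) i)"
    using adaptedE[OF assms(2)[OF y]] by blast
  have on: "orthonormal (\<lambda>i::'n. dir_deriv (w i) (\<lambda>y. f (chart_inv c (\<psi> y))) y)" using w(1) frame_orthonormal by simp
  show "trace (matrix (S y)) = 2 * a" "trace (matrix (S y) ** matrix (S y)) = 2 * a\<^sup>2"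
    using trace_principal[OF y on, of "curv (chart_inv c (\<psi> y))"] w power_sums unfolding S_def by simp_all
qed

text \<open>
  By Simons' formula the squared norm of the covariant derivative of the shape operator is \<open>- 6 a e\<^sub>3\<close>.
\<close>

lemma e3: "esym 3 (curv p) UNIV \<le> 0"
proof -
  let ?c = "chart_at \<A> p" and ?x = "snd (chart_at \<A> p) p"
  have x: "?x \<in> chart_image ?c" by (rule chart_maps(1)[OF chart_at])
  have p: "chart_inv ?c ?x = p" by (rule chart_maps(2)[OF chart_at])
  obtain U' V \<psi> where gp: "graph_patch V (\<lambda>y. f (chart_inv ?c (\<psi> y))) (\<lambda>y. \<xi> (chart_inv ?c (\<psi> y)))
      (\<chi> i. frame p i \<bullet> f p) (curv p) (frame p)"
    and fr: "\<And>y. y \<in> V \<Longrightarrow> adapted (\<lambda>y. f (chart_inv ?c (\<psi> y))) (\<lambda>y. \<xi> (chart_inv ?c (\<psi> y))) (chart_inv ?c (\<psi> y)) y"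
    by (rule graph_with_frames[OF chart_at(1) x, unfolded p]) (rule that; assumption)
  interpret G: graph_patch V "\<lambda>y. f (chart_inv ?c (\<psi> y))" "\<lambda>y. \<xi> (chart_inv ?c (\<psi> y))"
    "\<chi> i. frame p i \<bullet> f p" "curv p" "frame p" by (rule gp)
  have "0 \<le> (2 * a^2)^2 - 2 * a * (2 * a^3 + 3 * esym 3 (curv p) UNIV)"
    using G.simons(6)[OF graph_traces(1)[OF gp fr] graph_traces(2)[OF gp fr]]
    unfolding power_sums by (metis (no_types, lifting) sum_nonneg zero_le_power2)
  then have "a * esym 3 (curv p) UNIV \<le> 0" by (simp add: power2_eq_square power3_eq_cube algebra_simps)
  then show ?thesis using a by (simp add: mult_le_0_iff)
qed

lemma curv_two_valued: "esym 3 (curv p) UNIV = 0" "curv p i = 0 \<or> curv p i = a"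
  using six_curvatures_two_valued[OF card6 a e1[of p] e2 e3 e4 e5 e6] by blast+

lemma curved_proj_parallel:
  assumes c: "c \<in> \<A>" and x0: "x0 \<in> chart_image c"
  shows "((\<lambda>x. curved_proj a (chart_inv c x) v) has_derivative (\<lambda>_. 0)) (at x0)"
proof -
  define \<phi> where "\<phi> x = (\<chi> i. frame (chart_inv c x0) i \<bullet> f (chart_inv c x))" for x
  obtain U' V \<psi> where *: "open U'" "U' \<subseteq> chart_image c" "x0 \<in> U'" "homeomorphism U' V \<phi> \<psi>" "smooth_on (chart_image c) \<phi>"
    and gp: "graph_patch V (\<lambda>y. f (chart_inv c (\<psi> y))) (\<lambda>y. \<xi> (chart_inv c (\<psi> y)))
      (\<phi> x0) (curv (chart_inv c x0)) (frame (chart_inv c x0))"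
    and fr: "\<And>y. y \<in> V \<Longrightarrow> adapted (\<lambda>y. f (chart_inv c (\<psi> y))) (\<lambda>y. \<xi> (chart_inv c (\<psi> y))) (chart_inv c (\<psi> y)) y"
    by (rule graph_with_frames[OF c x0, folded \<phi>_def]) (rule that; assumption)
  interpret G: graph_patch V "\<lambda>y. f (chart_inv c (\<psi> y))" "\<lambda>y. \<xi> (chart_inv c (\<psi> y))"
    "\<phi> x0" "curv (chart_inv c x0)" "frame (chart_inv c x0)" by (rule gp)
  have "((\<lambda>y. curved_proj a (chart_inv c (\<psi> y)) v) has_derivative (\<lambda>_. 0)) (at (\<phi> x0))"
  proof (rule G.normal_projection_stationary[OF graph_traces(1)[OF gp fr] graph_traces(2)[OF gp fr]])
    show "(\<Sum>i\<in>UNIV. (curv (chart_inv c x0) i)\<^sup>2)\<^sup>2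
        = (\<Sum>i\<in>UNIV. curv (chart_inv c x0) i) * (\<Sum>i\<in>UNIV. curv (chart_inv c x0) i ^ 3)"
      unfolding power_sums curv_two_valued(1) by (simp add: power2_eq_square power3_eq_cube)
    show "a \<noteq> 0" using a by simp
    show "curv (chart_inv c x0) i = 0 \<or> curv (chart_inv c x0) i = a" for i by (rule curv_two_valued)
    fix y assume y: "y \<in> V"
    show "linear (curved_proj a (chart_inv c (\<psi> y)))" by (rule linear_curved_proj)
    show "curved_proj a (chart_inv c (\<psi> y)) (\<xi> (chart_inv c (\<psi> y))) = \<xi> (chart_inv c (\<psi> y))"
      by (rule curved_proj_normal)
    obtain w where w: "\<And>i. dir_deriv (w i) (\<lambda>y. f (chart_inv c (\<psi> y))) y = frame (chart_inv c (\<psi> y)) i"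
      "\<And>i. dir_deriv (w i) (\<lambda>y. \<xi> (chart_inv c (\<psi> y))) y = - (curv (chart_inv c (\<psi> y)) i *\<^sub>R frame (chart_inv c (\<psi> y)) i)"
      using adaptedE[OF fr[OF y]] by blast
    show "curved_proj a (chart_inv c (\<psi> y)) (dir_deriv (axis i 1) (\<lambda>y. f (chart_inv c (\<psi> y))) y)
        = (- 1 / a) *\<^sub>R dir_deriv (axis i 1) (\<lambda>y. \<xi> (chart_inv c (\<psi> y))) y" for i
      by (rule curved_proj_tangent[OF G.hypersurface_patch_axioms y refl w])
  qed
  from diff_chain_at[OF smooth_on_has_derivative[OF *(5) x0] this]
  have "((\<lambda>x. curved_proj a (chart_inv c (\<psi> (\<phi> x))) v) has_derivative (\<lambda>_. 0)) (at x0)" by (simp add: o_def)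
  then show ?thesis
    by (rule has_derivative_transform_within_open[OF _ *(1,3)]) (use *(4) in \<open>auto simp: homeomorphism_def\<close>)
qed

text \<open>
  Connectedness now turns the vanishing derivative into a projection that is the same at all points.
\<close>

lemma curved_proj_const: "curved_proj a p v = curved_proj a q v"
  by (rule constant_if_derivative_zero[OF connected_M, of "\<lambda>p. curved_proj a p v"])
    (use curved_proj_parallel in \<open>simp add: o_def\<close>)

text \<open>
  Moving the distance \<open>1/a\<close> along the normal reaches the axis of the cylinder: the directions of curvature
  \<open>a\<close> are then annihilated by the derivative, the others by the projection.
\<close>

lemma centre_const: "curved_proj a q (f p) + (1/a) *\<^sub>R \<xi> p = curved_proj a q (f p') + (1/a) *\<^sub>R \<xi> p'"
proof (rule constant_if_derivative_zero[OF connected_M, of "\<lambda>p. curved_proj a q (f p) + (1/a) *\<^sub>R \<xi> p"])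
  fix c x assume c: "c \<in> \<A>" and x: "x \<in> chart_image c"
  interpret hypersurface_metric "chart_image c" "f \<circ> chart_inv c" "\<xi> \<circ> chart_inv c" "g c" by (rule patch[OF c])
  let ?D = "\<lambda>v. curved_proj a q (dir_deriv v (f \<circ> chart_inv c) x) + (1/a) *\<^sub>R dir_deriv v (\<xi> \<circ> chart_inv c) x"
  have bl: "bounded_linear (curved_proj a q)" using linear_curved_proj linear_conv_bounded_linear by blast
  have "((\<lambda>x. curved_proj a q ((f \<circ> chart_inv c) x) + (1/a) *\<^sub>R (\<xi> \<circ> chart_inv c) x) has_derivative ?D) (at x)"
    by (intro has_derivative_add has_derivative_scaleR_right bounded_linear.has_derivative[OF bl]
        smooth_on_has_derivative[OF smooth_X x] smooth_on_has_derivative[OF smooth_N x])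
  moreover have "?D v = 0" for v
  proof -
    obtain w where w: "\<And>i. dir_deriv (w i) (f \<circ> chart_inv c) x = frame (chart_inv c x) i"
      "\<And>i. dir_deriv (w i) (\<xi> \<circ> chart_inv c) x = - (curv (chart_inv c x) i *\<^sub>R frame (chart_inv c x) i)"
      using frame_chart_obtain[OF c x] by metis
    from curved_proj_tangent[OF hypersurface_patch_axioms x _ w]
    have "curved_proj a (chart_inv c x) (dir_deriv v (f \<circ> chart_inv c) x) = (- 1 / a) *\<^sub>R dir_deriv v (\<xi> \<circ> chart_inv c) x"
      by simp
    then show ?thesis using curved_proj_const[of q _ "chart_inv c x"] by (simp flip: scaleR_add_left)
  qed
  ultimately show "((\<lambda>p. curved_proj a q (f p) + (1/a) *\<^sub>R \<xi> p) \<circ> chart_inv c has_derivative (\<lambda>_. 0)) (at x)"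
    by (simp add: o_def)
qed

end

section \<open>The Riemannian distance\<close>

context immersed_hypersurface
begin

abbreviation "speed \<equiv> curve_speed \<A> g"

lemma C1_chart_curve:
  assumes c: "c \<in> \<A>" and "a < b" and x: "\<And>t. t \<in> {a..b} \<Longrightarrow> x t \<in> chart_image c"
    and x': "\<And>t. t \<in> {a..b} \<Longrightarrow> (x has_vector_derivative x' t) (at t within {a..b})" "continuous_on {a..b} x'"
  shows "C1_curve_on \<A> a b (chart_inv c \<circ> x)"
proof -
  have cx: "continuous_on {a..b} x" using x'(1) continuous_on_vector_derivative by blast
  have "continuous_on {a..b} (chart_inv c \<circ> x)"
    unfolding o_def by (rule continuous_on_compose2[OF chart_maps(6)[OF c] cx]) (use x in blast)
  moreover have "(\<forall>t\<in>{a..b}. (chart_inv c \<circ> x) t \<in> fst d \<longrightarrow> (snd d \<circ> (chart_inv c \<circ> x)) differentiable (at t within {a..b})) \<and>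
     continuous_on {t\<in>{a..b}. (chart_inv c \<circ> x) t \<in> fst d} (\<lambda>t. vector_derivative (snd d \<circ> (chart_inv c \<circ> x)) (at t within {a..b}))"
    if d: "d \<in> \<A>" for d
  proof -
    let ?O = "snd c ` (fst c \<inter> fst d)" and ?T = "{t\<in>{a..b}. (chart_inv c \<circ> x) t \<in> fst d}"
    have O: "x t \<in> ?O" if "t \<in> ?T" for t
      using that x chart_maps(3)[OF c, of "x t"] chart_maps(4)[OF c, of "x t"] by (auto simp: image_iff) (metis IntI)
    let ?v = "\<lambda>t. dir_deriv (x' t) (transition c d) (x t)"
    have eq: "snd d \<circ> (chart_inv c \<circ> x) = transition c d \<circ> x" by (simp add: transition_def o_assoc)
    have D: "((snd d \<circ> (chart_inv c \<circ> x)) has_vector_derivative ?v t) (at t within {a..b})" if "t \<in> ?T" for t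
      unfolding eq
      by (rule vector_derivative_diff_chain_within[OF x'(1)])
        (use that O smooth_on_has_derivative[OF transition_smooth[OF c d]] has_derivative_at_withinI in blast)+
    have vd: "vector_derivative (snd d \<circ> (chart_inv c \<circ> x)) (at t within {a..b}) = ?v t" if "t \<in> ?T" for t
      using vector_derivative_within_closed_interval[OF \<open>a < b\<close> _ D[OF that]] that by blast
    have "continuous_on ?T (\<lambda>t. \<Sum>i\<in>UNIV. (x' t $ i) *\<^sub>R dir_deriv (axis i 1) (transition c d) (x t))"
    proof (intro continuous_on_sum continuous_on_scaleR)
      have sub: "?T \<subseteq> {a..b}" by auto
      fix i
      show "continuous_on ?T (\<lambda>t. x' t $ i)"
        using continuous_on_subset[OF x'(2) sub] by (intro continuous_intros)
      show "continuous_on ?T (\<lambda>t. dir_deriv (axis i 1) (transition c d) (x t))"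
        using continuous_on_compose2[OF smooth_on_imp_continuous_on[OF smooth_on_dir_deriv[OF transition_smooth[OF c d]]]
            continuous_on_subset[OF cx sub]] O by blast
    qed
    then have "continuous_on ?T (\<lambda>t. vector_derivative (snd d \<circ> (chart_inv c \<circ> x)) (at t within {a..b}))"
      by (rule continuous_on_eq)
        (use vd O dir_deriv_axis[OF smooth_on_differentiable[OF transition_smooth[OF c d]]] in auto)
    moreover have "(snd d \<circ> (chart_inv c \<circ> x)) differentiable (at t within {a..b})" if "t \<in> ?T" for t
      using D[OF that] by (auto simp: has_vector_derivative_def differentiable_def)
    ultimately show ?thesis by blast
  qed
  ultimately show ?thesis by (simp add: C1_curve_on_def)
qed

lemma speed_norm:
  "speed \<gamma> t = norm (dir_deriv (vector_derivative (snd (chart_at \<A> (\<gamma> t)) \<circ> \<gamma>) (at t))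
    (f \<circ> chart_inv (chart_at \<A> (\<gamma> t))) (snd (chart_at \<A> (\<gamma> t)) (\<gamma> t)))"
proof -
  let ?c = "chart_at \<A> (\<gamma> t)"
  interpret hypersurface_metric "chart_image ?c" "f \<circ> chart_inv ?c" "\<xi> \<circ> chart_inv ?c" "g ?c"
    by (rule patch[OF chart_at(1)])
  have "snd ?c (\<gamma> t) \<in> chart_image ?c" by (rule chart_maps(1)[OF chart_at])
  then show ?thesis by (simp add: curve_speed_def Let_def norm_eq_sqrt_inner first_ff)
qed

lemma speed_nonneg: "0 \<le> speed \<gamma> t"
  unfolding speed_norm by simp

text \<open>
  The image of a curve under \<open>f\<close> is a \<open>C\<^sup>1\<close> curve in Euclidean space whose speed is the Riemannian one.
  Charts enter the study of lengths only here.  The two endpoints are excluded in the last claim, because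
  \<open>curve_speed\<close> uses two-sided derivatives.
\<close>

lemma C1_image_curve:
  assumes "a < b" and C1: "C1_curve_on \<A> a b \<gamma>"
  obtains F' where "continuous_on {a..b} F'"
    "\<And>t. t \<in> {a..b} \<Longrightarrow> ((f \<circ> \<gamma>) has_vector_derivative F' t) (at t within {a..b})"
    "\<And>t. t \<in> {a<..<b} \<Longrightarrow> speed \<gamma> t = norm (F' t)"
proof -
  define F' where "F' t = vector_derivative (f \<circ> \<gamma>) (at t within {a..b})" for t
  have cont: "continuous_on {a..b} \<gamma>" using C1 by (simp add: C1_curve_on_def)
  have loc: "((f \<circ> \<gamma>) has_vector_derivative F' t) (at t within {a..b}) \<and> continuous (at t within {a..b}) F' \<and>
      F' t = dir_deriv (vector_derivative (snd c \<circ> \<gamma>) (at t within {a..b})) (f \<circ> chart_inv c) (snd c (\<gamma> t))"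
    if t: "t \<in> {a..b}" and c: "c \<in> \<A>" "\<gamma> t \<in> fst c" for t c
  proof -
    let ?T = "{t\<in>{a..b}. \<gamma> t \<in> fst c}" and ?X = "f \<circ> chart_inv c"
    obtain Op where O: "open Op" "Op \<inter> {a..b} = ?T"
    proof -
      have "openin (top_of_set {a..b}) ({a..b} \<inter> \<gamma> -` fst c)"
        using continuous_openin_preimage_gen[OF cont chart(1)[OF c(1)]] .
      then obtain Op where "open Op" "{a..b} \<inter> \<gamma> -` fst c = {a..b} \<inter> Op" by (auto simp: openin_open)
      moreover have "{a..b} \<inter> \<gamma> -` fst c = ?T" by auto
      ultimately show ?thesis using that[of Op] by (simp add: Int_commute)
    qed
    let ?v = "\<lambda>s. vector_derivative (snd c \<circ> \<gamma>) (at s within {a..b})"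
    let ?D = "\<lambda>s. dir_deriv (?v s) ?X (snd c (\<gamma> s))"
    have smX: "smooth_on (chart_image c) ?X" by (rule smooth_chart(1)[OF c(1)])
    have xin: "snd c (\<gamma> s) \<in> chart_image c" if "s \<in> ?T" for s using chart_maps(1)[OF c(1)] that by auto
    have v: "((snd c \<circ> \<gamma>) has_vector_derivative ?v s) (at s within {a..b})" if "s \<in> ?T" for s
      using C1 c(1) that unfolding C1_curve_on_def vector_derivative_works[symmetric] by blast
    have D: "((f \<circ> \<gamma>) has_vector_derivative ?D s) (at s within {a..b})" if s: "s \<in> ?T" for s
    proof -
      have "(?X \<circ> (snd c \<circ> \<gamma>) has_vector_derivative ?D s) (at s within {a..b})"
        using vector_derivative_diff_chain_within[OF v[OF s] has_derivative_at_withinI]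
          smooth_on_has_derivative[OF smX xin[OF s]] by simp
      then have XD: "(?X \<circ> (snd c \<circ> \<gamma>) has_vector_derivative ?D s) (at s within {a..b})" by simp
      obtain \<delta> where \<delta>: "\<delta> > 0" "ball s \<delta> \<subseteq> Op" using O s open_contains_ball by blast
      show ?thesis
      proof (rule has_vector_derivative_transform_within[OF XD \<delta>(1)])
        show "s \<in> {a..b}" using s by simp
        fix s' assume "s' \<in> {a..b}" "dist s' s < \<delta>"
        then have "s' \<in> Op \<inter> {a..b}" using \<delta>(2) by (auto simp: dist_commute)
        then have "s' \<in> ?T" unfolding O(2) .
        then show "(?X \<circ> (snd c \<circ> \<gamma>)) s' = (f \<circ> \<gamma>) s'" using chart_maps(2)[OF c(1)] by simp
      qed
    qed
    have F: "F' s = ?D s" if "s \<in> ?T" for s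
      unfolding F'_def using vector_derivative_within_closed_interval[OF \<open>a < b\<close> _ D[OF that]] that by blast
    have "continuous_on ?T (\<lambda>s. \<Sum>i\<in>UNIV. (?v s $ i) *\<^sub>R dir_deriv (axis i 1) ?X (snd c (\<gamma> s)))"
    proof (intro continuous_on_sum continuous_on_scaleR)
      fix i
      have "continuous_on ?T ?v" using C1 c(1) by (simp add: C1_curve_on_def)
      then show "continuous_on ?T (\<lambda>s. ?v s $ i)" by (intro continuous_intros)
      have "continuous_on ?T (\<lambda>s. snd c (\<gamma> s))"
        by (rule continuous_on_compose2[OF chart_maps(5)[OF c(1)] continuous_on_subset[OF cont]]) auto
      then show "continuous_on ?T (\<lambda>s. dir_deriv (axis i 1) ?X (snd c (\<gamma> s)))"
        by (rule continuous_on_compose2[OF smooth_on_imp_continuous_on[OF smooth_on_dir_deriv[OF smX]]]) (use xin in auto)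
    qed
    then have "continuous_on ?T F'"
      by (rule continuous_on_eq) (use F xin dir_deriv_axis[OF smooth_on_differentiable[OF smX]] in auto)
    moreover have tT: "t \<in> ?T" using t c by simp
    ultimately have "continuous (at t within ?T) F'" by (auto simp: continuous_on_eq_continuous_within)
    moreover have "at t within ?T = at t within {a..b}"
      by (rule at_within_nhd[of t Op]) (use O tT in auto)
    ultimately show ?thesis using D[OF tT] F[OF tT] by simp
  qed
  show ?thesis
  proof
    show "continuous_on {a..b} F'"
      unfolding continuous_on_eq_continuous_within using loc chart_at by blast
    show "((f \<circ> \<gamma>) has_vector_derivative F' t) (at t within {a..b})" if "t \<in> {a..b}" for t
      using loc that chart_at by blast
    show "speed \<gamma> t = norm (F' t)" if t: "t \<in> {a<..<b}" for t
      using loc[OF _ chart_at, of t] t at_within_Icc_at[of a t b] by (simp add: speed_norm)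
  qed
qed

text \<open>
  Reversing and concatenating curves reparametrizes them; the new curve has to agree with the old one on the
  interval in question only.
\<close>

lemma C1_affine:
  assumes "a < b" "a' < b'" and C1: "C1_curve_on \<A> a b \<gamma>" and "m \<noteq> 0"
    and into: "\<And>t. t \<in> {a'..b'} \<Longrightarrow> m * t + k \<in> {a..b}"
    and \<gamma>': "\<And>t. t \<in> {a'..b'} \<Longrightarrow> \<gamma>' t = \<gamma> (m * t + k)"
  shows "C1_curve_on \<A> a' b' \<gamma>'"
    "\<And>t. t \<in> {a'<..<b'} \<Longrightarrow> m * t + k \<in> {a<..<b} \<Longrightarrow> speed \<gamma>' t = \<bar>m\<bar> * speed \<gamma> (m * t + k)"
proof -
  have chain: "(h' has_vector_derivative m *\<^sub>R D) (at t within {a'..b'})"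
    if "(h has_vector_derivative D) (at (m * t + k) within {a..b})" "t \<in> {a'..b'}" "\<And>t. t \<in> {a'..b'} \<Longrightarrow> h' t = h (m * t + k)"
    for h h' :: "real \<Rightarrow> 'v::real_normed_vector" and D t
  proof -
    have "((\<lambda>t. m * t + k) has_vector_derivative m) (at t within {a'..b'})"
      by (auto intro!: derivative_eq_intros simp: has_vector_derivative_def)
    moreover have "(h has_vector_derivative D) (at (m * t + k) within (\<lambda>t. m * t + k) ` {a'..b'})"
      by (rule has_vector_derivative_within_subset[OF that(1)]) (use into in auto)
    ultimately have "(h \<circ> (\<lambda>t. m * t + k) has_vector_derivative m *\<^sub>R D) (at t within {a'..b'})"
      by (rule vector_diff_chain_within)
    then show ?thesis by (rule has_vector_derivative_transform[OF that(2), rotated]) (simp add: that(3))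
  qed
  have cm: "continuous_on S (\<lambda>t. m * t + k)" for S :: "real set" by (intro continuous_intros)
  show C1': "C1_curve_on \<A> a' b' \<gamma>'"
    unfolding C1_curve_on_def
  proof (intro conjI ballI impI)
    have "continuous_on {a'..b'} (\<lambda>t. \<gamma> (m * t + k))"
      by (rule continuous_on_compose2[OF _ cm]) (use C1 into in \<open>auto simp: C1_curve_on_def\<close>)
    then show "continuous_on {a'..b'} \<gamma>'" by (rule continuous_on_eq) (simp add: \<gamma>')
    fix c assume c: "c \<in> \<A>"
    let ?v = "\<lambda>s. vector_derivative (snd c \<circ> \<gamma>) (at s within {a..b})"
    have D: "((snd c \<circ> \<gamma>') has_vector_derivative m *\<^sub>R ?v (m * t + k)) (at t within {a'..b'})"
      if "t \<in> {a'..b'}" "\<gamma>' t \<in> fst c" for t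
    proof (rule chain[OF _ that(1)])
      have "(snd c \<circ> \<gamma>) differentiable (at (m * t + k) within {a..b})"
        using C1 c that(2) into[OF that(1)] \<gamma>'[OF that(1)] by (simp add: C1_curve_on_def)
      then show "((snd c \<circ> \<gamma>) has_vector_derivative ?v (m * t + k)) (at (m * t + k) within {a..b})"
        by (simp add: vector_derivative_works)
    qed (simp add: \<gamma>')
    show "(snd c \<circ> \<gamma>') differentiable (at t within {a'..b'})" if "t \<in> {a'..b'}" "\<gamma>' t \<in> fst c" for t
      using D[OF that] by (auto simp: has_vector_derivative_def differentiable_def)
    let ?T = "{t\<in>{a'..b'}. \<gamma>' t \<in> fst c}"
    have "continuous_on {s\<in>{a..b}. \<gamma> s \<in> fst c} ?v" using C1 c by (simp add: C1_curve_on_def)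
    then have "continuous_on ?T (\<lambda>t. ?v (m * t + k))"
      by (rule continuous_on_compose2[OF _ cm]) (use into \<gamma>' in auto)
    then have "continuous_on ?T (\<lambda>t. m *\<^sub>R ?v (m * t + k))" by (intro continuous_intros)
    then show "continuous_on ?T (\<lambda>t. vector_derivative (snd c \<circ> \<gamma>') (at t within {a'..b'}))"
      by (rule continuous_on_eq)
        (use vector_derivative_within_closed_interval[OF \<open>a' < b'\<close> _ D] in auto)
  qed
  obtain F where F: "\<And>t. t \<in> {a..b} \<Longrightarrow> ((f \<circ> \<gamma>) has_vector_derivative F t) (at t within {a..b})"
    "\<And>t. t \<in> {a<..<b} \<Longrightarrow> speed \<gamma> t = norm (F t)" using C1_image_curve[OF assms(1) C1] by metis
  obtain F' where F': "\<And>t. t \<in> {a'..b'} \<Longrightarrow> ((f \<circ> \<gamma>') has_vector_derivative F' t) (at t within {a'..b'})"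
    "\<And>t. t \<in> {a'<..<b'} \<Longrightarrow> speed \<gamma>' t = norm (F' t)" using C1_image_curve[OF assms(2) C1'] by metis
  show "speed \<gamma>' t = \<bar>m\<bar> * speed \<gamma> (m * t + k)" if t: "t \<in> {a'<..<b'}" "m * t + k \<in> {a<..<b}" for t
  proof -
    have t': "t \<in> {a'..b'}" "m * t + k \<in> {a..b}" using t by auto
    have "((f \<circ> \<gamma>') has_vector_derivative m *\<^sub>R F (m * t + k)) (at t within {a'..b'})"
      by (rule chain[OF F(1)[OF t'(2)] t'(1)]) (simp add: \<gamma>')
    then have "F' t = m *\<^sub>R F (m * t + k)"
      using F'(1)[OF t'(1)] vector_derivative_within_closed_interval[OF assms(2) t'(1)] by metis
    then show ?thesis using F(2)[OF t(2)] F'(2)[OF t(1)] by simp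
  qed
qed

text \<open>
  Describing the subdivision inductively makes facts about lengths provable by induction instead of by
  manipulating break points.
\<close>

inductive piecewise_C1 :: "real \<Rightarrow> real \<Rightarrow> (real \<Rightarrow> 'm) \<Rightarrow> bool" where
  single: "a < b \<Longrightarrow> C1_curve_on \<A> a b \<gamma> \<Longrightarrow> piecewise_C1 a b \<gamma>"
| join: "piecewise_C1 a b \<gamma> \<Longrightarrow> piecewise_C1 b c \<gamma> \<Longrightarrow> piecewise_C1 a c \<gamma>"

lemma piecewise_C1_less: "piecewise_C1 a b \<gamma> \<Longrightarrow> a < b"
  by (induction rule: piecewise_C1.induct) auto

lemma piecewise_C1_iff: "piecewise_C1 0 1 \<gamma> \<longleftrightarrow> piecewise_C1_curve \<A> \<gamma>"
proof
  have "\<exists>(k::nat) \<tau>. \<tau> 0 = a \<and> \<tau> k = b \<and> (\<forall>i<k. \<tau> i < \<tau> (Suc i) \<and> C1_curve_on \<A> (\<tau> i) (\<tau> (Suc i)) \<gamma>)"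
    if "piecewise_C1 a b \<gamma>" for a b
    using that
  proof (induction rule: piecewise_C1.induct)
    case (single a b \<gamma>)
    then show ?case by (intro exI[of _ 1] exI[of _ "\<lambda>i. if i = 0 then a else b"]) auto
  next
    case (join a b \<gamma> c)
    obtain k \<tau> where k: "\<tau> 0 = a" "\<tau> k = b" "\<And>i. i < k \<Longrightarrow> \<tau> i < \<tau> (Suc i) \<and> C1_curve_on \<A> (\<tau> i) (\<tau> (Suc i)) \<gamma>"
      using join.IH(1) by blast
    obtain k' \<tau>' where k': "\<tau>' 0 = b" "\<tau>' k' = c" "\<And>i. i < k' \<Longrightarrow> \<tau>' i < \<tau>' (Suc i) \<and> C1_curve_on \<A> (\<tau>' i) (\<tau>' (Suc i)) \<gamma>"
      using join.IH(2) by blast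
    let ?\<tau> = "\<lambda>i. if i \<le> k then \<tau> i else \<tau>' (i - k)"
    have *: "?\<tau> i = \<tau>' (i - k)" if "k \<le> i" for i using that k k' by (cases "i = k") auto
    have "?\<tau> i < ?\<tau> (Suc i) \<and> C1_curve_on \<A> (?\<tau> i) (?\<tau> (Suc i)) \<gamma>" if "i < k + k'" for i
    proof (cases "i < k")
      case False
      then show ?thesis using k'(3)[of "i - k"] that *[of i] *[of "Suc i"] by (simp add: Suc_diff_le)
    qed (use k in auto)
    moreover have "?\<tau> (k + k') = c" using *[of "k + k'"] k' by simp
    ultimately show ?case using k(1) by (intro exI[of _ "k + k'"] exI[of _ ?\<tau>]) auto
  qed
  then show "piecewise_C1_curve \<A> \<gamma>" if "piecewise_C1 0 1 \<gamma>" using that unfolding piecewise_C1_curve_def by blast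
next
  assume "piecewise_C1_curve \<A> \<gamma>"
  then obtain k :: nat and \<tau> where \<tau>: "\<tau> 0 = 0" "\<tau> k = 1"
    "\<And>i. i < k \<Longrightarrow> \<tau> i < \<tau> (Suc i) \<and> C1_curve_on \<A> (\<tau> i) (\<tau> (Suc i)) \<gamma>"
    unfolding piecewise_C1_curve_def by blast
  have "j < k \<Longrightarrow> piecewise_C1 0 (\<tau> (Suc j)) \<gamma>" for j
  proof (induction j)
    case 0
    then show ?case using \<tau>(1) \<tau>(3)[of 0] by (auto intro: piecewise_C1.single)
  next
    case (Suc j)
    then show ?case using \<tau>(3)[of "Suc j"] by (auto intro: piecewise_C1.join piecewise_C1.single)
  qed
  moreover have "k \<noteq> 0" using \<tau>(1,2) by (metis zero_neq_one)
  ultimately show "piecewise_C1 0 1 \<gamma>" using \<tau>(2) by (metis Suc_pred' lessI neq0_conv)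
qed

lemma C1_integral:
  assumes "a < b" "C1_curve_on \<A> a b \<gamma>"
  shows "speed \<gamma> integrable_on {a..b}"
    "t \<in> {a..b} \<Longrightarrow> norm (f (\<gamma> t) - f (\<gamma> a)) \<le> integral {a..t} (speed \<gamma>)"
proof -
  obtain F' where F': "continuous_on {a..b} F'"
    "\<And>t. t \<in> {a..b} \<Longrightarrow> ((f \<circ> \<gamma>) has_vector_derivative F' t) (at t within {a..b})"
    "\<And>t. t \<in> {a<..<b} \<Longrightarrow> speed \<gamma> t = norm (F' t)" using C1_image_curve[OF assms] by metis
  have I: "(\<lambda>t. norm (F' t)) integrable_on {a..b}"
    by (intro integrable_continuous_real continuous_on_norm F'(1))
  show "speed \<gamma> integrable_on {a..b}"
    by (rule integrable_spike_finite[OF _ _ I, of "{a,b}"]) (use F'(3) in auto)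
  assume t: "t \<in> {a..b}"
  have It: "(\<lambda>t. norm (F' t)) integrable_on {a..t}" by (rule integrable_subinterval_real[OF I]) (use t in auto)
  have "(F' has_integral ((f \<circ> \<gamma>) t - (f \<circ> \<gamma>) a)) {a..t}"
  proof (rule fundamental_theorem_of_calculus)
    show "a \<le> t" using t by simp
    show "((f \<circ> \<gamma>) has_vector_derivative F' s) (at s within {a..t})" if "s \<in> {a..t}" for s
      by (rule has_vector_derivative_within_subset[OF F'(2)]) (use t that in auto)
  qed
  moreover have "((\<lambda>t. norm (F' t)) has_integral integral {a..t} (speed \<gamma>)) {a..t}"
  proof -
    have "integral {a..t} (\<lambda>t. norm (F' t)) = integral {a..t} (speed \<gamma>)"
      by (rule integral_spike[of "{a,b}"]) (use F'(3) t in auto)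
    then show ?thesis using It by (metis has_integral_integrable_integral)
  qed
  ultimately show "norm (f (\<gamma> t) - f (\<gamma> a)) \<le> integral {a..t} (speed \<gamma>)"
    using has_integral_norm_bound_integral_component[of F' _ "{a..t}"] 
    by (metis (no_types, lifting) comp_apply has_integral_integrable_integral integral_norm_bound_integral order_refl)
qed

lemma piecewise_C1_integral:
  assumes "piecewise_C1 a b \<gamma>"
  shows "speed \<gamma> integrable_on {a..b}"
    "t \<in> {a..b} \<Longrightarrow> norm (f (\<gamma> t) - f (\<gamma> a)) \<le> integral {a..t} (speed \<gamma>)"
proof -
  have "speed \<gamma> integrable_on {a..b} \<and> (\<forall>t\<in>{a..b}. norm (f (\<gamma> t) - f (\<gamma> a)) \<le> integral {a..t} (speed \<gamma>))"
    using assms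
  proof (induction rule: piecewise_C1.induct)
    case (single a b \<gamma>)
    then show ?case using C1_integral by blast
  next
    case (join a b \<gamma> c)
    have less: "a < b" "b < c" using join.hyps piecewise_C1_less by auto
    have I: "speed \<gamma> integrable_on {a..c}"
      using Henstock_Kurzweil_Integration.integrable_combine[OF less_imp_le[OF less(1)] less_imp_le[OF less(2)]] join.IH by blast
    have "norm (f (\<gamma> t) - f (\<gamma> a)) \<le> integral {a..t} (speed \<gamma>)" if t: "t \<in> {a..c}" for t
    proof (cases "t \<le> b")
      case False
      have It: "speed \<gamma> integrable_on {a..t}" by (rule integrable_subinterval_real[OF I]) (use t in auto)
      have "norm (f (\<gamma> t) - f (\<gamma> a)) \<le> norm (f (\<gamma> t) - f (\<gamma> b)) + norm (f (\<gamma> b) - f (\<gamma> a))"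
        using norm_triangle_ineq[of "f (\<gamma> t) - f (\<gamma> b)" "f (\<gamma> b) - f (\<gamma> a)"] by simp
      also have "\<dots> \<le> integral {b..t} (speed \<gamma>) + integral {a..b} (speed \<gamma>)"
        using join.IH t False less by (intro add_mono) auto
      also have "\<dots> = integral {a..t} (speed \<gamma>)"
        using Henstock_Kurzweil_Integration.integral_combine[OF _ _ It, of b] less False by simp
      finally show ?thesis .
    qed (use join.IH t in auto)
    then show ?case using I by blast
  qed
  then show "speed \<gamma> integrable_on {a..b}"
    "t \<in> {a..b} \<Longrightarrow> norm (f (\<gamma> t) - f (\<gamma> a)) \<le> integral {a..t} (speed \<gamma>)" by blast+
qed

lemma piecewise_C1_affine:
  assumes "piecewise_C1 a b \<gamma>" "m > 0" "(speed \<gamma> has_integral I) {a..b}"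
    and "\<And>t. t \<in> {(a - k) / m..(b - k) / m} \<Longrightarrow> \<gamma>' t = \<gamma> (m * t + k)"
  shows "piecewise_C1 ((a - k) / m) ((b - k) / m) \<gamma>' \<and> (speed \<gamma>' has_integral I) {(a - k) / m..(b - k) / m}"
  using assms
proof (induction arbitrary: I rule: piecewise_C1.induct)
  case (single a b \<gamma>)
  have into: "m * t + k \<in> {a..b} \<longleftrightarrow> t \<in> {(a - k) / m..(b - k) / m}"
    "m * t + k \<in> {a<..<b} \<longleftrightarrow> t \<in> {(a - k) / m<..<(b - k) / m}" for t
    using \<open>m > 0\<close> by (auto simp: field_simps)
  have less: "(a - k) / m < (b - k) / m" using single \<open>m > 0\<close> by (simp add: divide_strict_right_mono)
  have C1: "C1_curve_on \<A> ((a - k) / m) ((b - k) / m) \<gamma>'"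
    and sp: "\<And>t. t \<in> {(a - k) / m<..<(b - k) / m} \<Longrightarrow> m * t + k \<in> {a<..<b} \<Longrightarrow> speed \<gamma>' t = \<bar>m\<bar> * speed \<gamma> (m * t + k)"
    using C1_affine[OF single(1) less single(2), of m k \<gamma>'] \<open>m > 0\<close> into single(5) by auto
  have "((\<lambda>t. speed \<gamma> (m * t + k)) has_integral I / m) {(a - k) / m..(b - k) / m}"
    using has_integral_affinity'[of "speed \<gamma>" I a b m k] single(4) \<open>m > 0\<close> by (simp add: divide_inverse mult.commute)
  then have "((\<lambda>t. m * speed \<gamma> (m * t + k)) has_integral m * (I / m)) {(a - k) / m..(b - k) / m}"
    by (rule has_integral_mult_right)
  then have "(speed \<gamma>' has_integral m * (I / m)) {(a - k) / m..(b - k) / m}"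
    by (rule has_integral_spike_finite[of "{(a - k) / m, (b - k) / m}", rotated 2])
      (use sp into \<open>m > 0\<close> in auto)
  then show ?case using C1 less \<open>m > 0\<close> by (auto intro: piecewise_C1.single)
next
  case (join a b \<gamma> c)
  have less: "a < b" "b < c" using join.hyps piecewise_C1_less by auto
  then have less': "(a - k) / m < (b - k) / m" "(b - k) / m < (c - k) / m"
    using \<open>m > 0\<close> by (simp_all add: divide_strict_right_mono)
  obtain J K where JK: "(speed \<gamma> has_integral J) {a..b}" "(speed \<gamma> has_integral K) {b..c}"
    using piecewise_C1_integral(1)[OF join.hyps(1)] piecewise_C1_integral(1)[OF join.hyps(2)] by blast
  have "(speed \<gamma> has_integral (J + K)) {a..c}" using has_integral_combine[OF _ _ JK] less by simp
  then have "J + K = I" using join.prems(2) has_integral_unique by blast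
  have 1: "piecewise_C1 ((a - k) / m) ((b - k) / m) \<gamma>'" "(speed \<gamma>' has_integral J) {(a - k) / m..(b - k) / m}"
    using join.IH(1)[OF join.prems(1) JK(1)] join.prems(3) less' by auto
  have 2: "piecewise_C1 ((b - k) / m) ((c - k) / m) \<gamma>'" "(speed \<gamma>' has_integral K) {(b - k) / m..(c - k) / m}"
    using join.IH(2)[OF join.prems(1) JK(2)] join.prems(3) less' by auto
  have "(speed \<gamma>' has_integral (J + K)) {(a - k) / m..(c - k) / m}"
    using has_integral_combine[OF _ _ 1(2) 2(2)] less' by simp
  then show ?case using piecewise_C1.join[OF 1(1) 2(1)] \<open>J + K = I\<close> by simp
qed

lemma piecewise_C1_reflect:
  assumes "piecewise_C1 a b \<gamma>" "(speed \<gamma> has_integral I) {a..b}"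
  shows "piecewise_C1 (- b) (- a) (\<lambda>t. \<gamma> (- t)) \<and> (speed (\<lambda>t. \<gamma> (- t)) has_integral I) {- b..- a}"
  using assms
proof (induction arbitrary: I rule: piecewise_C1.induct)
  case (single a b \<gamma>)
  have C1: "C1_curve_on \<A> (- b) (- a) (\<lambda>t. \<gamma> (- t))"
    and sp: "\<And>t. t \<in> {- b<..<- a} \<Longrightarrow> speed (\<lambda>t. \<gamma> (- t)) t = speed \<gamma> (- t)"
    using C1_affine[OF single(1) _ single(2), of "- b" "- a" "- 1" 0 "\<lambda>t. \<gamma> (- t)"] single(1) by auto
  have "((\<lambda>t. speed \<gamma> (- t)) has_integral I) {- b..- a}" using single(3) by simp
  then have "(speed (\<lambda>t. \<gamma> (- t)) has_integral I) {- b..- a}"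
    by (rule has_integral_spike_finite[of "{- b, - a}", rotated 2]) (use sp in auto)
  then show ?case using C1 single(1) by (auto intro: piecewise_C1.single)
next
  case (join a b \<gamma> c)
  have less: "a < b" "b < c" using join.hyps piecewise_C1_less by auto
  obtain J K where JK: "(speed \<gamma> has_integral J) {a..b}" "(speed \<gamma> has_integral K) {b..c}"
    using piecewise_C1_integral(1)[OF join.hyps(1)] piecewise_C1_integral(1)[OF join.hyps(2)] by blast
  have "(speed \<gamma> has_integral (J + K)) {a..c}" using has_integral_combine[OF _ _ JK] less by simp
  then have I: "I = K + J" using has_integral_unique[OF join.prems] by simp
  have 1: "piecewise_C1 (- b) (- a) (\<lambda>t. \<gamma> (- t))" "(speed (\<lambda>t. \<gamma> (- t)) has_integral J) {- b..- a}"
    using join.IH(1)[OF JK(1)] by auto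
  have 2: "piecewise_C1 (- c) (- b) (\<lambda>t. \<gamma> (- t))" "(speed (\<lambda>t. \<gamma> (- t)) has_integral K) {- c..- b}"
    using join.IH(2)[OF JK(2)] by auto
  show ?case unfolding I using piecewise_C1.join[OF 2(1) 1(1)] has_integral_combine[OF _ _ 2(2) 1(2)] less by simp
qed

end

context immersed_hypersurface
begin

text \<open>
  Only the end points and the length of a curve are kept, so that reversing and concatenating curves become
  symmetry and additivity of a relation.
\<close>

definition joins :: "'m \<Rightarrow> 'm \<Rightarrow> real \<Rightarrow> bool" where
  "joins p q L \<longleftrightarrow> (\<exists>\<gamma>. piecewise_C1 0 1 \<gamma> \<and> \<gamma> 0 = p \<and> \<gamma> 1 = q \<and> (speed \<gamma> has_integral L) {0..1})"

lemma riemannian_dist_joins: "riemannian_dist \<A> g p q = Inf {L. joins p q L}"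
proof -
  have "{curve_length \<A> g \<gamma> |\<gamma>. piecewise_C1_curve \<A> \<gamma> \<and> \<gamma> 0 = p \<and> \<gamma> 1 = q} = {L. joins p q L}"
    unfolding joins_def piecewise_C1_iff[symmetric] curve_length_def
    using piecewise_C1_integral(1) by (auto simp: has_integral_integrable_integral) 
  then show ?thesis by (simp add: riemannian_dist_def)
qed

lemma joins_sym:
  assumes "joins p q L"
  shows "joins q p L"
proof -
  obtain \<gamma> where \<gamma>: "piecewise_C1 0 1 \<gamma>" "\<gamma> 0 = p" "\<gamma> 1 = q" "(speed \<gamma> has_integral L) {0..1}"
    using assms unfolding joins_def by blast
  have 1: "piecewise_C1 (- 1) 0 (\<lambda>t. \<gamma> (- t))" "(speed (\<lambda>t. \<gamma> (- t)) has_integral L) {- 1..0}"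
    using piecewise_C1_reflect[OF \<gamma>(1,4)] by auto
  have "piecewise_C1 0 1 (\<lambda>t. \<gamma> (1 - t)) \<and> (speed (\<lambda>t. \<gamma> (1 - t)) has_integral L) {0..1}"
    using piecewise_C1_affine[OF 1(1) _ 1(2), of 1 "- 1" "\<lambda>t. \<gamma> (1 - t)"] by simp
  then show ?thesis unfolding joins_def using \<gamma>(2,3) by (intro exI[of _ "\<lambda>t. \<gamma> (1 - t)"]) simp
qed

lemma joins_trans:
  assumes "joins p q L" "joins q r L'"
  shows "joins p r (L + L')"
proof -
  obtain \<gamma> where \<gamma>: "piecewise_C1 0 1 \<gamma>" "\<gamma> 0 = p" "\<gamma> 1 = q" "(speed \<gamma> has_integral L) {0..1}"
    using assms(1) unfolding joins_def by blast
  obtain \<gamma>' where \<gamma>': "piecewise_C1 0 1 \<gamma>'" "\<gamma>' 0 = q" "\<gamma>' 1 = r" "(speed \<gamma>' has_integral L') {0..1}"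
    using assms(2) unfolding joins_def by blast
  define \<eta> where "\<eta> t = (if t \<le> 1/2 then \<gamma> (2 * t) else \<gamma>' (2 * t - 1))" for t
  have 1: "piecewise_C1 0 (1/2) \<eta>" "(speed \<eta> has_integral L) {0..1/2}"
    using piecewise_C1_affine[OF \<gamma>(1) _ \<gamma>(4), of 2 0 \<eta>] by (auto simp: \<eta>_def)
  have 2: "piecewise_C1 (1/2) 1 \<eta>" "(speed \<eta> has_integral L') {1/2..1}"
  proof -
    have "\<eta> t = \<gamma>' (2 * t + - 1)" if "t \<in> {1/2..1}" for t
    proof (cases "t = 1/2")
      case True
      show ?thesis unfolding True using \<gamma>(3) \<gamma>'(2) by (simp add: \<eta>_def)
    qed (use that in \<open>auto simp: \<eta>_def\<close>)
    then show "piecewise_C1 (1/2) 1 \<eta>" "(speed \<eta> has_integral L') {1/2..1}"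
      using piecewise_C1_affine[OF \<gamma>'(1) _ \<gamma>'(4), of 2 "- 1" \<eta>] by auto
  qed
  have "(speed \<eta> has_integral (L + L')) {0..1}" using has_integral_combine[OF _ _ 1(2) 2(2)] by simp
  moreover have "piecewise_C1 0 1 \<eta>" by (rule piecewise_C1.join[OF 1(1) 2(1)])
  moreover have "\<eta> 0 = p" "\<eta> 1 = r" using \<gamma>(2) \<gamma>'(3) by (simp_all add: \<eta>_def)
  ultimately show ?thesis unfolding joins_def by blast
qed

lemma joins_near:
  assumes "joins p q L"
  obtains \<gamma> :: "real \<Rightarrow> 'm" where "continuous_on {0..1} \<gamma>" "\<gamma> 0 = p" "\<gamma> 1 = q" "\<And>t. t \<in> {0..1} \<Longrightarrow> norm (f (\<gamma> t) - f p) \<le> L"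
proof -
  obtain \<gamma> where \<gamma>: "piecewise_C1 0 1 \<gamma>" "\<gamma> 0 = p" "\<gamma> 1 = q" "(speed \<gamma> has_integral L) {0..1}"
    using assms unfolding joins_def by blast
  have cont: "continuous_on {a..b} \<gamma>" if "piecewise_C1 a b \<gamma>" for a b \<gamma>
    using that
  proof (induction rule: piecewise_C1.induct)
    case (single a b \<gamma>)
    then show ?case by (simp add: C1_curve_on_def)
  next
    case (join a b \<gamma> c)
    then have "continuous_on ({a..b} \<union> {b..c}) \<gamma>" by (intro continuous_on_closed_Un) auto
    moreover have "{a..b} \<union> {b..c} = {a..c}"
      using piecewise_C1_less[OF join.hyps(1)] piecewise_C1_less[OF join.hyps(2)] by (intro ivl_disj_un_two_touch) auto
    ultimately show ?case by simp
  qed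
  have "norm (f (\<gamma> t) - f p) \<le> L" if t: "t \<in> {0..1}" for t
  proof -
    have I: "speed \<gamma> integrable_on {0..1}" using \<gamma>(4) by blast
    have I': "speed \<gamma> integrable_on {0..t}" "speed \<gamma> integrable_on {t..1}"
      by (rule integrable_subinterval_real[OF I]; use t in auto)+
    have "norm (f (\<gamma> t) - f p) \<le> integral {0..t} (speed \<gamma>)" using piecewise_C1_integral(2)[OF \<gamma>(1) t] \<gamma>(2) by simp
    also have "\<dots> \<le> integral {0..t} (speed \<gamma>) + integral {t..1} (speed \<gamma>)"
      using integral_nonneg[OF I'(2)] speed_nonneg by simp
    also have "\<dots> = L" using Henstock_Kurzweil_Integration.integral_combine[OF _ _ I, of t] t \<gamma>(4)
      by (simp add: integral_unique)
    finally show ?thesis .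
  qed
  then show ?thesis using that[OF cont[OF \<gamma>(1)] \<gamma>(2,3)] by blast
qed

lemma joins_ge: "joins p q L \<Longrightarrow> norm (f q - f p) \<le> L"
  using joins_near[of p q L] by (metis atLeastAtMost_iff order_refl zero_le_one)

text \<open>The speed of a curve is that of its image under \<open>f\<close>, which is explicit when lengths have to be estimated.\<close>

lemma joins_chart_curve:
  assumes c: "c \<in> \<A>" and x: "\<And>t. t \<in> {0..1} \<Longrightarrow> x t \<in> chart_image c"
    and x': "\<And>t. t \<in> {0..1} \<Longrightarrow> (x has_vector_derivative x' t) (at t within {0..1})" "continuous_on {0..1} x'"
    and D: "\<And>t. t \<in> {0..1} \<Longrightarrow> ((\<lambda>t. f (chart_inv c (x t))) has_vector_derivative D t) (at t within {0..1})"
    and K: "\<And>t. t \<in> {0..1} \<Longrightarrow> norm (D t) \<le> K"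
  obtains L where "joins (chart_inv c (x 0)) (chart_inv c (x 1)) L" "L \<le> K"
proof -
  let ?\<gamma> = "chart_inv c \<circ> x"
  have C1: "C1_curve_on \<A> 0 1 ?\<gamma>" by (rule C1_chart_curve[OF c _ x x']) simp
  then have piecewise_C1: "piecewise_C1 0 1 ?\<gamma>" by (simp add: piecewise_C1.single)
  then obtain L where L: "(speed ?\<gamma> has_integral L) {0..1}" using piecewise_C1_integral(1) by blast
  obtain F' where F': "\<And>t. t \<in> {0..1} \<Longrightarrow> ((f \<circ> ?\<gamma>) has_vector_derivative F' t) (at t within {0..1})"
    "\<And>t. t \<in> {0<..<1} \<Longrightarrow> speed ?\<gamma> t = norm (F' t)" using C1_image_curve[OF zero_less_one C1] by metis
  have "F' t = D t" if "t \<in> {0..1}" for t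
    using vector_derivative_within_closed_interval[OF zero_less_one that F'(1)[OF that]]
      vector_derivative_within_closed_interval[OF zero_less_one that D[OF that]] by (simp add: o_def)
  then have sp: "speed ?\<gamma> t \<le> K" if "t \<in> {0<..<1}" for t using F'(2)[OF that] K[of t] that by simp
  have "((\<lambda>_. K) has_integral K) {0..1::real}" using has_integral_const_real[of K 0 1] by simp
  moreover have "((\<lambda>t. if t \<in> {0,1} then K else speed ?\<gamma> t) has_integral L) {0..1}"
    by (rule has_integral_spike_finite[OF _ _ L, of "{0,1}"]) auto
  ultimately have "L \<le> K" using has_integral_le[of _ L "{0..1}" "\<lambda>_. K" K] sp by (smt (verit) atLeastAtMost_iff greaterThanLessThan_iff insert_iff singleton_iff)
  moreover have "joins (chart_inv c (x 0)) (chart_inv c (x 1)) L" unfolding joins_def using piecewise_C1 L by (intro exI[of _ ?\<gamma>]) simp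
  ultimately show ?thesis using that by blast
qed

lemma joins_ball:
  assumes c: "c \<in> \<A>" and B: "ball x0 r \<subseteq> chart_image c" "x0 \<in> ball x0 r" "x1 \<in> ball x0 r"
  shows "\<exists>L. joins (chart_inv c x0) (chart_inv c x1) L"
proof -
  let ?x = "\<lambda>t. x0 + t *\<^sub>R (x1 - x0)"
  have x: "?x t \<in> chart_image c" if "t \<in> {0..1}" for t
  proof -
    have "(1 - t) *\<^sub>R x0 + t *\<^sub>R x1 \<in> ball x0 r" using convexD_alt[OF convex_ball B(2,3)] that by simp
    then show ?thesis using B(1) by (auto simp: algebra_simps)
  qed
  have x': "(?x has_vector_derivative (x1 - x0)) (at t within {0..1})" for t
    by (auto intro!: derivative_eq_intros simp: has_vector_derivative_def)
  have C1: "C1_curve_on \<A> 0 1 (chart_inv c \<circ> ?x)" by (rule C1_chart_curve[OF c _ x x']) auto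
  then have piecewise_C1: "piecewise_C1 0 1 (chart_inv c \<circ> ?x)" by (simp add: piecewise_C1.single)
  then obtain L where L: "(speed (chart_inv c \<circ> ?x) has_integral L) {0..1}" using piecewise_C1_integral(1) by blast
  then have "joins (chart_inv c x0) (chart_inv c x1) L"
    unfolding joins_def using piecewise_C1 L by (intro exI[of _ "chart_inv c \<circ> ?x"]) simp
  then show ?thesis by blast
qed

lemma joins_refl: "joins p p 0"
proof -
  let ?c = "chart_at \<A> p" and ?x = "snd (chart_at \<A> p) p"
  have x: "?x \<in> chart_image ?c" "chart_inv ?c ?x = p" using chart_maps(1,2)[OF chart_at] by auto
  obtain L where L: "joins (chart_inv ?c ?x) (chart_inv ?c ?x) L" "L \<le> 0"
    by (rule joins_chart_curve[OF chart_at(1), of "\<lambda>_. ?x" p "\<lambda>_. 0" "\<lambda>_. 0" 0]) (use x in auto)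
  then have "L = 0" using joins_ge[OF L(1)] by simp
  then show ?thesis using L x by simp
qed

text \<open>
  The set of points that can be reached from a given one is open, and the manifold is a disjoint union of
  such sets.
\<close>

lemma joins_exists:
  assumes conn: "connected (UNIV :: 'm set)"
  shows "\<exists>L. joins p q L"
proof -
  let ?C = "\<lambda>p. {q. \<exists>L. joins p q L}"
  have op: "open (?C p)" for p
  proof (subst open_subopen, intro ballI)
    fix q assume q: "q \<in> ?C p"
    let ?c = "chart_at \<A> q"
    note m = chart_maps[OF chart_at(1)[of q]]
    obtain r where r: "r > 0" "ball (snd ?c q) r \<subseteq> chart_image ?c"
      using chart(2)[OF chart_at(1)] m(1)[OF chart_at(2)] open_contains_ball by metis
    let ?T = "fst ?c \<inter> snd ?c -` ball (snd ?c q) r"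
    have "open ?T" by (rule continuous_open_preimage[OF m(5) chart(1)[OF chart_at(1)] open_ball])
    moreover have "q \<in> ?T" using chart_at(2) r(1) by simp
    moreover have "?T \<subseteq> ?C p"
    proof
      fix y assume y: "y \<in> ?T"
      have "\<exists>L. joins (chart_inv ?c (snd ?c q)) (chart_inv ?c (snd ?c y)) L"
        by (rule joins_ball[OF chart_at(1) r(2)]) (use y r(1) in auto)
      then have "\<exists>L. joins q y L" using m(2)[of y] m(2)[OF chart_at(2)] y by simp
      then show "y \<in> ?C p" using q joins_trans by blast
    qed
    ultimately show "\<exists>T. open T \<and> q \<in> T \<and> T \<subseteq> ?C p" by blast
  qed
  have "- ?C p = (\<Union>q\<in>- ?C p. ?C q)"
  proof
    show "- ?C p \<subseteq> (\<Union>q\<in>- ?C p. ?C q)" using joins_refl by blast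
    show "(\<Union>q\<in>- ?C p. ?C q) \<subseteq> - ?C p" using joins_trans joins_sym by blast
  qed
  then have "open (- ?C p)" using op by (metis open_UN)
  then have "?C p = {} \<or> - ?C p = {}"
    using connectedD[OF conn op[of p], of "- ?C p"] by auto
  moreover have "p \<in> ?C p" using joins_refl by blast
  ultimately show ?thesis by blast
qed

text \<open>
  A curve leaving \<open>p\<close> has to cross the boundary sphere of a coordinate ball, on which \<open>f\<close> has a
  positive distance from \<open>f p\<close>.
\<close>

lemma joins_separated:
  assumes "p \<noteq> q"
  obtains \<mu> where "\<mu> > 0" "\<And>L. joins p q L \<Longrightarrow> \<mu> \<le> L"
proof -
  let ?c = "chart_at \<A> p" and ?x = "snd (chart_at \<A> p) p"
  note c = chart_at(1)[of p]
  note m = chart_maps[OF c]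
  have x: "?x \<in> chart_image ?c" "chart_inv ?c ?x = p" using m(1,2)[OF chart_at(2)] by auto
  define \<phi> where "\<phi> y = (\<chi> i. frame (chart_inv ?c ?x) i \<bullet> f (chart_inv ?c y))" for y
  obtain U' V \<psi> where U': "open U'" "U' \<subseteq> chart_image ?c" "?x \<in> U'" "homeomorphism U' V \<phi> \<psi>"
    by (rule graph_at[OF c x(1), folded \<phi>_def])
  have inj: "y = z" if "y \<in> U'" "z \<in> U'" "f (chart_inv ?c y) = f (chart_inv ?c z)" for y z
  proof -
    have "\<psi> (\<phi> y) = \<psi> (\<phi> z)" using that(3) by (simp add: \<phi>_def)
    then show ?thesis using U'(4) that(1,2) by (auto simp: homeomorphism_def)
  qed
  obtain r where r: "r > 0" "cball ?x r \<subseteq> U'" using U'(1,3) open_contains_cball by metis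
  obtain \<rho> where \<rho>: "\<rho> > 0" "cball ?x \<rho> \<subseteq> U'" "q \<notin> chart_inv ?c ` cball ?x \<rho>"
  proof (cases "q \<in> fst ?c")
    case True
    have "snd ?c q \<noteq> ?x" using assms m(2)[OF True] x(2) by auto
    then have d: "dist ?x (snd ?c q) > 0" by simp
    let ?\<rho> = "min r (dist ?x (snd ?c q) / 2)"
    have "q \<notin> chart_inv ?c ` cball ?x ?\<rho>"
    proof
      assume "q \<in> chart_inv ?c ` cball ?x ?\<rho>"
      then obtain z where z: "z \<in> cball ?x ?\<rho>" "q = chart_inv ?c z" by blast
      then have "z \<in> chart_image ?c" using r(2) U'(2) by auto
      then have "snd ?c q = z" using m(4) z(2) by simp
      then show False using z(1) d by simp
    qed
    moreover have "cball ?x ?\<rho> \<subseteq> U'" using r(2) subset_cball[of ?\<rho> r ?x] by auto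
    moreover have "?\<rho> > 0" using r(1) d by simp
    ultimately show ?thesis using that[of ?\<rho>] by blast
  next
    case False
    then have "q \<notin> chart_inv ?c ` cball ?x r" using m(3) r(2) U'(2) by blast
    then show ?thesis using that[of r] r by blast
  qed
  have cb: "cball ?x \<rho> \<subseteq> chart_image ?c" using \<rho>(2) U'(2) by blast
  obtain \<mu> where \<mu>: "\<mu> > 0" "\<And>y. y \<in> sphere ?x \<rho> \<Longrightarrow> \<mu> \<le> norm (f (chart_inv ?c y) - f p)"
  proof (cases "sphere ?x \<rho> = {}")
    case False
    have "continuous_on (sphere ?x \<rho>) (\<lambda>y. (f \<circ> chart_inv ?c) y)"
      by (rule continuous_on_subset[OF smooth_on_imp_continuous_on[OF smooth_chart(1)[OF c]]])
        (use cb sphere_cball in blast)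
    then have "continuous_on (sphere ?x \<rho>) (\<lambda>y. norm ((f \<circ> chart_inv ?c) y - f p))"
      by (rule continuous_on_norm[OF continuous_on_diff[OF _ continuous_on_const]])
    then obtain y where y: "y \<in> sphere ?x \<rho>"
      "\<And>z. z \<in> sphere ?x \<rho> \<Longrightarrow> norm ((f \<circ> chart_inv ?c) y - f p) \<le> norm ((f \<circ> chart_inv ?c) z - f p)"
      using continuous_attains_inf[OF compact_sphere False] by blast
    have "y \<in> U'" using y(1) \<rho>(2) sphere_cball by blast
    moreover have "y \<noteq> ?x" using y(1) \<rho>(1) by auto
    ultimately have "f (chart_inv ?c y) \<noteq> f p" using inj[of y ?x] U'(3) x(2) by auto
    then show ?thesis using that[of "norm (f (chart_inv ?c y) - f p)"] y(2) by auto
  qed (use that[of 1] in auto)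
  have "\<mu> \<le> L" if L: "joins p q L" for L
  proof -
    obtain \<gamma> :: "real \<Rightarrow> 'm" where \<gamma>: "continuous_on {0..1} \<gamma>" "\<gamma> 0 = p" "\<gamma> 1 = q"
      "\<And>t. t \<in> {0..1} \<Longrightarrow> norm (f (\<gamma> t) - f p) \<le> L" using joins_near[OF L] by metis
    let ?B = "fst ?c \<inter> snd ?c -` ball ?x \<rho>" and ?K = "chart_inv ?c ` cball ?x \<rho>"
    have B: "open ?B" by (rule continuous_open_preimage[OF m(5) chart(1)[OF c] open_ball])
    have "compact ?K" by (rule compact_continuous_image[OF continuous_on_subset[OF m(6) cb] compact_cball])
    then have K: "open (- ?K)" by (simp add: compact_imp_closed open_Compl)
    have conn: "connected (\<gamma> ` {0..1})" by (rule connected_continuous_image[OF \<gamma>(1)]) simp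
    have "?B \<subseteq> ?K"
    proof
      fix z assume z: "z \<in> ?B"
      then show "z \<in> ?K" using m(2)[of z] by (intro image_eqI[of _ _ "snd ?c z"]) auto
    qed
    then have "?B \<inter> - ?K \<inter> \<gamma> ` {0..1} = {}" by blast
    moreover have "\<gamma> 0 \<in> \<gamma> ` {0..1}" "\<gamma> 1 \<in> \<gamma> ` {0..1}" by (rule imageI, simp)+
    then have "p \<in> ?B \<inter> \<gamma> ` {0..1}" "q \<in> - ?K \<inter> \<gamma> ` {0..1}"
      using \<gamma>(2,3) \<rho>(1,3) chart_at(2)[of p] by simp_all
    ultimately have "\<not> \<gamma> ` {0..1} \<subseteq> ?B \<union> - ?K" using connectedD[OF conn B K] by blast
    then obtain s where s: "s \<in> \<gamma> ` {0..1}" "s \<notin> ?B \<union> - ?K" by (auto simp only: subset_iff)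
    then obtain t where t0: "t \<in> {0..1}" "s = \<gamma> t" by (auto simp only: image_iff)
    have t: "t \<in> {0..1}" "\<gamma> t \<notin> ?B" "\<gamma> t \<in> ?K" using s(2) t0 by simp_all
    from t(3) obtain z where z: "z \<in> cball ?x \<rho>" "\<gamma> t = chart_inv ?c z" by (rule imageE)
    have zc: "z \<in> chart_image ?c" using z(1) cb by blast
    have "z \<notin> ball ?x \<rho>" using t(2) m(3,4)[OF zc] z(2) by simp
    then have "z \<in> sphere ?x \<rho>" using z(1) by simp
    from \<mu>(2)[OF this] show ?thesis using \<gamma>(4)[OF t(1)] z(2) by simp
  qed
  then show ?thesis using that \<mu>(1) by blast
qed

text \<open>
  The distance is an infimum over a nonempty set of lengths only because the manifold is connected.
\<close>

lemma
  assumes conn: "connected (UNIV :: 'm set)"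
  shows riemannian_dist_le: "joins p q L \<Longrightarrow> riemannian_dist \<A> g p q \<le> L"
    and riemannian_dist_ge: "norm (f q - f p) \<le> riemannian_dist \<A> g p q"
    and riemannian_dist_metric: "Metric_space UNIV (riemannian_dist \<A> g)"
proof -
  have ne: "{L. joins p q L} \<noteq> {}" for p q using joins_exists[OF conn] by blast
  have bdd: "bdd_below {L. joins p q L}" for p q using joins_ge by (intro bdd_belowI) auto
  show le: "joins p q L \<Longrightarrow> riemannian_dist \<A> g p q \<le> L" for p q L
    unfolding riemannian_dist_joins by (rule cInf_lower[OF _ bdd]) simp
  show ge: "norm (f q - f p) \<le> riemannian_dist \<A> g p q" for p q
    unfolding riemannian_dist_joins by (rule cInf_greatest[OF ne]) (use joins_ge in auto)
  show "Metric_space UNIV (riemannian_dist \<A> g)"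
  proof
    show "0 \<le> riemannian_dist \<A> g p q" for p q using ge[of q p] norm_ge_zero order_trans by blast
    show "riemannian_dist \<A> g p q = riemannian_dist \<A> g q p" for p q
    proof -
      have "{L. joins p q L} = {L. joins q p L}" using joins_sym by blast
      then show ?thesis by (simp add: riemannian_dist_joins)
    qed
    show "riemannian_dist \<A> g p q = 0 \<longleftrightarrow> p = q" for p q
    proof
      assume "p = q"
      then show "riemannian_dist \<A> g p q = 0" using le[OF joins_refl[of p]] ge[of p p] by simp
    next
      assume z: "riemannian_dist \<A> g p q = 0"
      show "p = q"
      proof (rule ccontr)
        assume "p \<noteq> q"
        then obtain \<mu> where "\<mu> > 0" "\<And>L. joins p q L \<Longrightarrow> \<mu> \<le> L" using joins_separated by metis
        then have "\<mu> \<le> riemannian_dist \<A> g p q" unfolding riemannian_dist_joins by (intro cInf_greatest[OF ne]) auto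
        then show False using z \<open>\<mu> > 0\<close> by simp
      qed
    qed
    show "riemannian_dist \<A> g p r \<le> riemannian_dist \<A> g p q + riemannian_dist \<A> g q r" for p q r
    proof -
      have "riemannian_dist \<A> g p r - L \<le> riemannian_dist \<A> g q r" if L: "joins p q L" for L
        unfolding riemannian_dist_joins[of q r]
      proof (rule cInf_greatest[OF ne])
        fix L' assume "L' \<in> {L. joins q r L}"
        then show "riemannian_dist \<A> g p r - L \<le> L'" using le[OF joins_trans[OF L, of r L']] by simp
      qed
      then have "riemannian_dist \<A> g p r - riemannian_dist \<A> g q r \<le> riemannian_dist \<A> g p q"
        unfolding riemannian_dist_joins[of p q] by (intro cInf_greatest[OF ne]) (force simp: algebra_simps)
      then show ?thesis by simp
    qed
  qed
qed

end

section \<open>Completeness and lifting\<close>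

text \<open>
  A greedy search takes the place of a maximal lift of \<open>\<gamma>\<close>.  Starting from \<open>p0\<close>, one always moves to a point at a time at least half as far ahead as is possible from the current point at cost \<open>K\<close>
  per unit of time.  The points form a Cauchy sequence; its limit lies over the limit time \<open>T\<close>, and if \<open>T < 1\<close>,
  a further step from the limit was available all along, contradicting that the steps tend to zero.
\<close>

lemma complete_continuation:
  fixes d :: "'m \<Rightarrow> 'm \<Rightarrow> real" and f :: "'m \<Rightarrow> 'e::real_normed_vector" and \<gamma> :: "real \<Rightarrow> 'e"
  assumes met: "Metric_space UNIV d" and compl: "Metric_space.mcomplete UNIV d"
    and f: "\<And>p q. norm (f q - f p) \<le> d p q"
    and \<gamma>: "continuous_on {0..1} \<gamma>" and K: "K \<ge> 0" and p0: "f p0 = \<gamma> 0"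
    and step: "\<And>t p. 0 \<le> t \<Longrightarrow> t < 1 \<Longrightarrow> f p = \<gamma> t \<Longrightarrow> \<exists>t' p'. t < t' \<and> t' \<le> 1 \<and> f p' = \<gamma> t' \<and> d p p' \<le> K * (t' - t)"
  shows "\<exists>p. f p = \<gamma> 1"
proof -
  interpret Metric_space UNIV d by (rule met)
  define reach where "reach t p = {t'. t \<le> t' \<and> t' \<le> 1 \<and> (\<exists>p'. f p' = \<gamma> t' \<and> d p p' \<le> K * (t' - t))}" for t p
  define good where "good s \<longleftrightarrow> 0 \<le> fst s \<and> fst s \<le> 1 \<and> f (snd s) = \<gamma> (fst s)" for s :: "real \<times> 'm"
  define nxt where "nxt s s' \<longleftrightarrow> fst s \<le> fst s' \<and> d (snd s) (snd s') \<le> K * (fst s' - fst s) \<and>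
    (\<forall>t\<in>reach (fst s) (snd s). t - fst s \<le> 2 * (fst s' - fst s))" for s s' :: "real \<times> 'm"
  have "\<exists>s'. good s' \<and> nxt s s'" if s: "good s" for s
  proof -
    obtain t p where tp: "s = (t, p)" by (cases s)
    have t: "0 \<le> t" "t \<le> 1" "f p = \<gamma> t" using s by (auto simp: good_def tp)
    have self: "t \<in> reach t p" using t by (auto simp: reach_def)
    have bdd: "bdd_above (reach t p)" by (rule bdd_aboveI[of _ 1]) (auto simp: reach_def)
    show ?thesis
    proof (cases "Sup (reach t p) \<le> t")
      case True
      have "t' \<le> t" if "t' \<in> reach t p" for t' using cSup_upper[OF that bdd] True by simp
      then show ?thesis using t by (intro exI[of _ s]) (auto simp: good_def nxt_def tp)
    next
      case False
      then have "(t + Sup (reach t p)) / 2 < Sup (reach t p)" by simp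
      then obtain t' where t': "t' \<in> reach t p" "(t + Sup (reach t p)) / 2 < t'"
        using less_cSup_iff[OF _ bdd] self by blast
      obtain p' where p': "t \<le> t'" "t' \<le> 1" "f p' = \<gamma> t'" "d p p' \<le> K * (t' - t)"
        using t'(1) by (auto simp: reach_def)
      have "t'' - t \<le> 2 * (t' - t)" if "t'' \<in> reach t p" for t''
        using cSup_upper[OF that bdd] t'(2) by (simp add: field_simps)
      then show ?thesis using t p' by (intro exI[of _ "(t', p')"]) (auto simp: good_def nxt_def tp)
    qed
  qed
  moreover have "good (0, p0)" using p0 by (simp add: good_def)
  ultimately obtain s where s: "\<And>n. good (s n)" "\<And>n. nxt (s n) (s (Suc n))"
    using dependent_nat_choice[of "\<lambda>_. good" "\<lambda>_. nxt"] by blast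
  define t where "t n = fst (s n)" for n
  define p where "p n = snd (s n)" for n
  have tn: "0 \<le> t n" "t n \<le> 1" "f (p n) = \<gamma> (t n)" for n using s(1)[of n] by (auto simp: good_def t_def p_def)
  have nx: "t n \<le> t (Suc n)" "d (p n) (p (Suc n)) \<le> K * (t (Suc n) - t n)"
    "t' \<in> reach (t n) (p n) \<Longrightarrow> t' - t n \<le> 2 * (t (Suc n) - t n)" for n t'
    using s(2)[of n] by (auto simp: nxt_def t_def p_def)
  have inc: "incseq t" using nx(1) by (rule incseq_SucI)
  obtain T where T: "t \<longlonglongrightarrow> T" "\<And>n. t n \<le> T"
    using incseq_convergent[OF inc, of 1] tn(2) by blast
  have T01: "0 \<le> T" "T \<le> 1" using T(2)[of 0] tn(1)[of 0] LIMSEQ_le_const2[OF T(1)] tn(2) by auto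
  have dist: "d (p n) (p (n + k)) \<le> K * (t (n + k) - t n)" for n k
  proof (induction k)
    case (Suc k)
    have "d (p n) (p (n + Suc k)) \<le> d (p n) (p (n + k)) + d (p (n + k)) (p (n + Suc k))" by (rule triangle) auto
    then show ?case using Suc nx(2)[of "n + k"] by (simp add: algebra_simps)
  qed simp
  have dist': "d (p n) (p m) \<le> K * (T - t n)" if "n \<le> m" for n m
  proof -
    have "d (p n) (p m) \<le> K * (t m - t n)" using dist[of n "m - n"] that by simp
    also have "\<dots> \<le> K * (T - t n)" using T(2)[of m] K by (intro mult_left_mono) auto
    finally show ?thesis .
  qed
  have lim0: "(\<lambda>n. K * (T - t n)) \<longlonglongrightarrow> 0"
    using tendsto_mult_right_zero[OF tendsto_diff[OF tendsto_const T(1), of T, simplified], of K] by simp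
  have "MCauchy p"
    unfolding MCauchy_def
  proof (intro conjI allI impI)
    fix \<epsilon> :: real assume "\<epsilon> > 0"
    then obtain N where N: "\<And>n. n \<ge> N \<Longrightarrow> K * (T - t n) < \<epsilon>"
      using order_tendstoD(2)[OF lim0] by (auto simp: eventually_sequentially)
    show "\<exists>N. \<forall>n n'. N \<le> n \<longrightarrow> N \<le> n' \<longrightarrow> d (p n) (p n') < \<epsilon>"
    proof (intro exI[of _ N] allI impI)
      fix n n' assume "N \<le> n" "N \<le> n'"
      then show "d (p n) (p n') < \<epsilon>"
        using N[of n] N[of n'] dist'[of n n'] dist'[of n' n] commute[of "p n" "p n'"] by (cases "n \<le> n'") auto
    qed
  qed simp
  then obtain q where "limitin mtopology p q sequentially" using compl unfolding mcomplete_def by blast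
  then have q: "\<And>\<epsilon>. \<epsilon> > 0 \<Longrightarrow> \<exists>N. \<forall>n\<ge>N. d (p n) q < \<epsilon>" by (simp add: limit_metric_sequentially)
  have dq: "(\<lambda>n. d (p n) q) \<longlonglongrightarrow> 0" by (rule LIMSEQ_I) (use q in \<open>auto simp: nonneg\<close>)
  have dq': "d (p n) q \<le> K * (T - t n)" for n
  proof (rule LIMSEQ_le_const)
    show "(\<lambda>m. K * (T - t n) + d (p m) q) \<longlonglongrightarrow> K * (T - t n)"
      using tendsto_add[OF tendsto_const dq, of "K * (T - t n)"] by simp
    show "\<exists>N. \<forall>m\<ge>N. d (p n) q \<le> K * (T - t n) + d (p m) q"
      using dist' triangle[of "p n" _ q] by (intro exI[of _ n] allI impI) (smt (verit, ccfv_threshold) UNIV_I)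
  qed
  have fq: "f q = \<gamma> T"
  proof -
    have "(\<lambda>n. f (p n)) \<longlonglongrightarrow> f q"
      by (rule LIMSEQ_I) (use q f in \<open>metis (no_types, opaque_lifting) norm_minus_commute order_le_less_trans\<close>)
    moreover have "(\<lambda>n. \<gamma> (t n)) \<longlonglongrightarrow> \<gamma> T"
      by (rule continuous_on_tendsto_compose[OF \<gamma> T(1)]) (use T01 tn in auto)
    ultimately show ?thesis using LIMSEQ_unique by (simp add: tn(3))
  qed
  show ?thesis
  proof (cases "T < 1")
    case True
    obtain t' p' where t': "T < t'" "t' \<le> 1" "f p' = \<gamma> t'" "d q p' \<le> K * (t' - T)"
      using step[OF T01(1) True fq] by blast
    have "t' \<in> reach (t n) (p n)" for n
    proof -
      have "d (p n) p' \<le> d (p n) q + d q p'" by (rule triangle) auto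
      also have "\<dots> \<le> K * (t' - t n)" using dq'[of n] t'(4) by (simp add: algebra_simps)
      finally show ?thesis using t' T(2)[of n] by (auto simp: reach_def)
    qed
    then have "t' - t n \<le> 2 * (t (Suc n) - t n)" for n using nx(3) by blast
    moreover have "(\<lambda>n. 2 * (t (Suc n) - t n)) \<longlonglongrightarrow> 2 * (T - T)"
      by (intro tendsto_intros T(1) LIMSEQ_Suc)
    ultimately have "t' - T \<le> 2 * (T - T)"
      by (intro LIMSEQ_le[OF tendsto_diff[OF tendsto_const T(1)]]) auto
    then show ?thesis using t'(1) by simp
  next
    case False
    then show ?thesis using fq T01 by (metis antisym_conv1)
  qed
qed

section \<open>The cylinder\<close>

text \<open>
  The vector \<open>w\<close> is the normalized component of \<open>v\<close> orthogonal to \<open>u\<close>.  That component vanishes if \<open>v\<close> is \<open>u\<close>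
  or \<open>-u\<close>, and then the dimension of \<open>W\<close> provides some other \<open>w\<close>.
\<close>

lemma unit_vectors_angle:
  fixes u v :: "'e::euclidean_space"
  assumes W: "subspace W" "dim W \<ge> 2" and u: "u \<in> W" "norm u = 1" and v: "v \<in> W" "norm v = 1"
  obtains w \<theta> where "w \<in> W" "norm w = 1" "u \<bullet> w = 0" "v = cos \<theta> *\<^sub>R u + sin \<theta> *\<^sub>R w"
proof -
  define s where "s = u \<bullet> v"
  have uu: "u \<bullet> u = 1" "v \<bullet> v = 1" using u v by (simp_all add: norm_eq_1)
  have s: "-1 \<le> s" "s \<le> 1" using Cauchy_Schwarz_ineq2[of u v] u v by (auto simp: s_def)
  define r where "r = v - s *\<^sub>R u"
  have ur: "u \<bullet> r = 0" by (simp add: r_def inner_diff_right uu s_def)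
  have "r \<bullet> r = 1 - s\<^sup>2"
    by (simp add: r_def inner_diff_right inner_diff_left uu s_def inner_commute[of v u] power2_eq_square)
  then have nr: "norm r = sqrt (1 - s\<^sup>2)" by (simp add: norm_eq_sqrt_inner)
  have th: "cos (arccos s) = s" "sin (arccos s) = norm r" using s by (simp_all add: nr sin_arccos_abs abs_le_iff)
  have rW: "r \<in> W" unfolding r_def using u v W(1) by (simp add: subspace_diff subspace_mul)
  show ?thesis
  proof (cases "r = 0")
    case False
    show ?thesis
    proof (rule that[of "r /\<^sub>R norm r" "arccos s"])
      show "v = cos (arccos s) *\<^sub>R u + sin (arccos s) *\<^sub>R (r /\<^sub>R norm r)" using False by (simp add: th r_def)
    qed (use False rW W(1) ur in \<open>simp_all add: subspace_mul\<close>)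
  next
    case True
    have "dim {y \<in> W. \<forall>x\<in>span {u}. orthogonal x y} + dim (span {u}) = dim W"
      by (rule dim_subspace_orthogonal_to_vectors[OF subspace_span W(1) span_minimal[OF _ W(1)]]) (use u(1) in simp)
    moreover have "dim (span {u}) \<le> 1" using dim_le_card'[of "{u}"] by simp
    ultimately have "dim {y \<in> W. \<forall>x\<in>span {u}. orthogonal x y} \<noteq> 0" using W(2) by linarith
    then obtain y where y: "y \<in> W" "orthogonal u y" "y \<noteq> 0"
      unfolding dim_eq_0 using span_base[of u "{u}"] by blast
    show ?thesis
    proof (rule that[of "y /\<^sub>R norm y" "arccos s"])
      show "v = cos (arccos s) *\<^sub>R u + sin (arccos s) *\<^sub>R (y /\<^sub>R norm y)" using True by (simp add: th r_def)
    qed (use y W(1) in \<open>simp_all add: subspace_mul orthogonal_def\<close>)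
  qed
qed

context special_hypersurface
begin

text \<open>
  By \<open>curved_proj_const\<close> and \<open>centre_const\<close> neither the projection nor the centre depends on the point at which
  it is formed, so an arbitrary one is used.
\<close>

definition cross_proj :: "'e \<Rightarrow> 'e" where "cross_proj = curved_proj a undefined"
definition centre :: 'e where "centre = cross_proj (f undefined) + (1/a) *\<^sub>R \<xi> undefined"
definition cylinder :: "'e set" where "cylinder = {z. norm (cross_proj z - centre) = 1/a}"

lemma cross_proj_eq: "cross_proj v = curved_proj a p v"
  unfolding cross_proj_def by (rule curved_proj_const)

lemma cross_proj_linear: "linear cross_proj"
  unfolding cross_proj_def by (rule linear_curved_proj)

lemma cross_proj_normal: "cross_proj (\<xi> p) = \<xi> p"
  by (simp add: cross_proj_eq[of _ p] curved_proj_normal)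

lemma cross_proj_frame: "cross_proj (frame p i) = (curv p i / a) *\<^sub>R frame p i"
  by (simp add: cross_proj_eq[of _ p] curved_proj_frame)

lemma cross_proj_image: "cross_proj (f p) = centre - (1/a) *\<^sub>R \<xi> p"
  using centre_const[of undefined p undefined] by (simp add: centre_def cross_proj_def algebra_simps)

lemma cross_proj_idem: "cross_proj (cross_proj v) = cross_proj v"
proof -
  have "(curv p i / a) * (curv p i / a) = curv p i / a" for p i using curv_two_valued(2)[of p i] a by auto
  then have k: "(curv p i / a * x) * (curv p i / a) = curv p i / a * x" for p i x by (metis mult.assoc mult.commute)
  let ?p = undefined
  have "cross_proj v = (\<xi> ?p \<bullet> v) *\<^sub>R \<xi> ?p + (\<Sum>i\<in>UNIV. (curv ?p i / a * (frame ?p i \<bullet> v)) *\<^sub>R frame ?p i)"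
    by (simp add: cross_proj_def curved_proj_def)
  from arg_cong[OF this, of cross_proj] show ?thesis
    by (simp only: linear_add[OF cross_proj_linear] linear_cmul[OF cross_proj_linear] linear_sum[OF cross_proj_linear] cross_proj_normal cross_proj_frame
        scaleR_scaleR k) (simp add: cross_proj_def curved_proj_def)
qed

lemma cross_proj_selfadjoint: "cross_proj v \<bullet> w = v \<bullet> cross_proj w"
  by (simp add: cross_proj_def curved_proj_def inner_add_left inner_add_right inner_sum_left inner_sum_right inner_commute mult_ac)

lemma cross_proj_centre: "cross_proj centre = centre"
  by (simp add: centre_def linear_add[OF cross_proj_linear] linear_cmul[OF cross_proj_linear] cross_proj_idem cross_proj_normal)

lemma subspace_cross_proj: "subspace {v. cross_proj v = v}" "subspace {v. cross_proj v = 0}"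
  by (simp_all add: subspace_def linear_0[OF cross_proj_linear] linear_add[OF cross_proj_linear] linear_cmul[OF cross_proj_linear])

text \<open>
  The principal curvatures are \<open>0\<close> or \<open>a\<close> and add up to \<open>2 a\<close>, so exactly two of them are \<open>a\<close>; with the normal
  this gives a space of dimension \<open>3\<close>.
\<close>

lemma dim_cross_proj: "dim {v. cross_proj v = v} = 3" "dim {v. cross_proj v = 0} = 4"
proof -
  let ?p = "undefined :: 'm"
  let ?I = "{i. curv ?p i = a}"
  have "(\<Sum>i\<in>UNIV. curv ?p i) = (\<Sum>i\<in>UNIV. if i \<in> ?I then a else 0)"
    by (rule sum.cong[OF refl]) (use curv_two_valued(2)[of ?p] in auto)
  also have "\<dots> = real (card ?I) * a" by (simp add: sum.If_cases)
  finally have cI: "card ?I = 2" using power_sums(1)[of ?p] a by simp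
  let ?B = "insert (\<xi> ?p) (frame ?p ` ?I)"
  note on = orthonormal_inner[OF frame_orthonormal[of ?p]]
  have inj: "inj_on (frame ?p) ?I"
  proof (rule inj_onI)
    fix i j assume "frame ?p i = frame ?p j"
    then show "i = j" using on[of i j] on[of i i] by (auto split: if_splits)
  qed
  have "\<xi> ?p \<notin> frame ?p ` ?I" using \<xi>_frame(1)[of ?p] \<xi>_unit[of ?p] by (metis imageE zero_neq_one)
  then have card: "card ?B = 3" using cI inj by (simp add: card_image)
  have ind: "independent ?B"
  proof (rule pairwise_orthogonal_independent)
    show "pairwise orthogonal ?B"
      by (auto simp: pairwise_def orthogonal_def \<xi>_frame on split: if_splits)
    have "x \<bullet> x = 1" if "x \<in> ?B" for x using that \<xi>_unit[of ?p] on by auto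
    from this[of 0] show "0 \<notin> ?B" by auto
  qed
  have "span ?B = {v. cross_proj v = v}"
  proof
    show "span ?B \<subseteq> {v. cross_proj v = v}"
    proof (rule span_minimal[OF _ subspace_cross_proj(1)], rule subsetI)
      fix v assume "v \<in> ?B"
      then have "v = \<xi> ?p \<or> (\<exists>i. curv ?p i = a \<and> v = frame ?p i)" by blast
      then show "v \<in> {v. cross_proj v = v}" using cross_proj_frame[of ?p] cross_proj_normal[of ?p] a by force
    qed
    show "{v. cross_proj v = v} \<subseteq> span ?B"
    proof
      fix v assume "v \<in> {v. cross_proj v = v}"
      then have v: "v = (\<xi> ?p \<bullet> v) *\<^sub>R \<xi> ?p + (\<Sum>i\<in>UNIV. (curv ?p i / a * (frame ?p i \<bullet> v)) *\<^sub>R frame ?p i)"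
        by (simp add: cross_proj_def curved_proj_def)
      have "(curv ?p i / a * (frame ?p i \<bullet> v)) *\<^sub>R frame ?p i \<in> span ?B" for i
      proof (cases "curv ?p i = 0")
        case True
        then have "(curv ?p i / a * (frame ?p i \<bullet> v)) *\<^sub>R frame ?p i = 0" by simp
        then show ?thesis using span_zero by metis
      next
        case False
        then have "frame ?p i \<in> ?B" using curv_two_valued(2)[of ?p i] by blast
        then show ?thesis by (intro span_mul span_base)
      qed
      moreover have "\<xi> ?p \<in> span ?B" by (simp add: span_base)
      ultimately have "(\<xi> ?p \<bullet> v) *\<^sub>R \<xi> ?p + (\<Sum>i\<in>UNIV. (curv ?p i / a * (frame ?p i \<bullet> v)) *\<^sub>R frame ?p i) \<in> span ?B"
        by (intro span_add[OF span_mul span_sum])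
      then show "v \<in> span ?B" using v by argo
    qed
  qed
  then show d3: "dim {v. cross_proj v = v} = 3" using dim_span_eq_card_independent[OF ind] card by simp
  have "{y \<in> UNIV. \<forall>x\<in>{v. cross_proj v = v}. orthogonal x y} = {v. cross_proj v = 0}"
  proof (intro equalityI subsetI)
    fix y assume "y \<in> {y \<in> UNIV. \<forall>x\<in>{v. cross_proj v = v}. orthogonal x y}"
    then have "cross_proj y \<bullet> y = 0" using cross_proj_idem by (auto simp: orthogonal_def)
    then have "cross_proj y \<bullet> cross_proj y = 0" using cross_proj_selfadjoint[of y "cross_proj y"] cross_proj_idem[of y] by (simp add: inner_commute)
    then show "y \<in> {v. cross_proj v = 0}" by simp
  next
    fix y assume y: "y \<in> {v. cross_proj v = 0}"
    have "x \<bullet> y = 0" if "cross_proj x = x" for x using cross_proj_selfadjoint[of x y] that y by simp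
    then show "y \<in> {y \<in> UNIV. \<forall>x\<in>{v. cross_proj v = v}. orthogonal x y}" by (simp add: orthogonal_def)
  qed
  then show "dim {v. cross_proj v = 0} = 4"
    using dim_subspace_orthogonal_to_vectors[OF subspace_cross_proj(1) subspace_UNIV subset_UNIV] d3 codimension card6 by simp
qed

lemma image_in_cylinder: "f p \<in> cylinder"
  using \<xi>_unit[of p] a by (simp add: cylinder_def cross_proj_image norm_eq_1)

text \<open>
  Two points of the cylinder with the same projection to the tangent hyperplane of the immersion at \<open>p\<close>
  differ by a multiple of the normal \<open>\<xi> p\<close>; on the half of the cylinder around \<open>f p\<close> they coincide.
\<close>

lemma cylinder_projection_inj:
  assumes z: "z \<in> cylinder" "z' \<in> cylinder" and eq: "\<And>i. frame p i \<bullet> z = frame p i \<bullet> z'"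
    and side: "(cross_proj z - centre) \<bullet> \<xi> p < 0" "(cross_proj z' - centre) \<bullet> \<xi> p < 0"
    and expand: "\<And>v. v = (\<xi> p \<bullet> v) *\<^sub>R \<xi> p + (\<Sum>i\<in>UNIV. (frame p i \<bullet> v) *\<^sub>R frame p i)"
  shows "z = z'"
proof -
  define s where "s = \<xi> p \<bullet> (z' - z)"
  have "frame p i \<bullet> (z' - z) = 0" for i using eq[of i] by (simp add: inner_diff_right)
  then have zz: "z' - z = s *\<^sub>R \<xi> p" using expand[of "z' - z"] unfolding s_def by simp
  have "cross_proj z' - cross_proj z = s *\<^sub>R \<xi> p" using arg_cong[OF zz, of cross_proj]
    by (simp add: linear_diff[OF cross_proj_linear] linear_cmul[OF cross_proj_linear] cross_proj_normal)
  then have m: "cross_proj z' - centre = (cross_proj z - centre) + s *\<^sub>R \<xi> p" by (simp add: algebra_simps)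
  let ?m = "cross_proj z - centre"
  have "(cross_proj z' - centre) \<bullet> (cross_proj z' - centre) = ?m \<bullet> ?m" using z by (simp add: cylinder_def dot_square_norm)
  then have "s * (2 * (?m \<bullet> \<xi> p) + s) = 0"
    unfolding m by (simp add: inner_add_left inner_add_right \<xi>_unit inner_commute[of "\<xi> p"] algebra_simps)
  moreover have "2 * (?m \<bullet> \<xi> p) + s < 0"
  proof -
    have "?m \<bullet> \<xi> p + s < 0" using side(2) unfolding m by (simp add: inner_add_left \<xi>_unit)
    then show ?thesis using side(1) by simp
  qed
  ultimately have "s = 0" by auto
  then show ?thesis using zz by simp
qed

text \<open>
  In graph coordinates at \<open>p\<close> the lift is the curve with the same projection to the tangent hyperplane as \<open>\<gamma>\<close>.
  Its image agrees with \<open>\<gamma>\<close> because both stay on the cylinder, close to \<open>f p\<close>.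
\<close>

lemma local_lift:
  assumes t0: "0 \<le> t0" "t0 < 1" and p: "f p = \<gamma> t0"
    and \<gamma>: "\<And>t. (\<gamma> has_vector_derivative \<gamma>' t) (at t)" "continuous_on UNIV \<gamma>'" "\<And>t. \<gamma> t \<in> cylinder" "\<And>t. norm (\<gamma>' t) \<le> K"
  shows "\<exists>t1 p1 L. t0 < t1 \<and> t1 \<le> 1 \<and> f p1 = \<gamma> t1 \<and> joins p p1 L \<and> L \<le> K * (t1 - t0)"
proof -
  let ?c = "chart_at \<A> p" and ?x = "snd (chart_at \<A> p) p"
  note c = chart_at(1)[of p]
  note m = chart_maps[OF c]
  have x: "?x \<in> chart_image ?c" "chart_inv ?c ?x = p" using m(1,2)[OF chart_at(2)] by auto
  define \<phi> where "\<phi> x = (\<chi> i. frame p i \<bullet> f (chart_inv ?c x))" for x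
  obtain U' V \<psi> where U': "open U'" "U' \<subseteq> chart_image ?c" "?x \<in> U'" "homeomorphism U' V \<phi> \<psi>" "smooth_on V \<psi>"
    and gp: "graph_patch V (\<lambda>y. f (chart_inv ?c (\<psi> y))) (\<lambda>y. \<xi> (chart_inv ?c (\<psi> y))) (\<phi> ?x) (curv p) (frame p)"
    by (rule graph_at[OF c x(1), unfolded x(2), folded \<phi>_def]) (rule that; (assumption | simp add: \<phi>_def x(2)))
  interpret G: graph_patch V "\<lambda>y. f (chart_inv ?c (\<psi> y))" "\<lambda>y. \<xi> (chart_inv ?c (\<psi> y))" "\<phi> ?x" "curv p" "frame p" by (rule gp)
  have \<psi>\<phi>: "\<psi> (\<phi> ?x) = ?x" using U'(3,4) by (auto simp: homeomorphism_def)
  have expand: "v = (\<xi> p \<bullet> v) *\<^sub>R \<xi> p + (\<Sum>i\<in>UNIV. (frame p i \<bullet> v) *\<^sub>R frame p i)" for v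
    using G.b_expand[of v] by (simp add: \<psi>\<phi> x(2))
  define y where "y t = (\<chi> i. frame p i \<bullet> \<gamma> t)" for t
  define y' where "y' t = (\<chi> i. frame p i \<bullet> \<gamma>' t)" for t
  have blin: "bounded_linear (\<lambda>v. \<chi> i. frame p i \<bullet> v)"
    by (intro linear_conv_bounded_linear[THEN iffD1] linearI) (simp_all add: vec_eq_iff inner_add_right)
  have dy: "(y has_vector_derivative y' t) (at t)" for t
    unfolding y_def[abs_def] y'_def by (rule bounded_linear.has_vector_derivative[OF blin \<gamma>(1)])
  have cy': "continuous_on S y'" for S
    unfolding y'_def[abs_def] by (rule bounded_linear.continuous_on[OF blin]) (rule continuous_on_subset[OF \<gamma>(2)], simp)
  have c\<gamma>: "continuous_on S \<gamma>" for S
    using \<gamma>(1) by (meson continuous_on_vector_derivative has_vector_derivative_at_within)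
  have cy: "continuous_on S y" for S
    using dy by (meson continuous_on_vector_derivative has_vector_derivative_at_within)
  have y0: "y t0 = \<phi> ?x" by (simp add: y_def \<phi>_def x(2) p)
  define s1 where "s1 t = (cross_proj (\<gamma> t) - centre) \<bullet> \<xi> p" for t
  define s2 where "s2 t = (cross_proj (f (chart_inv ?c (\<psi> (y t)))) - centre) \<bullet> \<xi> p" for t
  have cP: "continuous_on S cross_proj" for S using cross_proj_linear by (simp add: linear_continuous_on linear_conv_bounded_linear)
  let ?T = "y -` V"
  have T: "open ?T" using open_vimage[OF G.open_U cy] .
  have c1: "continuous_on ?T s1"
    unfolding s1_def by (intro continuous_intros continuous_on_compose2[OF cP c\<gamma>]) auto
  have "continuous_on ?T (\<lambda>t. f (chart_inv ?c (\<psi> (y t))))"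
    by (rule continuous_on_compose2[OF smooth_on_imp_continuous_on[OF G.smooth_X] cy]) auto
  then have c2: "continuous_on ?T s2"
    unfolding s2_def by (intro continuous_intros continuous_on_compose2[OF cP]) auto
  have "open ({t \<in> ?T. s1 t < 0} \<inter> {t \<in> ?T. s2 t < 0})"
    using continuous_open_preimage[OF c1 T open_lessThan[of 0]] continuous_open_preimage[OF c2 T open_lessThan[of 0]]
    by (intro open_Int) (simp_all add: vimage_def Int_def)
  moreover have "t0 \<in> {t \<in> ?T. s1 t < 0} \<inter> {t \<in> ?T. s2 t < 0}"
  proof -
    have "(cross_proj (f p) - centre) \<bullet> \<xi> p < 0" using a by (simp add: cross_proj_image \<xi>_unit)
    then show ?thesis using G.y0 by (simp add: y0 s1_def s2_def \<psi>\<phi> x(2) p)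
  qed
  ultimately obtain \<delta> where \<delta>: "\<delta> > 0" "cball t0 \<delta> \<subseteq> {t \<in> ?T. s1 t < 0} \<inter> {t \<in> ?T. s2 t < 0}"
    using open_contains_cball by blast
  define t1 where "t1 = min (t0 + \<delta>) 1"
  have t1: "t0 < t1" "t1 \<le> 1" using \<delta>(1) t0 by (auto simp: t1_def)
  have good: "y t \<in> V" "s1 t < 0" "s2 t < 0" if "t \<in> {t0..t1}" for t
  proof -
    have "t \<in> cball t0 \<delta>" using that by (auto simp: t1_def dist_real_def)
    then show "y t \<in> V" "s1 t < 0" "s2 t < 0" using \<delta>(2) by auto
  qed
  have lift: "f (chart_inv ?c (\<psi> (y t))) = \<gamma> t" if "t \<in> {t0..t1}" for t
  proof (rule cylinder_projection_inj[OF image_in_cylinder \<gamma>(3) _ _ _ expand])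
    show "frame p i \<bullet> f (chart_inv ?c (\<psi> (y t))) = frame p i \<bullet> \<gamma> t" for i
      using G.graph[OF good(1)[OF that], of i] by (simp add: y_def)
  qed (use good[OF that] in \<open>simp_all add: s1_def s2_def\<close>)
  define \<tau> where "\<tau> r = t0 + r * (t1 - t0)" for r
  have \<tau>: "\<tau> r \<in> {t0..t1}" if "r \<in> {0..1}" for r
  proof -
    have "r * (t1 - t0) \<le> 1 * (t1 - t0)" "0 \<le> r * (t1 - t0)"
      using that t1(1) by (intro mult_right_mono mult_nonneg_nonneg; simp)+
    then show ?thesis unfolding \<tau>_def by simp
  qed
  have d\<tau>: "(\<tau> has_vector_derivative (t1 - t0)) (at r within {0..1})" for r
    unfolding \<tau>_def[abs_def] by (auto intro!: derivative_eq_intros simp: has_vector_derivative_def)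
  have c\<tau>: "continuous_on S \<tau>" for S unfolding \<tau>_def[abs_def] by (intro continuous_intros)
  let ?x' = "\<lambda>r. dir_deriv ((t1 - t0) *\<^sub>R y' (\<tau> r)) \<psi> (y (\<tau> r))"
  have dyt: "((\<lambda>r. y (\<tau> r)) has_vector_derivative (t1 - t0) *\<^sub>R y' (\<tau> r)) (at r within {0..1})" for r
    using vector_diff_chain_within[OF d\<tau> has_vector_derivative_at_within[OF dy]] by (simp add: o_def)
  have dgt: "((\<lambda>r. \<gamma> (\<tau> r)) has_vector_derivative (t1 - t0) *\<^sub>R \<gamma>' (\<tau> r)) (at r within {0..1})" for r
    using vector_diff_chain_within[OF d\<tau> has_vector_derivative_at_within[OF \<gamma>(1)]] by (simp add: o_def)
  obtain L where L: "joins (chart_inv ?c (\<psi> (y (\<tau> 0)))) (chart_inv ?c (\<psi> (y (\<tau> 1)))) L" "L \<le> K * (t1 - t0)"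
  proof (rule joins_chart_curve[OF c, of "\<lambda>r. \<psi> (y (\<tau> r))" ?x' "\<lambda>r. (t1 - t0) *\<^sub>R \<gamma>' (\<tau> r)" "K * (t1 - t0)"])
    fix r :: real assume r: "r \<in> {0..1}"
    note V = good(1)[OF \<tau>[OF r]]
    show "\<psi> (y (\<tau> r)) \<in> chart_image ?c" using V U'(2,4) by (auto simp: homeomorphism_def)
    show "((\<lambda>r. \<psi> (y (\<tau> r))) has_vector_derivative ?x' r) (at r within {0..1})"
      using vector_derivative_diff_chain_within[OF dyt[of r] has_derivative_at_withinI[OF smooth_on_has_derivative[OF U'(5) V]]]
      by (simp add: o_def)
    show "((\<lambda>r. f (chart_inv ?c (\<psi> (y (\<tau> r))))) has_vector_derivative (t1 - t0) *\<^sub>R \<gamma>' (\<tau> r)) (at r within {0..1})"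
      by (rule has_vector_derivative_transform[OF r _ dgt]) (rule lift[OF \<tau>])
    show "norm ((t1 - t0) *\<^sub>R \<gamma>' (\<tau> r)) \<le> K * (t1 - t0)"
      using \<gamma>(4)[of "\<tau> r"] t1(1) by (simp add: mult.commute mult_right_mono)
  next
    have "continuous_on {0..1} (\<lambda>r. \<Sum>i\<in>UNIV. (((t1 - t0) *\<^sub>R y' (\<tau> r)) $ i) *\<^sub>R dir_deriv (axis i 1) \<psi> (y (\<tau> r)))"
    proof (intro continuous_on_sum continuous_on_scaleR)
      fix i
      show "continuous_on {0..1} (\<lambda>r. ((t1 - t0) *\<^sub>R y' (\<tau> r)) $ i)"
        by (intro continuous_intros continuous_on_compose2[OF cy' c\<tau>]) auto
      show "continuous_on {0..1} (\<lambda>r. dir_deriv (axis i 1) \<psi> (y (\<tau> r)))"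
        by (rule continuous_on_compose2[OF smooth_on_imp_continuous_on[OF smooth_on_dir_deriv[OF U'(5)]]
            continuous_on_compose2[OF cy c\<tau>]]) (use good(1) \<tau> in auto)
    qed
    then show "continuous_on {0..1} ?x'"
      by (rule continuous_on_eq) (rule dir_deriv_axis[OF smooth_on_differentiable[OF U'(5) good(1)[OF \<tau>]], symmetric])
  qed
  have "chart_inv ?c (\<psi> (y (\<tau> 0))) = p" by (simp add: \<tau>_def y0 \<psi>\<phi> x(2))
  moreover have "f (chart_inv ?c (\<psi> (y (\<tau> 1)))) = \<gamma> t1" using lift[of t1] t1 by (simp add: \<tau>_def)
  ultimately show ?thesis using t1 L by metis
qed

text \<open>
  Moving uniformly along a line and along a great circle at the same time leads from any point of the cylinder
  to any other; such a helix is lifted by completeness.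
\<close>

lemma cylinder_subset_range:
  assumes complete: "complete_riemannian \<A> g"
  shows "cylinder \<subseteq> range f"
proof
  fix z1 assume z1: "z1 \<in> cylinder"
  define z0 where "z0 = f undefined"
  have z0: "z0 \<in> cylinder" by (simp add: z0_def image_in_cylinder)
  define u where "u z = a *\<^sub>R (cross_proj z - centre)" for z
  have u: "u z \<in> {v. cross_proj v = v}" "norm (u z) = 1" if "z \<in> cylinder" for z
    using that a by (simp_all add: u_def cylinder_def linear_cmul[OF cross_proj_linear] linear_diff[OF cross_proj_linear] cross_proj_idem cross_proj_centre)
  have zu: "z = centre + (1/a) *\<^sub>R u z + (z - cross_proj z)" for z using a by (simp add: u_def)
  obtain w \<theta> where w: "w \<in> {v. cross_proj v = v}" "norm w = 1" "u z0 \<bullet> w = 0" "u z1 = cos \<theta> *\<^sub>R u z0 + sin \<theta> *\<^sub>R w"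
    using unit_vectors_angle[OF subspace_cross_proj(1) _ u[OF z0] u[OF z1]] dim_cross_proj(1) by auto
  define h where "h = (z1 - z0) - cross_proj (z1 - z0)"
  define \<gamma> where "\<gamma> t = centre + (1/a) *\<^sub>R (cos (\<theta> * t) *\<^sub>R u z0 + sin (\<theta> * t) *\<^sub>R w) + ((z0 - cross_proj z0) + t *\<^sub>R h)" for t
  define \<gamma>' where "\<gamma>' t = (1/a) *\<^sub>R ((- (\<theta> * sin (\<theta> * t))) *\<^sub>R u z0 + (\<theta> * cos (\<theta> * t)) *\<^sub>R w) + h" for t
  define K where "K = (1/a) * (\<bar>\<theta>\<bar> + \<bar>\<theta>\<bar>) + norm h"
  have d\<gamma>: "(\<gamma> has_vector_derivative \<gamma>' t) (at t)" for t
  proof -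
    define k where "k = 1 / a"
    show ?thesis
      unfolding \<gamma>_def[abs_def] \<gamma>'_def has_vector_derivative_def k_def[symmetric]
      by (auto intro!: derivative_eq_intros simp: algebra_simps)
  qed
  have c\<gamma>': "continuous_on UNIV \<gamma>'" unfolding \<gamma>'_def[abs_def] by (intro continuous_intros)
  have Ph: "cross_proj h = 0" "cross_proj (z0 - cross_proj z0) = 0" by (simp_all add: h_def linear_diff[OF cross_proj_linear] cross_proj_idem)
  have \<gamma>C: "\<gamma> t \<in> cylinder" for t
  proof -
    let ?\<sigma> = "cos (\<theta> * t) *\<^sub>R u z0 + sin (\<theta> * t) *\<^sub>R w"
    have "cross_proj (\<gamma> t) - centre = (1/a) *\<^sub>R ?\<sigma>"
      using u(1)[OF z0] w(1) unfolding \<gamma>_def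
      by (simp only: linear_add[OF cross_proj_linear] linear_cmul[OF cross_proj_linear] cross_proj_centre Ph mem_Collect_eq) simp
    moreover have "norm ?\<sigma> = 1"
    proof -
      have ip: "u z0 \<bullet> u z0 = 1" "w \<bullet> w = 1" "w \<bullet> u z0 = 0"
        using u(2)[OF z0] w(2,3) by (simp_all add: norm_eq_1 inner_commute)
      have "?\<sigma> \<bullet> ?\<sigma> = cos (\<theta> * t) * cos (\<theta> * t) + sin (\<theta> * t) * sin (\<theta> * t)"
        by (simp add: inner_add_left inner_add_right ip w(3))
      then show ?thesis
        using sin_cos_squared_add2[of "\<theta> * t"] unfolding norm_eq_1 power2_eq_square by simp
    qed
    ultimately have "norm (cross_proj (\<gamma> t) - centre) = 1 / a" using a by simp
    then show ?thesis by (simp add: cylinder_def)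
  qed
  have K: "norm (\<gamma>' t) \<le> K" for t
  proof -
    have "norm ((- (\<theta> * sin (\<theta> * t))) *\<^sub>R u z0 + (\<theta> * cos (\<theta> * t)) *\<^sub>R w)
        \<le> \<bar>\<theta> * sin (\<theta> * t)\<bar> + \<bar>\<theta> * cos (\<theta> * t)\<bar>"
      using norm_triangle_ineq[of "(- (\<theta> * sin (\<theta> * t))) *\<^sub>R u z0" "(\<theta> * cos (\<theta> * t)) *\<^sub>R w"] u(2)[OF z0] w(2) by simp
    also have "\<dots> \<le> \<bar>\<theta>\<bar> + \<bar>\<theta>\<bar>" by (intro add_mono) (simp_all add: abs_mult mult_left_le)
    finally have "(1/a) * norm ((- (\<theta> * sin (\<theta> * t))) *\<^sub>R u z0 + (\<theta> * cos (\<theta> * t)) *\<^sub>R w) \<le> (1/a) * (\<bar>\<theta>\<bar> + \<bar>\<theta>\<bar>)"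
      using a by (intro mult_left_mono) auto
    then show ?thesis
      unfolding \<gamma>'_def K_def using norm_triangle_ineq[of "(1/a) *\<^sub>R ((- (\<theta> * sin (\<theta> * t))) *\<^sub>R u z0 + (\<theta> * cos (\<theta> * t)) *\<^sub>R w)" h] a
      by simp
  qed
  have "K \<ge> 0" using K[of 0] norm_ge_zero order_trans by blast
  have g0: "f undefined = \<gamma> 0" using zu[of z0] by (simp add: \<gamma>_def z0_def)
  have g1: "\<gamma> 1 = z1"
  proof -
    have "(z0 - cross_proj z0) + h = z1 - cross_proj z1" by (simp add: h_def linear_diff[OF cross_proj_linear])
    then show ?thesis using zu[of z1] w(4) by (simp add: \<gamma>_def)
  qed
  have "\<exists>p. f p = \<gamma> 1"
  proof (rule complete_continuation[where f=f and \<gamma>=\<gamma> and d="riemannian_dist \<A> g" and K=K])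
    show "Metric_space UNIV (riemannian_dist \<A> g)" by (rule riemannian_dist_metric[OF connected_M])
    show "norm (f q - f p) \<le> riemannian_dist \<A> g p q" for p q by (rule riemannian_dist_ge[OF connected_M])
    show "K \<ge> 0" "f undefined = \<gamma> 0" by fact+
    show "Metric_space.mcomplete UNIV (riemannian_dist \<A> g)" using complete by (simp add: complete_riemannian_def)
    show "continuous_on {0..1} \<gamma>"
      using d\<gamma> by (meson continuous_on_vector_derivative has_vector_derivative_at_within)
    fix t p assume t: "0 \<le> t" "t < 1" "f p = \<gamma> t"
    obtain t1 p1 L where "t < t1 \<and> t1 \<le> 1 \<and> f p1 = \<gamma> t1 \<and> joins p p1 L \<and> L \<le> K * (t1 - t)"
      using local_lift[where \<gamma>=\<gamma> and \<gamma>'=\<gamma>' and K=K, OF t d\<gamma> c\<gamma>' \<gamma>C K] by blast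
    then show "\<exists>t' p'. t < t' \<and> t' \<le> 1 \<and> f p' = \<gamma> t' \<and> riemannian_dist \<A> g p p' \<le> K * (t' - t)"
      using riemannian_dist_le[OF connected_M] by (meson order_trans)
  qed
  then show "z1 \<in> range f" using g1 by (metis rangeI)
qed

lemma range_eq_cylinder: "complete_riemannian \<A> g \<Longrightarrow> range f = cylinder"
  using cylinder_subset_range image_in_cylinder by blast

text \<open>
  Isometries of the images of \<open>cross_proj\<close> and of the complementary projection with Euclidean spaces of
  dimensions \<open>3\<close> and \<open>4\<close> combine to the required motion.
\<close>

lemma cylinder_rigid_motion:
  "equal_up_to_rigid_motion cylinder ((UNIV :: (real^4) set) \<times> sphere (0 :: real^3) (1 / a))"
proof -
  have "dim {v. cross_proj v = 0} = dim (UNIV :: (real^4) set)" using dim_cross_proj(2) by simp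
  then obtain F F' where F: "linear F" "linear F'" "F ` {v. cross_proj v = 0} = (UNIV :: (real^4) set)" "F' ` (UNIV :: (real^4) set) = {v. cross_proj v = 0}"
    "\<And>v. v \<in> {v. cross_proj v = 0} \<Longrightarrow> norm (F v) = norm v" "\<And>u. u \<in> (UNIV :: (real^4) set) \<Longrightarrow> norm (F' u) = norm u"
    "\<And>v. v \<in> {v. cross_proj v = 0} \<Longrightarrow> F' (F v) = v" "\<And>u. u \<in> (UNIV :: (real^4) set) \<Longrightarrow> F (F' u) = u"
    by (rule isometries_subspaces[OF subspace_cross_proj(2) subspace_UNIV]) (rule that; assumption)
  have "dim {v. cross_proj v = v} = dim (UNIV :: (real^3) set)" using dim_cross_proj(1) by simp
  then obtain G G' where G: "linear G" "linear G'" "G ` {v. cross_proj v = v} = (UNIV :: (real^3) set)" "G' ` (UNIV :: (real^3) set) = {v. cross_proj v = v}"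
    "\<And>v. v \<in> {v. cross_proj v = v} \<Longrightarrow> norm (G v) = norm v" "\<And>u. u \<in> (UNIV :: (real^3) set) \<Longrightarrow> norm (G' u) = norm u"
    "\<And>v. v \<in> {v. cross_proj v = v} \<Longrightarrow> G' (G v) = v" "\<And>u. u \<in> (UNIV :: (real^3) set) \<Longrightarrow> G (G' u) = u"
    by (rule isometries_subspaces[OF subspace_cross_proj(1) subspace_UNIV]) (rule that; assumption)
  define \<Phi> where "\<Phi> z = (F (z - cross_proj z), G (cross_proj z - centre))" for z
  have in0: "z - cross_proj z \<in> {v. cross_proj v = 0}" and in1: "cross_proj z - centre \<in> {v. cross_proj v = v}" "cross_proj z \<in> {v. cross_proj v = v}" for z
    by (simp_all add: linear_diff[OF cross_proj_linear] cross_proj_idem cross_proj_centre)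
  have \<Phi>_inv: "\<Phi> (F' u + (G' v + centre)) = (u, v)" for u v
  proof -
    have "cross_proj (F' u) = 0" "cross_proj (G' v) = G' v" using F(4) G(4) by auto
    then have "cross_proj (F' u + (G' v + centre)) = G' v + centre" by (simp add: linear_add[OF cross_proj_linear] cross_proj_centre)
    then show ?thesis by (simp add: \<Phi>_def F(8) G(8))
  qed
  have "surj \<Phi>" by (rule surjI[of _ "\<lambda>(u, v). F' u + (G' v + centre)"]) (use \<Phi>_inv in auto)
  moreover have "dist (\<Phi> x) (\<Phi> y) = dist x y" for x y
  proof -
    let ?d = "x - y"
    have 1: "F (x - cross_proj x) - F (y - cross_proj y) = F (?d - cross_proj ?d)"
      by (simp add: linear_diff[OF F(1), symmetric] linear_diff[OF cross_proj_linear] algebra_simps)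
    have 2: "G (cross_proj x - centre) - G (cross_proj y - centre) = G (cross_proj ?d)"
      by (simp add: linear_diff[OF G(1), symmetric] linear_diff[OF cross_proj_linear])
    have "\<Phi> x - \<Phi> y = (F (?d - cross_proj ?d), G (cross_proj ?d))" unfolding \<Phi>_def 1[symmetric] 2[symmetric] by simp
    then have "(dist (\<Phi> x) (\<Phi> y))\<^sup>2 = (norm (?d - cross_proj ?d))\<^sup>2 + (norm (cross_proj ?d))\<^sup>2"
      using F(5)[OF in0, of ?d] G(5)[OF in1(2), of ?d] by (simp add: dist_norm norm_Pair)
    also have "\<dots> = (norm ((?d - cross_proj ?d) + cross_proj ?d))\<^sup>2"
    proof -
      have "(?d - cross_proj ?d) \<bullet> cross_proj ?d = 0"
        using cross_proj_selfadjoint[of "?d - cross_proj ?d" ?d] in0[of ?d] by simp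
      then have "orthogonal (?d - cross_proj ?d) (cross_proj ?d)" by (simp add: orthogonal_def)
      from norm_add_Pythagorean[OF this] show ?thesis by simp
    qed
    finally have "(dist (\<Phi> x) (\<Phi> y))\<^sup>2 = (dist x y)\<^sup>2" by (simp add: dist_norm)
    then show ?thesis by simp
  qed
  moreover have "\<Phi> ` cylinder = UNIV \<times> sphere 0 (1 / a)"
  proof (intro equalityI subsetI)
    fix y assume "y \<in> \<Phi> ` cylinder"
    then show "y \<in> UNIV \<times> sphere 0 (1 / a)" using G(5)[OF in1(1)] by (auto simp: \<Phi>_def cylinder_def)
  next
    fix y :: "(real^4) \<times> (real^3)" assume y: "y \<in> UNIV \<times> sphere 0 (1 / a)"
    obtain u v where uv: "y = (u, v)" by (cases y)
    let ?z = "F' u + (G' v + centre)"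
    have "G (cross_proj ?z - centre) = v" using \<Phi>_inv[of u v] by (simp add: \<Phi>_def)
    then have "norm (cross_proj ?z - centre) = norm v" using G(5)[OF in1(1), of ?z] by simp
    then have "?z \<in> cylinder" using y uv by (simp add: cylinder_def)
    then show "y \<in> \<Phi> ` cylinder" using \<Phi>_inv[of u v] uv by (metis imageI)
  qed
  ultimately show ?thesis unfolding equal_up_to_rigid_motion_def by blast
qed

end

section \<open>The classification\<close>

theorem theorem1p7:
  fixes \<A> :: "('m::{t2_space,second_countable_topology}, 6) chart set"
    and g :: "('m, 6) metric_tensor"
    and f :: "'m \<Rightarrow> real^7"
    and \<xi> :: "'m \<Rightarrow> real^7"
    and R H :: real
  assumes "smooth_atlas \<A>"
    and "connected (UNIV :: 'm set)"
    and "orientable \<A>"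
    and "riemannian_metric \<A> g"
    and "complete_riemannian \<A> g"
    and "\<And>p. scalar_curvature \<A> g p = R"
    and "isometric_immersion \<A> g f"
    and "unit_normal_field \<A> f \<xi>"
    and "H > 0"
    and "\<And>p. mean_curvature \<A> g f \<xi> 1 p = H"
    and "\<And>p. mean_curvature \<A> g f \<xi> 4 p \<ge> 0"
    and "\<And>p. mean_curvature \<A> g f \<xi> 5 p \<le> 0"
    and "R = 3/5 * H\<^sup>2"
    and "\<And>p. mean_curvature \<A> g f \<xi> 6 p \<ge> 0"
  shows "equal_up_to_rigid_motion (range f)
           ((UNIV :: (real^4) set) \<times> sphere (0 :: real^3) (1 / (3 * \<bar>H\<bar>)))"
proof -
  interpret immersed_hypersurface \<A> g f \<xi>
    by unfold_locales (use assms in simp_all)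
  have esym: "esym r (curv p) UNIV = real (6 choose r) * mean_curvature \<A> g f \<xi> r p" if "r \<le> 6" for r p
  proof -
    have "0 < (6 choose r)" using that by (rule zero_less_binomial)
    then show ?thesis by (simp add: mean_curvature_esym)
  qed
  interpret special_hypersurface \<A> g f \<xi> "3 * H"
  proof
    show "connected (UNIV :: 'm set)" "3 * H > 0" using assms by simp_all
    show "CARD(6) = 6" by simp
    fix p
    show "esym 1 (curv p) UNIV = 2 * (3 * H)" using esym[of 1 p] assms(10)[of p] by simp
    have "R = 2 / (real CARD(6) * (real CARD(6) - 1)) * esym 2 (curv p) UNIV"
      using scalar_curvature_esym[OF immersed_hypersurface_axioms, of p] assms(6)[of p] by simp
    then show "esym 2 (curv p) UNIV = (3 * H)\<^sup>2" using assms(13) by (simp add: power_mult_distrib)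
    show "esym 4 (curv p) UNIV \<ge> 0" using esym[of 4 p] assms(11)[of p] by simp
    show "esym 5 (curv p) UNIV \<le> 0" using esym[of 5 p] assms(12)[of p] by (simp add: mult_nonneg_nonpos)
    show "esym 6 (curv p) UNIV \<ge> 0" using esym[of 6 p] assms(14)[of p] by simp
  qed
  show ?thesis
    using range_eq_cylinder[OF assms(5)] cylinder_rigid_motion assms(9) by simp
qed

end
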